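(* Let $c_N=\left(E(|S_{\sigma_\alpha(N)}|^2)\right)^{1/2}$ and $d_N=\left(E(|S_{\sigma(N)}|^2)\right)^{1/2}$, where $\sigma(N)=\sigma_\alpha(N)$ with $\alpha=\infty$. Suppose that $\frac{S_{\sigma_\alpha(N)}}{c_N}$ or $\frac{S_{\sigma(N)}}{d_N}$ converges in distribution as $N\to\infty$. If $\alpha>2$, then $$\lim_{N\to\infty}\frac{S_{\sigma_\alpha(N)}}{c_N}=\lim_{N\to\infty}\frac{S_{\sigma(N)}}{d_N}\quad\text{in distribution},$$ i.e. both sequences converge in distribution and have the same limiting distribution.
   Context: $S_n=S(n)$, $n\ge 0$, is the simple random walk on $\mathbb{Z}^3$ with $S_0=0$. $N$ is a scaling parameter and $\alpha$ is a fixed exponent; at scale $N$, loops of length at most $N^\alpha$ are erased as follows. Put $\sigma_\alpha(0)=\sup\{j\ge 0: S(j)=0,\ j\le N^\alpha\}$ and, for $i>0$, $\sigma_\alpha(i)=\sup\{j>\sigma_\alpha(i-1): S(j)=S(\sigma_\alpha(i-1)+1),\ |j-\sigma_\alpha(i-1)-1|\le N^\alpha\}$. The $N^\alpha$ loop erased walk is $\hat S^{(N)}_i=S(\sigma_\alpha(i))$; $\sigma_\alpha(N)$ is $\sigma_\alpha(i)$ with $i=N$ and cutoff $N^\alpha$. When $\alpha=\infty$ there is no length restriction: $\sigma(0)=\sup\{j\ge0:S(j)=0\}$ and $\sigma(i)=\sup\{j>\sigma(i-1):S(j)=S(\sigma(i-1)+1)\}$, and $S(\sigma(i))$ is the usual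 loop erased walk. *)

theory Defs
  imports "HOL-Probability.Probability"
begin

definition unit_steps :: "(int ^ 'd) set" where
  "unit_steps = (\<Union>k. {axis k 1, axis k (-1)})"

definition simple_random_walk :: "'a measure \<Rightarrow> (nat \<Rightarrow> 'a \<Rightarrow> int ^ 'd) \<Rightarrow> bool" where
  "simple_random_walk M S \<longleftrightarrow>
     prob_space M \<and>
     (\<forall>\<omega>\<in>space M. S 0 \<omega> = 0) \<and>
     prob_space.indep_vars M (\<lambda>_. count_space UNIV) (\<lambda>n \<omega>. S (Suc n) \<omega> - S n \<omega>) UNIV \<and>
     (\<forall>n. distr M (count_space UNIV) (\<lambda>\<omega>. S (Suc n) \<omega> - S n \<omega>)
            = measure_pmf (pmf_of_set unit_steps))"

definition real_vec :: "int ^ 'd \<Rightarrow> real ^ 'd" where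
  "real_vec x = (\<chi> k. real_of_int (x $ k))"

text \<open>The maximal length \<open>N\<^sup>\<alpha>\<close> of an erased loop; \<open>\<alpha> = \<infinity>\<close> means no restriction, for every \<open>N\<close>.\<close>

definition loop_cutoff :: "ereal \<Rightarrow> nat \<Rightarrow> ereal" where
  "loop_cutoff \<alpha> N = (if \<alpha> = \<infinity> then \<infinity> else ereal (real N powr real_of_ereal \<alpha>))"

text \<open>
  The last-visit times \<open>\<sigma>(i)\<close> of a path \<open>w\<close>, with loops of length at most \<open>L\<close> erased.
  For \<open>L < \<infinity>\<close> the sets are finite. For \<open>L = \<infinity>\<close> they can be infinite, and \<open>Sup\<close> is then an
  unspecified natural number; for the simple random walk on the three-dimensional lattice this
  has probability zero, by transience.
\<close>

fun erasure_time :: "ereal \<Rightarrow> (nat \<Rightarrow> int ^ 'd) \<Rightarrow> nat \<Rightarrow> nat" where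
  "erasure_time L w 0 = Sup {j. w j = 0 \<and> ereal (real j) \<le> L}"
| "erasure_time L w (Suc i) =
     Sup {j. j > erasure_time L w i \<and> w j = w (erasure_time L w i + 1) \<and>
             ereal \<bar>real j - real (erasure_time L w i) - 1\<bar> \<le> L}"

text \<open>The random point \<open>S(\<sigma>\<^sub>\<alpha>(N))\<close>; \<open>N\<close> is both the index and the scale in the cutoff.\<close>

definition erased_walk_end ::
    "ereal \<Rightarrow> (nat \<Rightarrow> 'a \<Rightarrow> int ^ 'd) \<Rightarrow> nat \<Rightarrow> 'a \<Rightarrow> real ^ 'd" where
  "erased_walk_end \<alpha> S N \<omega> =
     real_vec (S (erasure_time (loop_cutoff \<alpha> N) (\<lambda>n. S n \<omega>) N) \<omega>)"

text \<open>
  The library's \<^const>\<open>weak_conv_m\<close> is restricted to measures on the real line, so convergence in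
  distribution is stated here by means of bounded continuous test functions.
\<close>

definition converges_in_distribution ::
    "'a measure \<Rightarrow> (nat \<Rightarrow> 'a \<Rightarrow> 'b :: topological_space) \<Rightarrow> 'b measure \<Rightarrow> bool" where
  "converges_in_distribution M X \<nu> \<longleftrightarrow>
     (\<forall>n. X n \<in> borel_measurable M) \<and>
     prob_space \<nu> \<and> sets \<nu> = sets borel \<and>
     (\<forall>f :: 'b \<Rightarrow> real. continuous_on UNIV f \<longrightarrow> bounded (range f) \<longrightarrow>
        (\<lambda>n. \<integral>\<omega>. f (X n \<omega>) \<partial>M) \<longlonglongrightarrow> (\<integral>x. f x \<partial>\<nu>))"

end

theory Submission
  imports Defs
begin

text \<open>
Write \<open>Z\<close> for the endpoint of the erased walk with cutoff \<open>L = N powr \<alpha>\<close> and \<open>W\<close> for the endpoint without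
cutoff. The normalised variables have second moment 1, so they are tight, and both assertions follow
once \<open>P(Z \<noteq> W) \<rightarrow> 0\<close> and \<open>c N / d N \<rightarrow> 1\<close> (\<open>converging_together\<close>).

Let \<open>\<alpha> = 2 + 4\<delta>\<close> and stop the walk when it first leaves the cube of radius \<open>R\<close> of order
\<open>N powr (1 + \<delta>)\<close>. Except on an event of probability \<open>o(N powr -2)\<close> this happens before time \<open>L\<close>
(\<open>stay_power_le\<close>), and then the cutoff has no influence on the loop erasure of the stopped path.
The first \<open>N\<close> erased points lie within distance \<open>N\<close> of the origin. Whatever the stopped path is,
the expected number of visits to these points after the stopping time is at most
\<open>(N + 1) C / (R - N) \<rightarrow> 0\<close>. Without such a visit, the first \<open>N\<close> points of both erased walks are
those of the stopped path (\<open>erase_append_dichotomy\<close>); hence \<open>P(Z \<noteq> W) \<rightarrow> 0\<close>.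

For the second moments a small probability is not enough: the exceptional event could carry a
large part of \<open>E |Z|^2\<close>. But after the exceptional visit the erased walk restarts along a fresh random
walk. So on this event the maximum over the first \<open>N\<close> points is at most the maximum for the
stopped path plus an independent copy of the whole maximum plus 1, and both are multiplied by the small
expected number of visits. Therefore \<open>|c^2 - d^2|\<close> is at most a small factor times
\<open>E max_{i \<le> N} |W_i|^2\<close> (\<open>cutoff_comparison\<close>).

What remains is \<open>E max_{i \<le> N} |W_i|^2 \<le> C d^2\<close>, that is, the \<open>N\<close>-th point is typically as far out as
the farthest of the first \<open>N\<close> points (\<open>second_moment_max_le\<close>). When the erased walk first reaches
sup norm \<open>r\<close>, the points found so far lie strictly inside the cube of radius \<open>r\<close>, and the tip lies on a
face. The continuation has to avoid these points. Reflecting it in the plane of the face shows that it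
leaves a slab around that plane on the outer side at least as often as on the inner side
(\<open>killed_reflection\<close>), and from the outer side it escapes with probability bounded below. Given
that it avoids the old points, it thus has probability at most 1/2 of ever entering a much smaller cube
(\<open>avoid_and_hit_centre_le\<close>), and the \<open>N\<close>-th erased point is one of the points that it visits.

All hitting and Green function estimates come from one explicit superharmonic function on the lattice,
\<open>1 / sqrt (|x|^2 + 100)\<close> (\<open>newton_superharmonic\<close>). Probabilities are computed as averages over lists
of steps of a fixed length and are transferred to the probability space at the end.
\<close>

section \<open>Lattice sites and averages over step lists\<close>

type_synonym site = "int ^ 3"

abbreviation steps :: "site set" where
  "steps \<equiv> unit_steps"

definition supn :: "site \<Rightarrow> int" where
  "supn x = Max (range (\<lambda>k. \<bar>x $ k\<bar>))"

definition sq_norm :: "site \<Rightarrow> int" where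
  "sq_norm x = (\<Sum>k\<in>UNIV. (x $ k)\<^sup>2)"

lemma steps_eq: "steps = {axis 1 1, axis 2 1, axis 3 1, axis 1 (-1), axis 2 (-1), axis 3 (-1)}"
  unfolding unit_steps_def UNIV_3 by auto

lemma finite_steps [simp]: "finite steps"
  by (simp add: steps_eq)

lemma axis_eq_axis_iff:
  fixes a b :: int
  shows "(axis k a :: site) = axis j b \<longleftrightarrow> (k = j \<and> a = b) \<or> (a = 0 \<and> b = 0)"
  by (auto simp: vec_eq_iff axis_def)

lemma sum_steps:
  fixes f :: "site \<Rightarrow> 'b::comm_monoid_add"
  shows "(\<Sum>e\<in>steps. f e) = (\<Sum>k\<in>UNIV. f (axis k 1) + f (axis k (-1)))"
proof -
  have "(\<Sum>e\<in>steps. f e) = (\<Sum>k\<in>UNIV. \<Sum>e\<in>{axis k 1, axis k (-1)}. f e)"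
    unfolding unit_steps_def
    by (rule sum.UNION_disjoint) (auto simp: axis_eq_axis_iff)
  also have "\<dots> = (\<Sum>k\<in>UNIV. f (axis k 1) + f (axis k (-1)))"
    by (intro sum.cong) (auto simp: axis_eq_axis_iff)
  finally show ?thesis .
qed

lemma card_steps [simp]: "card steps = 6"
  using sum_steps[of "\<lambda>_. 1::nat"] by simp

lemma abs_coord_le_supn: "\<bar>x $ k\<bar> \<le> supn x"
  unfolding supn_def by (rule Max_ge) auto

lemma supn_le_iff: "supn x \<le> r \<longleftrightarrow> (\<forall>k. \<bar>x $ k\<bar> \<le> r)"
  unfolding supn_def by (subst Max_le_iff) auto

lemma supn_attained: "\<exists>k. supn x = \<bar>x $ k\<bar>"
proof -
  have "Max (range (\<lambda>k. \<bar>x $ k\<bar>)) \<in> range (\<lambda>k. \<bar>x $ k\<bar>)"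
    by (rule Max_in) auto
  then show ?thesis
    unfolding supn_def by (metis (no_types, lifting) imageE)
qed

lemma supn_nonneg [simp]: "0 \<le> supn x"
  by (rule order_trans[OF _ abs_coord_le_supn[of x 1]]) auto

lemma supn_0 [simp]: "supn 0 = 0"
  by (simp add: supn_def)

lemma supn_eq_0_iff [simp]: "supn x = 0 \<longleftrightarrow> x = 0"
proof
  assume "supn x = 0"
  then show "x = 0"
    using abs_coord_le_supn[of x] by (auto simp: vec_eq_iff)
qed simp

lemma supn_triangle: "supn (x + y) \<le> supn x + supn y"
  unfolding supn_le_iff
proof
  fix k
  show "\<bar>(x + y) $ k\<bar> \<le> supn x + supn y"
    using abs_coord_le_supn[of x k] abs_coord_le_supn[of y k] by simp
qed

lemma supn_minus: "supn (- x) = supn x"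
  by (simp add: supn_def)

lemma supn_step:
  assumes "e \<in> steps"
  shows "supn e = 1"
proof -
  obtain k c where e: "e = axis k c" "\<bar>c\<bar> = 1"
    using assms unfolding unit_steps_def by force
  have "supn e \<le> 1"
    unfolding supn_le_iff e using e(2) by (simp add: axis_def)
  moreover have "1 \<le> supn e"
    using abs_coord_le_supn[of e k] e by (simp add: axis_def)
  ultimately show ?thesis by simp
qed

lemma supn_step_le:
  assumes "e \<in> steps"
  shows "supn (x + e) \<le> supn x + 1" "supn x - 1 \<le> supn (x + e)"
  using supn_triangle[of x e] supn_triangle[of "x + e" "- e"] supn_step[OF assms]
  by (simp_all add: supn_minus)

lemma coord_step: "e \<in> steps \<Longrightarrow> \<bar>e $ k\<bar> \<le> 1"
  using abs_coord_le_supn[of e k] supn_step[of e] by simp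

lemma sq_norm_nonneg [simp]: "0 \<le> sq_norm x"
  unfolding sq_norm_def by (rule sum_nonneg) auto

lemma sq_norm_le_supn: "sq_norm x \<le> 3 * (supn x)\<^sup>2"
proof -
  have "sq_norm x \<le> (\<Sum>k\<in>(UNIV::3 set). (supn x)\<^sup>2)"
    unfolding sq_norm_def
  proof (rule sum_mono)
    fix k show "(x $ k)\<^sup>2 \<le> (supn x)\<^sup>2"
      using abs_coord_le_supn[of x k] by (intro abs_le_square_iff[THEN iffD1]) simp
  qed
  then show ?thesis by simp
qed

lemma supn_le_sq_norm: "(supn x)\<^sup>2 \<le> sq_norm x"
proof -
  obtain k where k: "supn x = \<bar>x $ k\<bar>" using supn_attained by blast
  have "(x $ k)\<^sup>2 \<le> sq_norm x"
    unfolding sq_norm_def by (rule member_le_sum) auto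
  then show ?thesis by (simp add: k)
qed

lemma norm_real_vec: "(norm (real_vec x))\<^sup>2 = real_of_int (sq_norm x)"
  unfolding sq_norm_def real_vec_def norm_vec_def L2_set_def
  by (simp add: sum_nonneg)

lemma sq_norm_axis: "sq_norm (x + axis k c) = sq_norm x + 2 * c * x $ k + c\<^sup>2"
proof -
  have "sq_norm (x + axis k c) = (\<Sum>j\<in>UNIV. (x $ j)\<^sup>2 + (if j = k then 2 * c * x $ j + c\<^sup>2 else 0))"
    unfolding sq_norm_def by (intro sum.cong) (auto simp: axis_def power2_eq_square algebra_simps)
  also have "\<dots> = sq_norm x + 2 * c * x $ k + c\<^sup>2"
    by (simp add: sum.distrib sq_norm_def)
  finally show ?thesis .
qed

text \<open>
The transition operator of the walk.
\<close>

definition nbr_avg :: "(site \<Rightarrow> real) \<Rightarrow> site \<Rightarrow> real" where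
  "nbr_avg f x = (\<Sum>e\<in>steps. f (x + e)) / 6"

text \<open>
The expectation of \<open>F\<close> over \<open>n\<close> independent uniform steps. The recursion on the first step turns
statements about functions of the starting point into inductions on \<open>n\<close>, without any measure theory.
\<close>

primrec avg :: "nat \<Rightarrow> (site list \<Rightarrow> real) \<Rightarrow> real" where
  "avg 0 F = F []"
| "avg (Suc n) F = (\<Sum>e\<in>steps. avg n (\<lambda>xs. F (e # xs))) / 6"

definition words :: "nat \<Rightarrow> site list set" where
  "words n = {xs. set xs \<subseteq> steps \<and> length xs = n}"

lemma words_0 [simp]: "words 0 = {[]}"
  by (auto simp: words_def)

lemma Cons_words [simp]: "e # xs \<in> words (Suc n) \<longleftrightarrow> e \<in> steps \<and> xs \<in> words n"
  by (auto simp: words_def)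

lemma words_Suc: "words (Suc n) = (\<lambda>(e, xs). e # xs) ` (steps \<times> words n)"
  by (auto simp: words_def length_Suc_conv image_iff)

lemma words_length: "xs \<in> words n \<Longrightarrow> length xs = n"
  by (simp add: words_def)

lemma words_set: "xs \<in> words n \<Longrightarrow> set xs \<subseteq> steps"
  by (simp add: words_def)

lemma finite_words [simp]: "finite (words n)"
  by (induction n) (auto simp: words_Suc)

lemma avg_eq_sum: "avg n F = (\<Sum>xs\<in>words n. F xs) / 6 ^ n"
proof (induction n arbitrary: F)
  case (Suc n)
  have "inj_on (\<lambda>(e, xs). e # xs) (steps \<times> words n)"
    by (auto simp: inj_on_def)
  then have "(\<Sum>xs\<in>words (Suc n). F xs) = (\<Sum>e\<in>steps. \<Sum>xs\<in>words n. F (e # xs))"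
    unfolding words_Suc by (subst sum.reindex) (auto simp: sum.cartesian_product case_prod_beta)
  then show ?case
    by (simp add: Suc.IH sum_divide_distrib[symmetric])
qed simp

lemma avg_cong: "(\<And>xs. xs \<in> words n \<Longrightarrow> F xs = G xs) \<Longrightarrow> avg n F = avg n G"
  by (simp add: avg_eq_sum)

lemma avg_mono: "(\<And>xs. xs \<in> words n \<Longrightarrow> F xs \<le> G xs) \<Longrightarrow> avg n F \<le> avg n G"
  unfolding avg_eq_sum by (intro divide_right_mono sum_mono) auto

lemma avg_const [simp]: "avg n (\<lambda>_. c) = c"
  by (induction n) auto

lemma avg_add: "avg n (\<lambda>xs. F xs + G xs) = avg n F + avg n G"
  by (simp add: avg_eq_sum sum.distrib add_divide_distrib)

lemma avg_diff: "avg n (\<lambda>xs. F xs - G xs) = avg n F - avg n G"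
  by (simp add: avg_eq_sum sum_subtractf diff_divide_distrib)

lemma avg_cmult: "avg n (\<lambda>xs. c * F xs) = c * avg n F"
  by (simp add: avg_eq_sum sum_distrib_left)

lemma avg_multc: "avg n (\<lambda>xs. F xs * c) = avg n F * c"
  by (simp add: avg_eq_sum sum_distrib_right)

lemma avg_sum: "avg n (\<lambda>xs. \<Sum>i\<in>I. F i xs) = (\<Sum>i\<in>I. avg n (F i))"
  unfolding avg_eq_sum by (subst sum.swap) (simp add: sum_divide_distrib)

lemma avg_nonneg: "(\<And>xs. xs \<in> words n \<Longrightarrow> 0 \<le> F xs) \<Longrightarrow> 0 \<le> avg n F"
  using avg_mono[of n "\<lambda>_. 0" F] by simp

lemma avg_le: "(\<And>xs. xs \<in> words n \<Longrightarrow> F xs \<le> c) \<Longrightarrow> avg n F \<le> c"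
  using avg_mono[of n F "\<lambda>_. c"] by simp

text \<open>
The Markov property at a deterministic time.
\<close>

lemma avg_append: "avg (m + n) F = avg m (\<lambda>xs. avg n (\<lambda>ys. F (xs @ ys)))"
  by (induction m arbitrary: F) auto

lemma nbr_avg_mono: "(\<And>e. e \<in> steps \<Longrightarrow> f (x + e) \<le> g (x + e)) \<Longrightarrow> nbr_avg f x \<le> nbr_avg g x"
  unfolding nbr_avg_def by (intro divide_right_mono sum_mono) auto

lemma nbr_avg_const [simp]: "nbr_avg (\<lambda>_. c) x = c"
  by (simp add: nbr_avg_def)

lemma nbr_avg_add: "nbr_avg (\<lambda>x. f x + g x) x = nbr_avg f x + nbr_avg g x"
  by (simp add: nbr_avg_def sum.distrib add_divide_distrib)

lemma nbr_avg_diff: "nbr_avg (\<lambda>x. f x - g x) x = nbr_avg f x - nbr_avg g x"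
  by (simp add: nbr_avg_def sum_subtractf diff_divide_distrib)

lemma nbr_avg_cmult: "nbr_avg (\<lambda>x. c * f x) x = c * nbr_avg f x"
  by (simp add: nbr_avg_def sum_distrib_left)

lemma nbr_avg_sum: "nbr_avg (\<lambda>x. \<Sum>i\<in>I. f i x) x = (\<Sum>i\<in>I. nbr_avg (f i) x)"
  unfolding nbr_avg_def by (subst sum.swap) (simp add: sum_divide_distrib)

lemma nbr_avg_sq_norm: "nbr_avg (\<lambda>x. real_of_int (sq_norm x)) x = real_of_int (sq_norm x) + 1"
proof -
  have "nbr_avg (\<lambda>x. real_of_int (sq_norm x)) x = (\<Sum>k\<in>(UNIV::3 set). 2 * real_of_int (sq_norm x) + 2) / 6"
    unfolding nbr_avg_def sum_steps sq_norm_axis by (intro arg_cong2[where f = "(/)"] sum.cong) auto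
  then show ?thesis by simp
qed

section \<open>A superharmonic function and its consequences\<close>

lemma inverse_sqrt_le_taylor:
  fixes z :: real
  assumes "\<bar>z\<bar> \<le> 1/4"
  shows "1 / sqrt (1 + z) \<le> 1 - z/2 + 3*z^2/8 - 5*z^3/16 + z^4"
proof -
  \<comment> \<open>The polynomial is the Taylor polynomial of order 3 with an enlarged fourth-order term; the
        inequality amounts to \<open>1 \<le> (1 + z) p^2\<close>, where the difference is \<open>z^4\<close> times a polynomial \<open>Q\<close>.\<close>
  define p where "p = 1 - z/2 + 3*z^2/8 - 5*z^3/16 + z^4"
  define Q where "Q = 93/64 + 78/64*z - 99/256*z^2 + 57/256*z^3 + 3/8*z^4 + z^5"
  have pow: "\<bar>z^k\<bar> \<le> (1/4)^k" for k
    using assms by (simp add: power_abs power_mono)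
  have lin: "\<bar>z\<bar> \<le> 1/4" "\<bar>z^2\<bar> \<le> 1/16" "\<bar>z^3\<bar> \<le> 1/64" "\<bar>z^4\<bar> \<le> 1/256" "\<bar>z^5\<bar> \<le> 1/1024"
    using pow[of 1] pow[of 2] pow[of 3] pow[of 4] pow[of 5] by (simp_all add: power_divide)
  have p: "0 \<le> p"
    using lin unfolding p_def by argo
  have "0 \<le> Q"
    using lin unfolding Q_def by argo
  moreover have "(1 + z) * p^2 - 1 = z^4 * Q"
    unfolding p_def Q_def by algebra
  moreover have "0 \<le> z^4"
    by simp
  ultimately have "1 \<le> (1 + z) * p^2"
    by (smt (verit) mult_nonneg_nonneg)
  then have "sqrt 1 \<le> sqrt ((1 + z) * p^2)"
    using real_sqrt_le_iff by blast
  then have "1 \<le> sqrt (1 + z) * p"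
    using p by (simp add: real_sqrt_mult)
  moreover have "0 < sqrt (1 + z)"
    using assms by simp
  ultimately show ?thesis
    unfolding p_def[symmetric] by (simp add: field_simps)
qed

text \<open>
In three dimensions \<open>1 / |x|\<close> is the Newtonian potential, harmonic away from 0. With a positive constant
added to \<open>|x|^2\<close> the function is strictly superharmonic in the continuum, with a deficit of order
\<open>100 |x| powr -5\<close>; the constant 100 is large enough for this deficit to absorb the lattice error,
which is a fourth-order term of the same decay.
\<close>

definition newton :: "site \<Rightarrow> real" where
  "newton x = 1 / sqrt (real_of_int (sq_norm x) + 100)"

lemma newton_pos: "0 < newton x"
  unfolding newton_def using sq_norm_nonneg[of x] by (simp add: add_nonneg_pos)

text \<open>
Contribution of the two neighbours in one coordinate direction. In the expansion in \<open>(1 \<plusminus> 2t) / q\<close> the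
terms linear in \<open>t\<close> cancel. After summation over the directions, \<open>-1/q\<close> and
\<open>3 t^2 / q^2\<close> cancel up to \<open>-300 / q^2\<close>, because the squares of the coordinates add up to
\<open>q - 100\<close>; this leaves room for the errors of order \<open>1 / q^2\<close>.
\<close>

lemma newton_pair_le:
  assumes "(t::real)^2 \<le> q" "100 \<le> q"
  shows "1 / sqrt (q + 1 + 2*t) + 1 / sqrt (q + 1 - 2*t)
     \<le> (2 - 1/q + 3*t^2/q^2 + (3/4 + 33)/q^2) / sqrt q"
proof -
  have q: "0 < q" using assms by simp
  have "10 \<le> sqrt q"
    using real_le_rsqrt[of 10 q] assms by simp
  have tq: "\<bar>t\<bar> \<le> sqrt q"
    using real_sqrt_le_mono[OF assms(1)] by simp
  have "10 * sqrt q \<le> sqrt q * sqrt q"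
    using \<open>10 \<le> sqrt q\<close> q by (intro mult_right_mono) auto
  then have q4: "1 + 2 * sqrt q \<le> q / 4"
    using q \<open>10 \<le> sqrt q\<close> assms(2) by simp
  have one: "1 / sqrt (q + 1 + 2 * s) \<le> (1 - z/2 + 3*z^2/8 - 5*z^3/16 + z^4) / sqrt q"
    if "z = (1 + 2 * s) / q" "\<bar>s\<bar> \<le> sqrt q" for z s
  proof -
    have "\<bar>1 + 2 * s\<bar> \<le> q / 4" using that(2) q4 by linarith
    then have "\<bar>z\<bar> \<le> 1/4"
      using q unfolding that(1) by (simp add: abs_divide divide_le_eq)
    have "q + 1 + 2 * s = q * (1 + z)"
      using q unfolding that(1) by (simp add: field_simps)
    then have "1 / sqrt (q + 1 + 2 * s) = (1 / sqrt (1 + z)) / sqrt q"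
      by (simp add: real_sqrt_mult)
    also have "\<dots> \<le> (1 - z/2 + 3*z^2/8 - 5*z^3/16 + z^4) / sqrt q"
      using q by (intro divide_right_mono inverse_sqrt_le_taylor[OF \<open>\<bar>z\<bar> \<le> 1/4\<close>]) simp
    finally show ?thesis .
  qed
  define z1 where "z1 = (1 + 2*t) / q"
  define z2 where "z2 = (1 + 2*(-t)) / q"
  have sums: "z1 + z2 = 2/q" "z1^2 + z2^2 = (2 + 8*t^2)/q^2"
     "z1^3 + z2^3 = (2 + 24*t^2)/q^3" "z1^4 + z2^4 = (2 + 48*t^2 + 32*t^4)/q^4"
    unfolding z1_def z2_def power_divide add_divide_distrib[symmetric]
    by (simp_all add: power2_eq_square power3_eq_cube power4_eq_xxxx algebra_simps)
  have r4: "(2 + 48*t^2 + 32*t^4)/q^4 \<le> 33/q^2"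
  proof -
    have "t^4 \<le> q^2"
      using power_mono[OF assms(1), of 2] by simp
    then have "2 + 48*t^2 + 32*t^4 \<le> 2 + 48*q + 32*q^2"
      using assms(1) by simp
    also have "\<dots> \<le> 33 * q^2"
    proof -
      have "100 * q \<le> q^2"
        using assms(2) by (simp add: power2_eq_square)
      then show ?thesis using assms(2) by linarith
    qed
    finally have "(2 + 48*t^2 + 32*t^4)/q^4 \<le> 33 * q^2 / q^4"
      using q by (intro divide_right_mono) auto
    also have "\<dots> = 33/q^2"
      using q by (simp add: power2_eq_square power4_eq_xxxx)
    finally show ?thesis .
  qed
  have "1 / sqrt (q + 1 + 2*t) + 1 / sqrt (q + 1 - 2*t)
      \<le> (1 - z1/2 + 3*z1^2/8 - 5*z1^3/16 + z1^4) / sqrt q + (1 - z2/2 + 3*z2^2/8 - 5*z2^3/16 + z2^4) / sqrt q"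
    using one[of z1 t] one[of z2 "-t"] tq by (simp add: z1_def z2_def)
  also have "\<dots> = (2 - (z1 + z2)/2 + 3*(z1^2 + z2^2)/8 - 5*(z1^3 + z2^3)/16 + (z1^4 + z2^4)) / sqrt q"
    by (simp add: add_divide_distrib diff_divide_distrib algebra_simps)
  also have "\<dots> \<le> (2 - 1/q + 3*t^2/q^2 + (3/4 + 33)/q^2) / sqrt q"
  proof (rule divide_right_mono)
    have "0 \<le> 5 * ((2 + 24*t^2)/q^3)/16"
      using q by simp
    moreover have "3 * ((2 + 8*t^2)/q^2)/8 = 3/4/q^2 + 3*t^2/q^2"
      using q by (simp add: field_simps)
    moreover have "(3/4 + 33)/q^2 = 3/4/q^2 + 33/q^2"
      by (simp add: add_divide_distrib)
    ultimately show "2 - (z1 + z2)/2 + 3*(z1^2 + z2^2)/8 - 5*(z1^3 + z2^3)/16 + (z1^4 + z2^4)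
        \<le> 2 - 1/q + 3*t^2/q^2 + (3/4 + 33)/q^2"
      unfolding sums using r4 by simp
  qed (use q in simp)
  finally show ?thesis .
qed

lemma newton_superharmonic: "nbr_avg newton x \<le> newton x"
proof -
  define q where "q = real_of_int (sq_norm x) + 100"
  have q: "100 \<le> q" unfolding q_def using sq_norm_nonneg[of x] by simp
  have coord: "(real_of_int (x $ k))^2 \<le> q" for k
  proof -
    have "(x $ k)\<^sup>2 \<le> sq_norm x"
      unfolding sq_norm_def by (rule member_le_sum) auto
    then have "real_of_int ((x $ k)\<^sup>2) \<le> real_of_int (sq_norm x)"
      by (simp only: of_int_le_iff)
    then show ?thesis unfolding q_def of_int_power by linarith
  qed
  have nb: "newton (x + axis k c) = 1 / sqrt (q + 1 + 2 * (real_of_int c * real_of_int (x $ k)))"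
    if "c^2 = 1" for k and c :: int
    unfolding newton_def sq_norm_axis q_def that by (simp add: algebra_simps)
  have "6 * nbr_avg newton x = (\<Sum>k\<in>UNIV. newton (x + axis k 1) + newton (x + axis k (-1)))"
    unfolding nbr_avg_def sum_steps by simp
  also have "\<dots> \<le> (\<Sum>k\<in>(UNIV::3 set). (2 - 1/q + 3*(real_of_int (x $ k))^2/q^2 + (3/4 + 33)/q^2) / sqrt q)"
  proof (rule sum_mono)
    fix k
    show "newton (x + axis k 1) + newton (x + axis k (-1))
        \<le> (2 - 1/q + 3*(real_of_int (x $ k))^2/q^2 + (3/4 + 33)/q^2) / sqrt q"
      using newton_pair_le[OF coord q, of k] nb[of 1 k] nb[of "-1" k] by simp
  qed
  also have "\<dots> = (\<Sum>k\<in>(UNIV::3 set). 2 - 1/q + (3/4 + 33)/q^2 + (3/q^2)*(real_of_int (x $ k))^2) / sqrt q"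
    unfolding sum_divide_distrib by (intro sum.cong) auto
  also have "\<dots> = (6 - 3/q + 3*(3/4 + 33)/q^2 + (3/q^2) * real_of_int (sq_norm x)) / sqrt q"
    unfolding sum.distrib sum_distrib_left[symmetric] sq_norm_def by simp
  also have "\<dots> \<le> 6 / sqrt q"
  proof (rule divide_right_mono)
    have "real_of_int (sq_norm x) = q - 100" by (simp add: q_def)
    then have "(3/q^2) * real_of_int (sq_norm x) = 3/q - 300/q^2"
      using q by (simp add: field_simps power2_eq_square)
    moreover have "3*(3/4 + 33)/q^2 \<le> 300/q^2"
      by (intro divide_right_mono) auto
    ultimately show "6 - 3/q + 3*(3/4 + 33)/q^2 + (3/q^2) * real_of_int (sq_norm x) \<le> 6"
      by linarith
  qed (use q in simp)
  finally show ?thesis by (simp add: newton_def q_def)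
qed

lemma newton_le_supn:
  assumes "t \<le> supn x" "0 < t"
  shows "newton x \<le> 1 / real_of_int t"
proof -
  have "(real_of_int t)^2 \<le> (real_of_int (supn x))^2"
    using assms by (intro power_mono) auto
  also have "\<dots> \<le> real_of_int (sq_norm x)"
    using supn_le_sq_norm[of x] by (metis of_int_le_iff of_int_power)
  finally have "real_of_int t \<le> sqrt (real_of_int (sq_norm x) + 100)"
    by (intro real_le_rsqrt) linarith
  then show ?thesis
    unfolding newton_def using assms(2) by (intro divide_left_mono mult_pos_pos) (auto intro: add_nonneg_pos)
qed

lemma newton_ge_supn:
  assumes "real_of_int (supn x) \<le> t"
  shows "1 / sqrt (3 * t^2 + 100) \<le> newton x"
proof -
  have "real_of_int (sq_norm x) \<le> real_of_int (3 * (supn x)\<^sup>2)"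
    using sq_norm_le_supn[of x] by (simp only: of_int_le_iff)
  also have "\<dots> \<le> 3 * t^2"
    using power_mono[OF assms, of 2] by simp
  finally show ?thesis
    unfolding newton_def using sq_norm_nonneg[of x]
    by (intro divide_left_mono) (auto intro!: mult_pos_pos add_nonneg_pos)
qed

primrec avoids :: "site set \<Rightarrow> site \<Rightarrow> site list \<Rightarrow> bool" where
  "avoids K x [] \<longleftrightarrow> x \<notin> K"
| "avoids K x (e # xs) \<longleftrightarrow> x \<notin> K \<and> avoids K (x + e) xs"

definition escape :: "site set \<Rightarrow> nat \<Rightarrow> site \<Rightarrow> real" where
  "escape K n x = avg n (\<lambda>xs. of_bool (avoids K x xs))"

lemma escape_0: "escape K 0 x = of_bool (x \<notin> K)"
  by (simp add: escape_def)

lemma escape_Suc: "escape K (Suc n) x = (if x \<in> K then 0 else nbr_avg (escape K n) x)"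
  by (simp add: escape_def nbr_avg_def)

lemma escape_nonneg: "0 \<le> escape K n x"
  unfolding escape_def by (rule avg_nonneg) auto

lemma escape_le_1: "escape K n x \<le> 1"
  unfolding escape_def by (rule avg_le) auto

lemma avoids_append: "avoids K x (xs @ ys) \<longleftrightarrow> avoids K x xs \<and> avoids K (x + sum_list xs) ys"
  by (induction xs arbitrary: x) (auto simp: add.assoc, metis avoids.simps list.exhaust)

lemma avoids_iff: "avoids K x xs \<longleftrightarrow> (\<forall>j\<le>length xs. x + sum_list (take j xs) \<notin> K)"
proof (induction xs arbitrary: x)
  case (Cons e xs)
  show ?case
    unfolding avoids.simps Cons.IH
  proof safe
    fix j assume "x \<notin> K" "\<forall>j\<le>length xs. x + e + sum_list (take j xs) \<notin> K"
      "j \<le> length (e # xs)" "x + sum_list (take j (e # xs)) \<in> K"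
    then show False by (cases j) (auto simp: add.assoc)
  next
    assume *: "\<forall>j\<le>length (e # xs). x + sum_list (take j (e # xs)) \<notin> K"
    { assume "x \<in> K" then show False using *[rule_format, of 0] by simp }
    fix j assume "j \<le> length xs" "x + e + sum_list (take j xs) \<in> K"
    then show False using *[rule_format, of "Suc j"] by (simp add: add.assoc)
  qed
qed simp

text \<open>
A nonnegative superharmonic function that is at least 1 on \<open>K\<close> dominates the probability of hitting \<open>K\<close>.
\<close>

lemma hit_le:
  assumes "0 < m" "\<And>y. y \<in> K \<Longrightarrow> m \<le> newton y"
  shows "1 - escape K n x \<le> newton x / m"
proof (induction n arbitrary: x)
  case 0
  show ?case
    using assms(2)[of x] assms(1) newton_pos[of x] by (auto simp: escape_0 field_simps)
next
  case (Suc n)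
  show ?case
  proof (cases "x \<in> K")
    case True
    then show ?thesis using assms(2)[of x] assms(1) by (simp add: escape_Suc field_simps)
  next
    case False
    then have "1 - escape K (Suc n) x = nbr_avg (\<lambda>y. 1 - escape K n y) x"
      by (simp add: escape_Suc nbr_avg_diff)
    also have "\<dots> \<le> nbr_avg (\<lambda>y. (1 / m) * newton y) x"
      by (rule nbr_avg_mono) (use Suc.IH in simp)
    also have "\<dots> \<le> (1 / m) * newton x"
      unfolding nbr_avg_cmult using assms(1) newton_superharmonic by (intro mult_left_mono) auto
    finally show ?thesis by simp
  qed
qed

text \<open>
The reciprocal of the superharmonicity deficit of the potential at 0, so that the multiple of the potential by
this constant decreases by exactly 1 under the transition operator at 0 and dominates the Green function.
\<close>

definition green_const :: real where
  "green_const = 1 / (1 / 10 - 1 / sqrt 101)"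

lemma green_const_pos: "0 < green_const"
proof -
  have "sqrt 100 < sqrt (101::real)" by (simp only: real_sqrt_less_iff)
  then have "1 / sqrt 101 < 1 / (10::real)" by (intro divide_strict_left_mono) auto
  then show ?thesis by (simp add: green_const_def)
qed

lemma sq_norm_0 [simp]: "sq_norm 0 = 0"
  by (simp add: sq_norm_def)

lemma nbr_avg_newton_0: "nbr_avg newton 0 = 1 / sqrt 101"
proof -
  have "newton e = 1 / sqrt 101" if "e \<in> steps" for e
    proof -
    have "sq_norm e = 1"
      using that sq_norm_axis[of 0] unfolding unit_steps_def by (auto simp: sq_norm_0)
    then show ?thesis by (simp add: newton_def)
  qed
  then show ?thesis by (simp add: nbr_avg_def)
qed

lemma expected_visits_le:
  "(\<Sum>v<H. avg v (\<lambda>ys. of_bool (z + sum_list ys = x))) \<le> green_const * newton (z - x)"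
proof (induction H arbitrary: z)
  case 0
  show ?case using green_const_pos newton_pos[of "z - x"] by simp
next
  case (Suc H)
  have "(\<Sum>v<Suc H. avg v (\<lambda>ys. of_bool (z + sum_list ys = x)))
      = of_bool (z = x) + (\<Sum>v<H. avg (Suc v) (\<lambda>ys. of_bool (z + sum_list ys = x)))"
    by (subst sum.lessThan_Suc_shift) simp
  also have "(\<Sum>v<H. avg (Suc v) (\<lambda>ys. of_bool (z + sum_list ys = x)))
      = nbr_avg (\<lambda>y. \<Sum>v<H. avg v (\<lambda>ys. of_bool (y + sum_list ys = x))) z"
    unfolding nbr_avg_sum by (simp add: nbr_avg_def add.assoc)
  also have "\<dots> \<le> nbr_avg (\<lambda>y. green_const * newton (y - x)) z"
    by (rule nbr_avg_mono) (rule Suc.IH)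
  also have "\<dots> = green_const * nbr_avg newton (z - x)"
    unfolding nbr_avg_cmult by (simp add: nbr_avg_def algebra_simps)
  finally have "(\<Sum>v<Suc H. avg v (\<lambda>ys. of_bool (z + sum_list ys = x)))
      \<le> of_bool (z = x) + green_const * nbr_avg newton (z - x)" by simp
  also have "\<dots> \<le> green_const * newton (z - x)"
  proof (cases "z = x")
    case True
    have "green_const * (1 / 10 - 1 / sqrt 101) = 1"
      using green_const_pos by (simp add: green_const_def)
    then show ?thesis
      using True by (simp add: nbr_avg_newton_0 newton_def sq_norm_def algebra_simps)
  next
    case False
    then show ?thesis
      using green_const_pos newton_superharmonic[of "z - x"] by simp
  qed
  finally show ?case .
qed

text \<open>
Since \<open>|S_n|^2 - n\<close> is a martingale, the expected time spent in the cube is at most the largest value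
of \<open>|x|^2\<close> on exit, which is \<open>3 R^2\<close>. The factor \<open>n\<close> arises because staying for \<open>n\<close> steps means having spent \<open>n\<close> units of
time there.
\<close>

lemma stay_le:
  assumes "supn z \<le> R"
  shows "real n * escape {x. R \<le> supn x} n z \<le> 3 * (real_of_int R)^2 - real_of_int (sq_norm z)"
  using assms
proof (induction n arbitrary: z)
  case (Suc n)
  define h where "h = escape {x. R \<le> supn x}"
  have sq_norm: "real_of_int (sq_norm y) \<le> 3 * (real_of_int R)^2" if "supn y \<le> R" for y
  proof -
    have "(supn y)\<^sup>2 \<le> R\<^sup>2" using that by (intro power_mono) auto
    then have "sq_norm y \<le> 3 * R\<^sup>2" using sq_norm_le_supn[of y] by linarith
    then have "real_of_int (sq_norm y) \<le> real_of_int (3 * R\<^sup>2)" by (simp only: of_int_le_iff)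
    then show ?thesis by simp
  qed
  show ?case
  proof (cases "R \<le> supn z")
    case True
    then show ?thesis using sq_norm[OF Suc.prems] by (simp add: escape_Suc)
  next
    case False
    have "real (Suc n) * h (Suc n) z = nbr_avg (\<lambda>y. real n * h n y) z + nbr_avg (h n) z"
      using False by (simp add: h_def escape_Suc nbr_avg_cmult algebra_simps)
    also have "nbr_avg (h n) z \<le> nbr_avg (\<lambda>_. 1) z"
      unfolding h_def by (rule nbr_avg_mono) (rule escape_le_1)
    also have "nbr_avg (\<lambda>y. real n * h n y) z \<le> nbr_avg (\<lambda>y. 3 * (real_of_int R)^2 - real_of_int (sq_norm y)) z"
    proof (rule nbr_avg_mono)
      fix e assume "e \<in> steps"
      then have "supn (z + e) \<le> R" using supn_step_le(1)[of e z] False by simp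
      then show "real n * h n (z + e) \<le> 3 * (real_of_int R)^2 - real_of_int (sq_norm (z + e))"
        unfolding h_def by (rule Suc.IH)
    qed
    finally show ?thesis
      by (simp add: nbr_avg_diff nbr_avg_sq_norm h_def)
  qed
next
  case 0
  have "(supn z)\<^sup>2 \<le> R\<^sup>2" using 0 by (intro power_mono) auto
  then have "sq_norm z \<le> 3 * R\<^sup>2" using sq_norm_le_supn[of z] by linarith
  then have "real_of_int (sq_norm z) \<le> real_of_int (3 * R\<^sup>2)" by (simp only: of_int_le_iff)
  then show ?case by simp
qed

lemma escape_add_le:
  assumes "\<And>y. escape K n y \<le> c"
  shows "escape K (m + n) x \<le> escape K m x * c"
proof -
  have "escape K (m + n) x = avg m (\<lambda>xs. of_bool (avoids K x xs) * escape K n (x + sum_list xs))"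
    unfolding escape_def avg_append avg_cmult[symmetric]
    by (intro avg_cong) (auto simp: avoids_append)
  also have "\<dots> \<le> avg m (\<lambda>xs. of_bool (avoids K x xs) * c)"
    by (intro avg_mono mult_left_mono assms) auto
  also have "\<dots> = escape K m x * c"
    by (simp add: escape_def avg_multc)
  finally show ?thesis .
qed

lemma stay_power_le:
  assumes "0 < b" "0 \<le> R"
  shows "escape {x. R \<le> supn x} (k * b) z \<le> (3 * (real_of_int R)^2 / real b) ^ k"
proof (induction k arbitrary: z)
  case 0
  show ?case by (simp add: escape_0)
next
  case (Suc k)
  have one: "escape {x. R \<le> supn x} b y \<le> 3 * (real_of_int R)^2 / real b" for y
  proof (cases "supn y \<le> R")
    case True
    show ?thesis
    proof -
      have "0 \<le> real_of_int (sq_norm y)" by simp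
      then have "real b * escape {x. R \<le> supn x} b y \<le> 3 * (real_of_int R)^2"
        using stay_le[OF True, of b] by linarith
      then show ?thesis using assms(1) by (simp add: field_simps)
    qed
  next
    case False
    obtain b' where "b = Suc b'" using assms(1) by (cases b) auto
    then show ?thesis using False by (simp add: escape_Suc)
  qed
  have "escape {x. R \<le> supn x} (k * b + b) z
      \<le> escape {x. R \<le> supn x} (k * b) z * (3 * (real_of_int R)^2 / real b)"
    by (rule escape_add_le) (rule one)
  also have "\<dots> \<le> (3 * (real_of_int R)^2 / real b) ^ k * (3 * (real_of_int R)^2 / real b)"
    by (intro mult_right_mono Suc.IH) auto
  finally show ?case by (simp add: add.commute mult.commute)
qed

section \<open>Reflection and escape from a cube\<close>

definition flip :: "3 \<Rightarrow> int \<Rightarrow> site \<Rightarrow> site" where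
  "flip k c x = (\<chi> j. if j = k then 2 * c - x $ k else x $ j)"

lemma flip_coord [simp]: "flip k c x $ k = 2 * c - x $ k"
  by (simp add: flip_def)

lemma flip_flip [simp]: "flip k c (flip k c x) = x"
  by (simp add: flip_def vec_eq_iff)

lemma flip_fixed: "x $ k = c \<Longrightarrow> flip k c x = x"
  by (simp add: flip_def vec_eq_iff)

lemma flip_add_axis:
  "flip k c (x + axis j a) = flip k c x + axis j (if j = k then - a else a)"
  by (auto simp: flip_def vec_eq_iff axis_def)

lemma sum_steps_flip:
  fixes f :: "site \<Rightarrow> real"
  shows "(\<Sum>e\<in>steps. f (flip k c x + e)) = (\<Sum>e\<in>steps. f (flip k c (x + e)))"
  unfolding sum_steps by (intro sum.cong) (auto simp: flip_add_axis)

lemma nbr_avg_flip: "nbr_avg f (flip k c x) = nbr_avg (\<lambda>y. f (flip k c y)) x"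
  unfolding nbr_avg_def sum_steps_flip ..

text \<open>
Reward of a walk that is stopped on entering \<open>K\<close> (reward 0), on entering the set \<open>stop\<close> (reward \<open>b\<close>), or
after \<open>n\<close> steps (reward \<open>t\<close>).
\<close>

primrec killed :: "site set \<Rightarrow> (site \<Rightarrow> bool) \<Rightarrow> (site \<Rightarrow> real) \<Rightarrow> real \<Rightarrow> nat \<Rightarrow> site \<Rightarrow> real" where
  "killed K stop b t 0 x = (if x \<in> K then 0 else if stop x then b x else t)"
| "killed K stop b t (Suc n) x =
     (if x \<in> K then 0 else if stop x then b x else nbr_avg (killed K stop b t n) x)"

text \<open>
The reflection argument. The walk is stopped at distance \<open>s\<close> from a lattice plane and receives \<open>\<beta>\<close> on the
outer and \<open>-\<beta>\<close> on the inner side; the obstacle \<open>K\<close> lies on the inner side only. Of a site and its mirror image,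
only the inner one can be in the obstacle, so the two expected rewards have a nonnegative sum. On the plane itself a
site is its own mirror image, and therefore the expected reward from the plane is nonnegative. Both claims
support each other in the induction on the number of steps.
\<close>

lemma killed_reflection:
  fixes \<sigma> :: int
  assumes sgn: "\<sigma> = 1 \<or> \<sigma> = -1"
    and K: "\<And>x. x \<in> K \<Longrightarrow> \<sigma> * x $ k < c"
    and s: "0 < s" and t: "0 \<le> t" and \<beta>: "0 \<le> \<beta>"
  defines "u \<equiv> killed K (\<lambda>x. s \<le> \<bar>\<sigma> * x $ k - c\<bar>) (\<lambda>x. if c \<le> \<sigma> * x $ k then \<beta> else - \<beta>) t"
  shows "c \<le> \<sigma> * x $ k \<Longrightarrow> 0 \<le> u n x"
    and "0 \<le> u n x + u n (flip k (\<sigma> * c) x)"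
proof -
  define l where "l x = \<sigma> * x $ k" for x :: site
  define r where "r = flip k (\<sigma> * c)"
  have l_r: "l (r x) = 2 * c - l x" for x
    using sgn by (auto simp: l_def r_def)
  have u_0: "u 0 x = (if x \<in> K then 0 else if s \<le> \<bar>l x - c\<bar> then (if c \<le> l x then \<beta> else - \<beta>) else t)" for x
    by (simp add: u_def l_def)
  have u_Suc: "u (Suc n) x = (if x \<in> K then 0 else if s \<le> \<bar>l x - c\<bar> then (if c \<le> l x then \<beta> else - \<beta>)
      else nbr_avg (u n) x)" for n x
    by (simp add: u_def l_def)
  have K': "x \<in> K \<Longrightarrow> l x < c" for x
    using K by (simp add: l_def)
  have step: "l x - 1 \<le> l (x + e)" if "e \<in> steps" for x e
    using coord_step[OF that, of k] sgn by (auto simp: l_def algebra_simps)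
  have main: "(\<forall>x. c \<le> l x \<longrightarrow> 0 \<le> u n x) \<and> (\<forall>x. 0 \<le> u n x + u n (r x))" for n
  proof (induction n)
    case 0
    have right: "0 \<le> u 0 x" if "c \<le> l x" for x
      using that K'[of x] t \<beta> by (auto simp: u_0)
    moreover have half: "0 \<le> u 0 x + u 0 (r x)" if "c \<le> l x" for x
      using that right[OF that] K'[of x] K'[of "r x"] t \<beta> s by (auto simp: u_0 l_r abs_if)
    ultimately show ?case
      using half[of "r x" for x] by (smt (verit) l_r flip_flip r_def)
  next
    case (Suc n)
    \<comment> \<open>Reflection permutes the steps, so the two sums over neighbours run over mirror pairs.\<close>
    have nbr_avg_pair: "0 \<le> nbr_avg (u n) x + nbr_avg (u n) (r x)" for x
    proof -
      have "0 = nbr_avg (\<lambda>_. 0) x" by simp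
      also have "\<dots> \<le> nbr_avg (\<lambda>y. u n y + u n (r y)) x"
        by (rule nbr_avg_mono) (use Suc.IH in blast)
      finally show ?thesis by (simp add: nbr_avg_add r_def nbr_avg_flip)
    qed
    have nbr_avg_right: "0 \<le> nbr_avg (u n) x" if "c \<le> l x" for x
    proof (cases "l x = c")
      case True
      then have "r x = x" using sgn by (auto simp: r_def l_def intro!: flip_fixed)
      then show ?thesis using nbr_avg_pair[of x] by simp
    next
      case False
      have "nbr_avg (\<lambda>_. 0) x \<le> nbr_avg (u n) x"
      proof (rule nbr_avg_mono)
        fix e assume "e \<in> steps"
        then have "c \<le> l (x + e)" using step[of e x] that False by simp
        then show "0 \<le> u n (x + e)" using Suc.IH by blast
      qed
      then show ?thesis by simp
    qed
    have right: "0 \<le> u (Suc n) x" if "c \<le> l x" for x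
      using that nbr_avg_right \<beta> by (auto simp: u_Suc)
    moreover have half: "0 \<le> u (Suc n) x + u (Suc n) (r x)" if "c \<le> l x" for x
    proof (cases "r x \<in> K")
      case True
      then show ?thesis using right[OF that] by (simp add: u_Suc[of n "r x"])
    next
      case False
      then show ?thesis
        using that nbr_avg_pair[of x] K'[of x] s \<beta> by (auto simp: u_Suc l_r abs_if)
    qed
    ultimately show ?case
      using half[of "r x" for x] by (smt (verit) l_r flip_flip r_def)
  qed
  show "c \<le> \<sigma> * x $ k \<Longrightarrow> 0 \<le> u n x" "0 \<le> u n x + u n (flip k (\<sigma> * c) x)"
    using main[of n] unfolding l_def r_def by auto
qed

lemma escape_far:
  assumes "1 \<le> r" "10 \<le> r" and K: "\<And>y. y \<in> K \<Longrightarrow> supn y < r"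
    and "4 * r \<le> supn x"
  shows "1 / 2 \<le> escape K n x"
proof -
  define m where "m = 1 / sqrt (3 * (real_of_int r)^2 + 100)"
  have "100 \<le> (real_of_int r)^2"
    using power_mono[of 10 "real_of_int r" 2] assms(2) by simp
  then have "sqrt (3 * (real_of_int r)^2 + 100) \<le> 2 * real_of_int r"
    using assms(1) by (intro real_le_lsqrt) (auto simp: power_mult_distrib)
  moreover have pos: "0 < sqrt (3 * (real_of_int r)^2 + 100)"
    by (simp add: add_nonneg_pos)
  ultimately have inv: "1 / m \<le> 2 * real_of_int r"
    by (simp add: m_def)
  have "1 - escape K n x \<le> newton x / m"
  proof (rule hit_le)
    show "0 < m" using pos by (simp add: m_def)
    fix y assume "y \<in> K"
    then show "m \<le> newton y"
      unfolding m_def using K[of y] by (intro newton_ge_supn) simp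
  qed
  also have "\<dots> = newton x * (1 / m)" by simp
  also have "\<dots> \<le> (1 / real_of_int (4 * r)) * (2 * real_of_int r)"
 
    using inv newton_pos[of x] assms pos by (intro mult_mono newton_le_supn) (auto simp: m_def)
  also have "\<dots> = 1 / 2" using assms(1) by simp
  finally show ?thesis by simp
qed

text \<open>
From distance \<open>d\<close> outside the plane of a face, a walk doubles its distance before reaching that plane
with probability at least 1/2, by symmetry.
\<close>

lemma escape_doubling:
  fixes \<sigma> r d :: int
  assumes sgn: "\<sigma> = 1 \<or> \<sigma> = -1"
    and K: "\<And>y. y \<in> K \<Longrightarrow> supn y < r" and d: "1 \<le> d"
    and \<kappa>: "0 \<le> \<kappa>" "\<kappa> \<le> 1"
    and far: "\<And>n z. r + 2 * d \<le> \<sigma> * z $ k \<Longrightarrow> \<kappa> \<le> escape K n z"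
    and x: "r + d \<le> \<sigma> * x $ k"
  shows "\<kappa> / 2 \<le> escape K n x"
proof -
  define c where "c = \<sigma> * x $ k"
  define s where "s = c - r"
  have s: "d \<le> s" using x by (simp add: s_def c_def)
  have notK: "y \<notin> K" if "r \<le> \<sigma> * y $ k" for y
    using K[of y] abs_coord_le_supn[of y k] that sgn by auto
  define u where "u = killed {} (\<lambda>x. s \<le> \<bar>\<sigma> * x $ k - c\<bar>)
     (\<lambda>x. if c \<le> \<sigma> * x $ k then \<kappa> / 2 else - (\<kappa> / 2)) (1 - \<kappa> / 2)"
  \<comment> \<open>The rewards are \<open>\<kappa>\<close> on the outer side, 0 on the inner side and 1 if the slab is not left;
        subtracting \<open>\<kappa> / 2\<close> makes them antisymmetric.\<close>
  have "\<kappa> / 2 + u n y \<le> escape K n y" if "\<bar>\<sigma> * y $ k - c\<bar> \<le> s" for n y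
    using that
  proof (induction n arbitrary: y)
    case 0
    show ?case
    proof (cases "s \<le> \<bar>\<sigma> * y $ k - c\<bar>")
      case True
      then show ?thesis
        using far[of y 0] escape_nonneg[of K 0 y] s by (auto simp: u_def s_def)
    next
      case False
      then have "y \<notin> K" by (intro notK) (auto simp: s_def)
      then show ?thesis using False by (simp add: u_def escape_0)
    qed
  next
    case (Suc n)
    show ?case
    proof (cases "s \<le> \<bar>\<sigma> * y $ k - c\<bar>")
      case True
      then show ?thesis
        using far[of y "Suc n"] escape_nonneg[of K "Suc n" y] s by (auto simp: u_def s_def)
    next
      case False
      then have "y \<notin> K" by (intro notK) (auto simp: s_def)
      have "nbr_avg (\<lambda>z. \<kappa> / 2 + u n z) y \<le> nbr_avg (escape K n) y"
      proof (rule nbr_avg_mono)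
        fix e assume "e \<in> steps"
        then have "\<bar>\<sigma> * (y + e) $ k - c\<bar> \<le> s"
          using coord_step[of e k] False sgn by (auto simp: algebra_simps)
        then show "\<kappa> / 2 + u n (y + e) \<le> escape K n (y + e)" by (rule Suc.IH)
      qed
      then show ?thesis using False \<open>y \<notin> K\<close> by (simp add: escape_Suc nbr_avg_add u_def)
    qed
  qed
  from this[of x n] have "\<kappa> / 2 + u n x \<le> escape K n x"
    using s d by (simp add: c_def)
  moreover have "0 \<le> u n x"
    unfolding u_def using \<kappa> s d
    by (intro killed_reflection(1)[OF sgn]) (auto simp: c_def)
  ultimately show ?thesis by simp
qed

text \<open>
Four doublings lead from distance \<open>3 r / 16\<close> to distance \<open>3 r\<close>, where the potential bounds the
probability of ever hitting the cube by 1/2.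
\<close>

lemma escape_half_space:
  fixes \<sigma> r d :: int
  assumes sgn: "\<sigma> = 1 \<or> \<sigma> = -1"
    and K: "\<And>y. y \<in> K \<Longrightarrow> supn y < r" and d: "1 \<le> d" "10 \<le> r" "3 * r \<le> 16 * d"
    and x: "r + d \<le> \<sigma> * x $ k"
  shows "1 / 32 \<le> escape K n x"
proof -
  have e16: "1 / 2 \<le> escape K n z" if "r + 16 * d \<le> \<sigma> * z $ k" for n z
  proof (rule escape_far[OF _ d(2) K])
    show "1 \<le> r" "4 * r \<le> supn z"
      using that d abs_coord_le_supn[of z k] sgn by auto
  qed
  have e8: "1 / 4 \<le> escape K n z" if "r + 8 * d \<le> \<sigma> * z $ k" for n z
    using escape_doubling[OF sgn K, where d = "8 * d" and \<kappa> = "1 / 2" and k = k and x = z and n = n] e16 that d by simp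
  have e4: "1 / 8 \<le> escape K n z" if "r + 4 * d \<le> \<sigma> * z $ k" for n z
    using escape_doubling[OF sgn K, where d = "4 * d" and \<kappa> = "1 / 4" and k = k and x = z and n = n] e8 that d by simp
  have e2: "1 / 16 \<le> escape K n z" if "r + 2 * d \<le> \<sigma> * z $ k" for n z
    using escape_doubling[OF sgn K, where d = "2 * d" and \<kappa> = "1 / 8" and k = k and x = z and n = n] e4 that d by simp
  show ?thesis
    using escape_doubling[OF sgn K, where d = "d" and \<kappa> = "1 / 16" and k = k and x = x and n = n] e2 x d by simp
qed

text \<open>
The ratio of the radii of the outer and the central cube. Any sufficiently large constant works: it makes the
probability of hitting the central cube small compared with the escape probability 1/32.
\<close>

definition ratio :: int where "ratio = 4000"

lemma hit_centre_le:
  assumes r: "ratio \<le> r" and x: "r \<le> 2 * supn x"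
  shows "1 - escape {y. ratio * supn y < r} n x \<le> 1 / 128"
proof -
  define t where "t = real_of_int r / 4000"
  define m where "m = 1 / sqrt (3 * t^2 + 100)"
  have t: "1 \<le> t" using r by (simp add: t_def ratio_def)
  have "3 * t^2 + 100 \<le> (15 * t)^2"
    using one_le_power[OF t, of 2] by (simp add: power_mult_distrib)
  then have "sqrt (3 * t^2 + 100) \<le> 15 * t"
    using t by (intro real_le_lsqrt) auto
  then have inv: "1 / m \<le> 15 * t" by (simp add: m_def)
  have pos: "0 < sqrt (3 * t^2 + 100)"
    by (simp add: add_nonneg_pos)
  have supn_pos: "0 < supn x" using r x by (simp add: ratio_def)
  have "1 - escape {y. ratio * supn y < r} n x \<le> newton x / m"
  proof (rule hit_le)
    show "0 < m" using pos by (simp add: m_def)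
    fix y assume "y \<in> {y. ratio * supn y < r}"
    then have "real_of_int (ratio * supn y) \<le> real_of_int r" by (simp only: of_int_le_iff) simp
    then have "real_of_int (supn y) \<le> t" by (simp add: t_def ratio_def)
    then show "m \<le> newton y" unfolding m_def by (rule newton_ge_supn)
  qed
  also have "\<dots> = newton x * (1 / m)" by simp
  also have "\<dots> \<le> (1 / real_of_int (supn x)) * (15 * t)"
    using inv newton_pos[of x] supn_pos t pos by (intro mult_mono newton_le_supn) (auto simp: m_def)
  also have "\<dots> \<le> 1 / 128"
  proof -
    have "real_of_int r \<le> 2 * real_of_int (supn x)" using x by linarith
    moreover have "0 \<le> real_of_int r" using r by (simp add: ratio_def)
    ultimately have "15 * t * 128 \<le> real_of_int (supn x)" unfolding t_def by simp
    then show ?thesis using supn_pos by (simp add: field_simps)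
  qed
  finally show ?thesis .
qed

text \<open>
Conditioned to avoid obstacles inside a cube, a walk from a point of a face enters the central
cube with probability at most 1/2. To enter it, the walk must first leave a slab around the plane of the face, and
then succeeds with probability at most 1/128. On the other hand, by reflection, at least half of the
obstacle-avoiding walks that leave the slab do so on the outer side, and each of these goes on to avoid the
obstacles with probability at least 1/32.
\<close>

lemma avoid_and_hit_centre_le:
  assumes r: "ratio \<le> r" and y: "supn y = r"
    and K: "\<And>x. x \<in> K \<Longrightarrow> supn x < r"
  shows "avg n (\<lambda>xs. of_bool (avoids K y xs \<and> \<not> avoids {x. ratio * supn x < r} y xs))
     \<le> 1 / 2 * escape K n y"
proof -
  define B where "B = {x. ratio * supn x < r}"
  define bad where "bad n x = avg n (\<lambda>xs. of_bool (avoids K x xs \<and> \<not> avoids B x xs))" for n x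
  have bad_0: "bad 0 x = of_bool (x \<notin> K \<and> x \<in> B)" for x by (simp add: bad_def)
  have bad_Suc: "x \<notin> B \<Longrightarrow> bad (Suc n) x = (if x \<in> K then 0 else nbr_avg (bad n) x)" for n x
    by (simp add: bad_def nbr_avg_def)
  obtain k where k: "supn y = \<bar>y $ k\<bar>" using supn_attained by blast
  define \<sigma> :: int where "\<sigma> = (if 0 \<le> y $ k then 1 else -1)"
  have sgn: "\<sigma> = 1 \<or> \<sigma> = -1" by (simp add: \<sigma>_def)
  have ly: "\<sigma> * y $ k = r" using k y by (auto simp: \<sigma>_def abs_if)
  \<comment> \<open>The slab is half as wide as the cube: it stays clear of the central cube, and its outer boundary is
        far enough from the cube for the escape bound.\<close>
  define s where "s = r div 2"
  have s: "2 * s \<le> r" "r < 2 * s + 2" "1 \<le> s" "3 * r \<le> 16 * s"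
    using r by (auto simp: s_def ratio_def)
  have notB: "x \<notin> B" if "r - s \<le> \<sigma> * x $ k" for x
  proof -
    have "r - s \<le> supn x" using that abs_coord_le_supn[of x k] sgn by auto
    then show ?thesis using s r by (auto simp: B_def ratio_def)
  qed
  have bad_stop: "bad n x \<le> 1 / 128" if "r \<le> 2 * supn x" for n x
  proof -
    have "bad n x \<le> avg n (\<lambda>xs. 1 - of_bool (avoids B x xs))"
      unfolding bad_def by (rule avg_mono) auto
    also have "\<dots> = 1 - escape B n x" by (simp add: avg_diff escape_def)
    also have "\<dots> \<le> 1 / 128" unfolding B_def by (rule hit_centre_le[OF r that])
    finally show ?thesis .
  qed
  define stop where "stop = (\<lambda>x::site. s \<le> \<bar>\<sigma> * x $ k - r\<bar>)"
  define w where "w = killed K stop (\<lambda>_. 1) 0"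
  define u where "u = killed K stop (\<lambda>x. if r \<le> \<sigma> * x $ k then 1 else - 1) 0"
  \<comment> \<open>\<open>w\<close> is the probability of leaving the slab without meeting \<open>K\<close>, and \<open>(w + u) / 2\<close> that of
        leaving it so on the outer side.\<close>
  have "bad n x \<le> 1 / 128 * w n x \<and> 1 / 64 * (w n x + u n x) \<le> escape K n x"
    if "\<bar>\<sigma> * x $ k - r\<bar> \<le> s" for n x
    using that
  proof (induction n arbitrary: x)
    case 0
    consider "x \<in> K" | "x \<notin> K" "stop x" | "x \<notin> K" "\<not> stop x" by blast
    then show ?case
    proof cases
      case 1
      then show ?thesis by (simp add: bad_0 w_def u_def escape_0)
    next
      case 2
      have "r - s \<le> \<sigma> * x $ k" using 0 by simp
      then show ?thesis using 2 notB[of x] by (simp add: bad_0 w_def u_def escape_0)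
    next
      case 3
      have "r - s \<le> \<sigma> * x $ k" using 0 by simp
      then show ?thesis using 3 notB[of x] by (simp add: bad_0 w_def u_def escape_0)
    qed
  next
    case (Suc n)
    have right: "r - s \<le> \<sigma> * x $ k" using Suc.prems by simp
    consider "x \<in> K" | "x \<notin> K" "stop x" | "x \<notin> K" "\<not> stop x" by blast
    then show ?case
    proof cases
      case 1
      then show ?thesis using notB[OF right] by (simp add: bad_Suc w_def u_def escape_Suc)
    next
      case 2
      have "r \<le> 2 * supn x"
        using right s abs_coord_le_supn[of x k] sgn by auto
      moreover have "1 / 32 \<le> escape K (Suc n) x" if "r \<le> \<sigma> * x $ k"
      proof (rule escape_half_space[OF sgn K])
        show "r + s \<le> \<sigma> * x $ k" using 2(2) that by (simp add: stop_def)
        show "1 \<le> s" "10 \<le> r" "3 * r \<le> 16 * s" using s r by (auto simp: ratio_def)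
      qed
      ultimately show ?thesis
        using 2 bad_stop[of x "Suc n"] escape_nonneg[of K "Suc n" x]
        by (cases "r \<le> \<sigma> * x $ k") (auto simp: w_def u_def)
    next
      case 3
      have nb: "bad n (x + e) \<le> 1 / 128 * w n (x + e) \<and> 1 / 64 * (w n (x + e) + u n (x + e)) \<le> escape K n (x + e)"
        if "e \<in> steps" for e
      proof (rule Suc.IH)
        show "\<bar>\<sigma> * (x + e) $ k - r\<bar> \<le> s"
          using coord_step[OF that, of k] 3(2) sgn by (auto simp: stop_def algebra_simps)
      qed
      have "nbr_avg (bad n) x \<le> nbr_avg (\<lambda>y. 1 / 128 * w n y) x" by (rule nbr_avg_mono) (use nb in blast)
      moreover have "nbr_avg (\<lambda>y. 1 / 64 * (w n y + u n y)) x \<le> nbr_avg (escape K n) x" by (rule nbr_avg_mono) (use nb in blast)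
      moreover have "bad (Suc n) x = nbr_avg (bad n) x" "w (Suc n) x = nbr_avg (w n) x" "u (Suc n) x = nbr_avg (u n) x"
        using 3 notB[OF right] by (simp_all add: bad_Suc w_def u_def)
      ultimately show ?thesis
        using 3(1) by (simp only: nbr_avg_cmult nbr_avg_add escape_Suc if_False simp_thms)
    qed
  qed
  from this[of y n] have "bad n y \<le> 1 / 128 * w n y" "1 / 64 * (w n y + u n y) \<le> escape K n y"
    using ly s by auto
  moreover have "0 \<le> u n y"
    unfolding u_def stop_def
  proof (rule killed_reflection(1)[OF sgn])
    fix x assume "x \<in> K"
    then show "\<sigma> * x $ k < r" using K[of x] abs_coord_le_supn[of x k] sgn by auto
  qed (use s ly in auto)
  ultimately show ?thesis by (simp add: bad_def B_def)
qed

section \<open>Loop erasure of a step list\<close>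

text \<open>
The last return to the starting point within the first \<open>L\<close> steps. The walk is recorded by its steps, so
erasing a loop is dropping a prefix, and the erased walk starts afresh on the remaining list.
\<close>

definition last_return :: "nat \<Rightarrow> site list \<Rightarrow> nat" where
  "last_return L xs = Max {j. j \<le> length xs \<and> j \<le> L \<and> sum_list (take j xs) = 0}"

text \<open>
If the list is exhausted before \<open>i\<close> steps have been kept, the value is the endpoint of the path.
\<close>

primrec erase :: "nat \<Rightarrow> nat \<Rightarrow> site list \<Rightarrow> site" where
  "erase L 0 xs = 0"
| "erase L (Suc i) xs = (case drop (last_return L xs) xs of [] \<Rightarrow> 0 | e # ys \<Rightarrow> e + erase L i ys)"

lemma last_return_set_finite: "finite {j. j \<le> length xs \<and> j \<le> L \<and> sum_list (take j xs) = 0}"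
  by (rule finite_subset[of _ "{..L}"]) auto

lemma last_return_props: "last_return L xs \<le> length xs" "last_return L xs \<le> L" "sum_list (take (last_return L xs) xs) = 0"
proof -
  have "last_return L xs \<in> {j. j \<le> length xs \<and> j \<le> L \<and> sum_list (take j xs) = 0}"
    unfolding last_return_def using last_return_set_finite by (rule Max_in) (auto intro: exI[of _ 0])
  then show "last_return L xs \<le> length xs" "last_return L xs \<le> L" "sum_list (take (last_return L xs) xs) = 0" by auto
qed

lemma last_return_ge: "j \<le> length xs \<Longrightarrow> j \<le> L \<Longrightarrow> sum_list (take j xs) = 0 \<Longrightarrow> j \<le> last_return L xs"
  unfolding last_return_def using last_return_set_finite by (intro Max_ge) auto

lemma last_return_eqI:
  assumes "j \<le> length xs" "j \<le> L" "sum_list (take j xs) = 0"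
    and "\<And>i. i \<le> length xs \<Longrightarrow> i \<le> L \<Longrightarrow> sum_list (take i xs) = 0 \<Longrightarrow> i \<le> j"
  shows "last_return L xs = j"
  by (meson assms last_return_ge last_return_props order_antisym)

lemma supn_erase_le: "set xs \<subseteq> steps \<Longrightarrow> supn (erase L i xs) \<le> int i"
proof (induction i arbitrary: xs)
  case (Suc i)
  show ?case
  proof (cases "drop (last_return L xs) xs")
    case (Cons e ys)
    have "set (e # ys) \<subseteq> steps"
      using Suc.prems set_drop_subset[of "last_return L xs" xs] Cons by (metis order_trans)
    then have "supn (erase L i ys) \<le> int i" "supn e = 1"
      using Suc.IH[of ys] supn_step by auto
    then show ?thesis using supn_triangle[of e "erase L i ys"] Cons by simp
  qed simp
qed simp

lemma erase_partial_sum: "\<exists>j\<le>length xs. erase L i xs = sum_list (take j xs)"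
proof (induction i arbitrary: xs)
  case 0
  show ?case by (rule exI[of _ 0]) simp
next
  case (Suc i)
  show ?case
  proof (cases "drop (last_return L xs) xs")
    case Nil
    then show ?thesis by (intro exI[of _ 0]) simp
  next
    case (Cons e ys)
    obtain j where j: "j \<le> length ys" "erase L i ys = sum_list (take j ys)"
      using Suc.IH by blast
    define b where "b = take (last_return L xs) xs"
    have xs: "xs = b @ e # ys"
      using Cons by (metis append_take_drop_id b_def)
    have "sum_list b = 0"
      using last_return_props(3) by (simp add: b_def)
    then have "sum_list (take (length b + Suc j) (b @ e # ys)) = e + sum_list (take j ys)"
      by simp
    moreover have "length b + Suc j \<le> length (b @ e # ys)"
      using j(1) by simp
    ultimately show ?thesis
      using Cons j(2) unfolding xs[symmetric] by (metis erase.simps(2) list.simps(5))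
  qed
qed

lemma erase_cutoff_irrelevant:
  "length xs \<le> L \<Longrightarrow> length xs \<le> L' \<Longrightarrow> erase L i xs = erase L' i xs"
proof (induction i arbitrary: xs)
  case (Suc i)
  have "last_return L xs = last_return L' xs"
    unfolding last_return_def using Suc.prems by (intro arg_cong[where f = Max]) auto
  then show ?case
    using Suc.IH Suc.prems
    by (auto split: list.split dest!: arg_cong[where f = length])
qed simp

lemma erase_append:
  "i * (L + 1) \<le> length xs \<Longrightarrow> erase L i (xs @ ys) = erase L i xs"
proof (induction i arbitrary: xs)
  case (Suc i)
  have len: "L < length xs" using Suc.prems by simp
  have last_return: "last_return L (xs @ ys) = last_return L xs"
    unfolding last_return_def using len by (intro arg_cong[where f = Max]) auto
  have c: "last_return L xs \<le> L" by (rule last_return_props)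
  then obtain e zs where zs: "drop (last_return L xs) xs = e # zs"
    using len by (metis drop_eq_Nil list.exhaust not_le order_le_less_trans)
  have "length zs = length xs - last_return L xs - 1"
    using arg_cong[OF zs, of length] by simp
  then have "i * (L + 1) \<le> length zs"
    using Suc.prems c by simp
  then show ?case
    using Suc.IH[of zs] zs c len by (simp add: last_return)
qed simp

lemma last_return_append_iff:
  assumes "length (b @ ys) \<le> L"
  shows "last_return L (b @ ys) = length b \<longleftrightarrow>
    sum_list b = 0 \<and> (case ys of [] \<Rightarrow> True | e # zs \<Rightarrow> avoids {0} e zs)"
proof
  assume c: "last_return L (b @ ys) = length b"
  have "sum_list b = 0" using last_return_props(3)[of L "b @ ys"] by (simp add: c)
  moreover have "avoids {0} e zs" if "ys = e # zs" for e zs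
    unfolding avoids_iff
  proof (intro allI impI notI)
    fix j assume j: "j \<le> length zs" "e + sum_list (take j zs) \<in> {0}"
    have "length b + Suc j \<le> last_return L (b @ ys)"
      using assms j that \<open>sum_list b = 0\<close> by (intro last_return_ge) auto
    then show False by (simp add: c)
  qed
  ultimately show "sum_list b = 0 \<and> (case ys of [] \<Rightarrow> True | e # zs \<Rightarrow> avoids {0} e zs)"
    by (auto split: list.split)
next
  assume *: "sum_list b = 0 \<and> (case ys of [] \<Rightarrow> True | e # zs \<Rightarrow> avoids {0} e zs)"
  show "last_return L (b @ ys) = length b"
  proof (rule last_return_eqI)
    fix i assume i: "i \<le> length (b @ ys)" "sum_list (take i (b @ ys)) = 0"
    show "i \<le> length b"
    proof (rule ccontr)
      assume "\<not> i \<le> length b"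
      then obtain j where j: "i = length b + Suc j"
        using less_iff_Suc_add[of "length b" i] by auto
      then obtain e zs where ys: "ys = e # zs" "j \<le> length zs" using i by (cases ys) auto
      then have "e + sum_list (take j zs) = 0" using i j * by simp
      then show False using * ys by (auto simp: avoids_iff)
    qed
  qed (use assms * in auto)
qed

section \<open>The farthest and the last erased point\<close>

definition reaches :: "nat \<Rightarrow> nat \<Rightarrow> int \<Rightarrow> site \<Rightarrow> site list \<Rightarrow> bool" where
  "reaches L N r x xs \<longleftrightarrow> (\<exists>i\<le>N. r \<le> supn (x + erase L i xs))"

lemma ex_le_Suc: "(\<exists>i\<le>Suc N. Q i) \<longleftrightarrow> Q 0 \<or> (\<exists>i\<le>N. Q (Suc i))"
  by (metis Suc_le_mono bot_nat_0.extremum not0_implies_Suc)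

lemma avg_split_last_return:
  assumes "n \<le> L"
  shows "avg n F = (\<Sum>j\<le>n. avg j (\<lambda>b. avg (n - j) (\<lambda>ys. of_bool (last_return L (b @ ys) = j) * F (b @ ys))))"
proof -
  have "avg n F = avg n (\<lambda>xs. \<Sum>j\<le>n. of_bool (last_return L xs = j) * F xs)"
  proof (rule avg_cong)
    fix xs assume "xs \<in> words n"
    then have "last_return L xs \<in> {..n}" using last_return_props(1)[of L xs] by (simp add: words_length)
    then show "F xs = (\<Sum>j\<le>n. of_bool (last_return L xs = j) * F xs)"
      by (subst sum_distrib_right[symmetric]) (simp add: of_bool_def)
  qed
  also have "\<dots> = (\<Sum>j\<le>n. avg (j + (n - j)) (\<lambda>xs. of_bool (last_return L xs = j) * F xs))"
    unfolding avg_sum by (intro sum.cong) auto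
  finally show ?thesis unfolding avg_append .
qed

text \<open>
Induction along the erased walk. The set \<open>K\<close> collects the erased points found so far: after
the last return to \<open>x\<close> the remaining path is a walk that avoids \<open>x\<close> as well, so \<open>x\<close> joins the set.
At the first index whose point has sup norm \<open>r\<close>, the rest of the path is exactly a walk from a face conditioned
to avoid obstacles inside the cube, and all later erased points lie on it.
\<close>

lemma late_return_avg_le:
  assumes r: "ratio \<le> r"
  shows "n \<le> L \<Longrightarrow> supn x < r \<Longrightarrow> (\<And>y. y \<in> K \<Longrightarrow> supn y < r) \<Longrightarrow>
    avg n (\<lambda>xs. of_bool (avoids K x xs \<and> reaches L N r x xs \<and> ratio * supn (x + erase L N xs) < r))
    \<le> 1 / 2 * avg n (\<lambda>xs. of_bool (avoids K x xs \<and> reaches L N r x xs))"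
proof (induction N arbitrary: n x K)
  case 0
  then show ?case by (simp add: reaches_def)
next
  case (Suc N)
  define D :: "site list \<Rightarrow> real" where "D xs =
     of_bool (avoids K x xs \<and> reaches L (Suc N) r x xs \<and> ratio * supn (x + erase L (Suc N) xs) < r)
     - 1 / 2 * of_bool (avoids K x xs \<and> reaches L (Suc N) r x xs)" for xs
  have "avg n D = (\<Sum>j\<le>n. avg j (\<lambda>b. avg (n - j) (\<lambda>ys. of_bool (last_return L (b @ ys) = j) * D (b @ ys))))"
    by (rule avg_split_last_return) (rule Suc.prems)
  also have "\<dots> \<le> 0"
  proof (rule sum_nonpos, rule avg_le)
    fix j b assume "j \<in> {..n}" and b: "b \<in> words j"
    then have j: "j \<le> n" "length b = j" by (auto simp: words_length)
    show "avg (n - j) (\<lambda>ys. of_bool (last_return L (b @ ys) = j) * D (b @ ys)) \<le> 0"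
    proof (cases "n - j")
      case 0
      have "of_bool (last_return L b = j) * D b = 0"
      proof (cases "last_return L b = j")
        case True
        then have "erase L i b = 0" for i using j by (cases i) auto
        then have "\<not> reaches L (Suc N) r x b"
          using Suc.prems(2) by (auto simp: reaches_def)
        then show ?thesis by (simp add: D_def)
      qed simp
      then show ?thesis by (simp add: 0)
    next
      case (Suc m)
      have "avg m (\<lambda>zs. of_bool (last_return L (b @ e # zs) = j) * D (b @ e # zs)) \<le> 0" if e: "e \<in> steps" for e
      proof (cases "sum_list b = 0 \<and> avoids K x b")
        case True
        define y where "y = x + e"
        define K' where "K' = insert x K"
        have K': "supn z < r" if "z \<in> K'" for z
          using that Suc.prems(2,3) by (auto simp: K'_def)
        \<comment> \<open>The indicators for the full list become indicators for the rest \<open>zs\<close> after the last return, with the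
                    obstacle \<open>K'\<close> and starting point \<open>y\<close>.\<close>
        have val: "of_bool (last_return L (b @ e # zs) = j) * D (b @ e # zs)
           = of_bool (avoids K' y zs \<and> (r \<le> supn y \<or> reaches L N r y zs) \<and> ratio * supn (y + erase L N zs) < r)
             - 1 / 2 * of_bool (avoids K' y zs \<and> (r \<le> supn y \<or> reaches L N r y zs))"
          if zs: "zs \<in> words m" for zs
        proof -
          have len: "length (b @ e # zs) \<le> L"
            using Suc.prems(1) Suc j zs by (simp add: words_length)
          have last_return_iff: "last_return L (b @ e # zs) = j \<longleftrightarrow> avoids {0} e zs"
            using last_return_append_iff[OF len] True j by simp
          have K'_iff: "avoids K' y zs \<longleftrightarrow> avoids K y zs \<and> avoids {0} e zs"
            unfolding avoids_iff K'_def y_def by (auto simp: add.assoc)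
          show ?thesis
          proof (cases "avoids {0} e zs")
            case False
            then show ?thesis using last_return_iff K'_iff by simp
          next
            case ok: True
            then have c: "last_return L (b @ e # zs) = j" using last_return_iff by simp
            have erase: "erase L (Suc i) (b @ e # zs) = e + erase L i zs" for i
              using c j by simp
            have "reaches L (Suc N) r x (b @ e # zs) \<longleftrightarrow> reaches L N r y zs"
              unfolding reaches_def ex_le_Suc erase y_def using Suc.prems(2) by (simp add: add.assoc)
            moreover have "r \<le> supn y \<Longrightarrow> reaches L N r y zs"
              unfolding reaches_def by (rule exI[of _ 0]) simp
            moreover have "avoids K x (b @ e # zs) \<longleftrightarrow> avoids K y zs"
              using True unfolding avoids_append y_def avoids.simps
              by (metis add.right_neutral append_Nil2 avoids_append avoids.simps(1))
            ultimately show ?thesis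
              unfolding D_def erase using c ok K'_iff by (auto simp: y_def add.assoc)
          qed
        qed
        have "avg m (\<lambda>zs. of_bool (last_return L (b @ e # zs) = j) * D (b @ e # zs))
          = avg m (\<lambda>zs. of_bool (avoids K' y zs \<and> (r \<le> supn y \<or> reaches L N r y zs) \<and> ratio * supn (y + erase L N zs) < r))
             - 1 / 2 * avg m (\<lambda>zs. of_bool (avoids K' y zs \<and> (r \<le> supn y \<or> reaches L N r y zs)))"
          unfolding avg_cmult[symmetric] avg_diff[symmetric] by (intro avg_cong val)
        also have "\<dots> \<le> 0"
        proof (cases "r \<le> supn y")
          case False
          then show ?thesis
            using Suc.IH[of m y K'] K' Suc.prems(1) Suc by simp
        next
          case out: True
          then have y: "supn y = r"
            using supn_step_le(1)[OF e, of x] Suc.prems(2) by (simp add: y_def)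
          have "avg m (\<lambda>zs. of_bool (avoids K' y zs \<and> ratio * supn (y + erase L N zs) < r))
             \<le> avg m (\<lambda>zs. of_bool (avoids K' y zs \<and> \<not> avoids {x. ratio * supn x < r} y zs))"
          proof (rule avg_mono)
            fix zs
            have "\<not> avoids {x. ratio * supn x < r} y zs" if "ratio * supn (y + erase L N zs) < r"
              using erase_partial_sum[of zs L N] that by (auto simp: avoids_iff)
            then show "of_bool (avoids K' y zs \<and> ratio * supn (y + erase L N zs) < r)
                \<le> (of_bool (avoids K' y zs \<and> \<not> avoids {x. ratio * supn x < r} y zs) :: real)"
              by auto
          qed
          also have "\<dots> \<le> 1 / 2 * escape K' m y"
            using r y K' by (rule avoid_and_hit_centre_le)
          finally show ?thesis using out by (simp add: escape_def)
        qed
        finally show ?thesis .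
      next
        case False
        have "of_bool (last_return L (b @ e # zs) = j) * D (b @ e # zs) = 0" if zs: "zs \<in> words m" for zs
        proof (cases "sum_list b = 0")
          case True
          then have "\<not> avoids K x b" using False by simp
          then have "\<not> avoids K x (b @ e # zs)" by (simp add: avoids_append)
          then show ?thesis by (simp add: D_def)
        next
          case False
          have "length (b @ e # zs) \<le> L"
            using Suc.prems(1) Suc j zs by (simp add: words_length)
          then show ?thesis using last_return_append_iff[of b "e # zs" L] False j by simp
        qed
        then show ?thesis using avg_le[of m _ 0] by simp
      qed
      then show ?thesis
        unfolding Suc avg.simps by (intro divide_nonpos_pos sum_nonpos) auto
    qed
  qed
  finally have "avg n D \<le> 0" .
  then show ?case unfolding D_def avg_diff avg_cmult by simp
qed

definition max_norm :: "nat \<Rightarrow> nat \<Rightarrow> site list \<Rightarrow> real" where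
  "max_norm L N xs = real_of_int (Max ((\<lambda>i. supn (erase L i xs)) ` {..N}))"

lemma max_norm_ge: "i \<le> N \<Longrightarrow> real_of_int (supn (erase L i xs)) \<le> max_norm L N xs"
  unfolding max_norm_def of_int_le_iff by (rule Max_ge) auto

lemma max_norm_leI: "(\<And>i. i \<le> N \<Longrightarrow> real_of_int (supn (erase L i xs)) \<le> c) \<Longrightarrow> max_norm L N xs \<le> c"
proof -
  assume *: "\<And>i. i \<le> N \<Longrightarrow> real_of_int (supn (erase L i xs)) \<le> c"
  have "Max ((\<lambda>i. supn (erase L i xs)) ` {..N}) \<in> (\<lambda>i. supn (erase L i xs)) ` {..N}"
    by (rule Max_in) auto
  then obtain i where "i \<le> N" "Max ((\<lambda>i. supn (erase L i xs)) ` {..N}) = supn (erase L i xs)"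
    by (elim imageE) simp
  then show ?thesis unfolding max_norm_def using * by simp
qed

lemma max_norm_nonneg: "0 \<le> max_norm L N xs"
  using max_norm_ge[of 0 N L xs] by simp

lemma max_norm_le:
  assumes "set xs \<subseteq> steps"
  shows "max_norm L N xs \<le> real N"
proof (rule max_norm_leI)
  fix i assume "i \<le> N"
  then have "supn (erase L i xs) \<le> int N"
    using supn_erase_le[OF assms, of L i] by linarith
  then show "real_of_int (supn (erase L i xs)) \<le> real N"
    by linarith
qed

lemma sum_twice_upto: "(\<Sum>r=1..m. 2 * real r) = real m * (real m + 1)"
  by (induction m) (auto simp: algebra_simps)

text \<open>
Summation of \<open>late_return_avg_le\<close> over all radii \<open>r\<close>. Radii below \<open>ratio\<close> contribute the additive constant.
\<close>

lemma second_moment_max_le: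
  assumes "n \<le> L"
  shows "avg n (\<lambda>xs. (max_norm L N xs)\<^sup>2)
    \<le> real_of_int (ratio\<^sup>2) + 4 * real_of_int (ratio\<^sup>2) * avg n (\<lambda>xs. real_of_int ((supn (erase L N xs))\<^sup>2))"
proof -
  define A where "A = nat ratio"
  have A: "int A = ratio" "0 < A" by (auto simp: A_def ratio_def)
  define Q where "Q r = avg n (\<lambda>xs. of_bool (reaches L N (int r) 0 xs))" for r
  \<comment> \<open>For a natural number \<open>m\<close>, the sum of \<open>2 r\<close> over \<open>1 \<le> r \<le> m\<close> is at least \<open>m^2\<close>.\<close>
  have layer: "(max_norm L N xs)\<^sup>2 \<le> (\<Sum>r=1..N. 2 * real r * of_bool (reaches L N (int r) 0 xs))"
    if xs: "xs \<in> words n" for xs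
  proof -
    define m where "m = nat (Max ((\<lambda>i. supn (erase L i xs)) ` {..N}))"
    have Max_mem: "Max ((\<lambda>i. supn (erase L i xs)) ` {..N}) \<in> (\<lambda>i. supn (erase L i xs)) ` {..N}"
      by (rule Max_in) auto
    then obtain i where i: "i \<le> N" "Max ((\<lambda>i. supn (erase L i xs)) ` {..N}) = supn (erase L i xs)"
      by (elim imageE) simp
    then have m: "int m = supn (erase L i xs)" "max_norm L N xs = real m" by (simp_all add: m_def max_norm_def)
    have "m \<le> N"
      using max_norm_le[of xs L N] xs m(2) by (simp add: words_set)
    have "(max_norm L N xs)\<^sup>2 \<le> (\<Sum>r=1..m. 2 * real r)"
      unfolding sum_twice_upto m by (simp add: power2_eq_square algebra_simps)
    also have "\<dots> = (\<Sum>r=1..m. 2 * real r * of_bool (reaches L N (int r) 0 xs))"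
    proof (intro sum.cong refl)
      fix r assume "r \<in> {1..m}"
      then have "reaches L N (int r) 0 xs"
        unfolding reaches_def using i m by (intro exI[of _ i]) auto
      then show "2 * real r = 2 * real r * of_bool (reaches L N (int r) 0 xs)" by simp
    qed
    also have "\<dots> \<le> (\<Sum>r=1..N. 2 * real r * of_bool (reaches L N (int r) 0 xs))"
      using \<open>m \<le> N\<close> by (intro sum_mono2) auto
    finally show ?thesis .
  qed
  have half: "Q r \<le> 2 * avg n (\<lambda>xs. of_bool (int r \<le> ratio * supn (erase L N xs)))" if "A \<le> r" for r
  proof -
    have "ratio \<le> int r" using that A by linarith
    then have "avg n (\<lambda>xs. of_bool (avoids {} 0 xs \<and> reaches L N r 0 xs \<and> ratio * supn (0 + erase L N xs) < r))
      \<le> 1 / 2 * avg n (\<lambda>xs. of_bool (avoids {} 0 xs \<and> reaches L N r 0 xs))"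
      using assms by (intro late_return_avg_le) (auto simp: ratio_def)
    then have "avg n (\<lambda>xs. of_bool (reaches L N r 0 xs \<and> ratio * supn (erase L N xs) < r)) \<le> 1 / 2 * Q r"
      by (simp add: avoids_iff Q_def)
    moreover have "Q r \<le> avg n (\<lambda>xs. of_bool (reaches L N r 0 xs \<and> ratio * supn (erase L N xs) < r))
        + avg n (\<lambda>xs. of_bool (int r \<le> ratio * supn (erase L N xs)))"
      unfolding Q_def avg_add[symmetric] by (intro avg_mono) auto
    ultimately show ?thesis by simp
  qed
  have Q1: "Q r \<le> 1" for r unfolding Q_def by (rule avg_le) auto
  have "avg n (\<lambda>xs. (max_norm L N xs)\<^sup>2) \<le> (\<Sum>r=1..N. 2 * real r * Q r)"
    unfolding Q_def avg_cmult[symmetric] avg_sum[symmetric] by (intro avg_mono layer)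
  also have "\<dots> \<le> (\<Sum>r=1..N. 2 * real r * (of_bool (r < A) + 2 * avg n (\<lambda>xs. of_bool (int r \<le> ratio * supn (erase L N xs)))))"
  proof (intro sum_mono mult_left_mono)
    fix r
    show "Q r \<le> of_bool (r < A) + 2 * avg n (\<lambda>xs. of_bool (int r \<le> ratio * supn (erase L N xs)))"
      using half[of r] Q1[of r] avg_nonneg[of n "\<lambda>xs. of_bool (int r \<le> ratio * supn (erase L N xs))"]
      by (cases "r < A") auto
  qed auto
  also have "\<dots> = (\<Sum>r=1..N. 2 * real r * of_bool (r < A))
      + 2 * avg n (\<lambda>xs. \<Sum>r=1..N. 2 * real r * of_bool (int r \<le> ratio * supn (erase L N xs)))"
    unfolding avg_sum avg_cmult by (simp add: algebra_simps sum.distrib sum_distrib_left)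
  also have "(\<Sum>r=1..N. 2 * real r * of_bool (r < A)) \<le> (\<Sum>r=1..A - 1. 2 * real r)"
  proof -
    have "(\<Sum>r=1..N. 2 * real r * of_bool (r < A)) = (\<Sum>r\<in>{1..N} \<inter> {..<A}. 2 * real r)"
      unfolding sum.inter_restrict[OF finite_atLeastAtMost] by (intro sum.cong) auto
    also have "\<dots> \<le> (\<Sum>r=1..A - 1. 2 * real r)" by (intro sum_mono2) auto
    finally show ?thesis .
  qed
  also have "(\<Sum>r=1..A - 1. 2 * real r) \<le> real_of_int (ratio\<^sup>2)"
    unfolding sum_twice_upto using A by (simp add: of_nat_diff power2_eq_square algebra_simps flip: A(1))
  also have "avg n (\<lambda>xs. \<Sum>r=1..N. 2 * real r * of_bool (int r \<le> ratio * supn (erase L N xs)))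
     \<le> avg n (\<lambda>xs. (2 * real_of_int (ratio\<^sup>2)) * real_of_int ((supn (erase L N xs))\<^sup>2))"
  proof (rule avg_mono)
    fix xs
    define k where "k = nat (ratio * supn (erase L N xs))"
    have k: "int k = ratio * supn (erase L N xs)" by (simp add: k_def ratio_def)
    have "(\<Sum>r=1..N. 2 * real r * of_bool (int r \<le> ratio * supn (erase L N xs)))
        = (\<Sum>r\<in>{1..N} \<inter> {..k}. 2 * real r)"
      unfolding sum.inter_restrict[OF finite_atLeastAtMost] k[symmetric] by (intro sum.cong) auto
    also have "\<dots> \<le> (\<Sum>r=1..k. 2 * real r)" by (intro sum_mono2) auto
    also have "\<dots> \<le> 2 * (real k)\<^sup>2"
      unfolding sum_twice_upto by (cases k) (auto simp: power2_eq_square algebra_simps)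
    also have "real k = real_of_int (ratio * supn (erase L N xs))" using k by (metis of_int_of_nat_eq)
    finally show "(\<Sum>r=1..N. 2 * real r * of_bool (int r \<le> ratio * supn (erase L N xs)))
       \<le> (2 * real_of_int (ratio\<^sup>2)) * real_of_int ((supn (erase L N xs))\<^sup>2)"
      by (simp add: power_mult_distrib)
  qed
  finally show ?thesis by (simp add: avg_cmult)
qed

lemma max_norm_cong: "(\<And>i. i \<le> N \<Longrightarrow> erase L i xs = erase L' i ys) \<Longrightarrow> max_norm L N xs = max_norm L' N ys"
  unfolding max_norm_def by (intro arg_cong[where f = real_of_int] arg_cong[where f = Max] image_cong) auto

section \<open>Loop erasure after leaving a large cube\<close>

text \<open>
A loop at the \<open>k\<close>-th erased point of \<open>p\<close> is closed by the first \<open>v\<close> steps of \<open>q\<close>, and each erased point of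
\<open>p @ q\<close> is an erased point of \<open>p\<close> or belongs to a fresh erased walk attached to the \<open>k\<close>-th point by one step.
The displacement \<open>e\<close> is 0 if \<open>q\<close> is exhausted.
\<close>

definition restarts :: "nat \<Rightarrow> nat \<Rightarrow> site list \<Rightarrow> site list \<Rightarrow> nat \<Rightarrow> nat \<Rightarrow> bool" where
  "restarts L N p q k v \<longleftrightarrow> sum_list p + sum_list (take v q) = erase L k p \<and>
     v + length p \<le> (k + 1) * (L + 1) \<and>
     (\<forall>i\<le>N. (\<exists>i'\<le>N. erase L i (p @ q) = erase L i' p) \<or>
       (\<exists>i'\<le>N. \<exists>e. supn e \<le> 1 \<and> erase L i (p @ q) = erase L k p + e + erase L i' (drop (Suc v) q)))"

text \<open>
Suppose the path \<open>p\<close> ends so far out that none of the first \<open>N\<close> erased points can be its endpoint, and is so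
short that the cutoff does not affect it. Continuing it by \<open>q\<close> changes these points only if
some loop at a point \<open>erase L k p\<close> closes inside \<open>q\<close>, say at time \<open>v\<close>. From then on, the erased walk is that
of the steps of \<open>q\<close> after time \<open>v\<close>. The bound on \<open>v\<close> guarantees that enough steps remain to
determine it.
\<close>

lemma erase_append_dichotomy:
  assumes "length p \<le> L" "int N < supn (sum_list p)" "set (p @ q) \<subseteq> steps"
  shows "(\<forall>i\<le>N. erase L i (p @ q) = erase L i p) \<or>
    (\<exists>k\<le>N. \<exists>v\<le>length q. restarts L N p q k v)"
  using assms
proof (induction N arbitrary: p)
  case 0
  then show ?case by simp
next
  case (Suc N)
  define c where "c = last_return L (p @ q)"
  have c: "c \<le> length (p @ q)" "c \<le> L" "sum_list (take c (p @ q)) = 0"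
    using last_return_props[of L "p @ q"] by (auto simp: c_def)
  \<comment> \<open>Either the loop at the starting point closes inside \<open>q\<close>, and then \<open>k = 0\<close>, or it closes inside \<open>p\<close> and one
        step is peeled off. That step reduces the sup norm of the endpoint by at most 1, while \<open>N\<close> drops by 1.\<close>
  show ?case
  proof (cases "length p < c")
    case True
    define v where "v = c - length p"
    have v: "v \<le> length q" "sum_list p + sum_list (take v q) = erase L 0 p" "v + length p \<le> (0 + 1) * (L + 1)"
      using c True by (auto simp: v_def)
    have drop: "drop c (p @ q) = drop v q" using True by (simp add: v_def)
    have "(\<exists>i'\<le>Suc N. erase L i (p @ q) = erase L i' p) \<or>
        (\<exists>i'\<le>Suc N. \<exists>e. supn e \<le> 1 \<and> erase L i (p @ q) = erase L 0 p + e + erase L i' (drop (Suc v) q))"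
      if "i \<le> Suc N" for i
    proof (cases i)
      case 0
      then show ?thesis by (intro disjI1 exI[of _ 0]) simp
    next
      case (Suc i')
      show ?thesis
      proof (cases "drop v q")
        case Nil
        then have "erase L i (p @ q) = erase L 0 p" using Suc drop by (simp add: c_def)
        then show ?thesis by (intro disjI1 exI[of _ 0]) simp
      next
        case (Cons e ys)
        have "e \<in> set q" using Cons by (metis in_set_dropD list.set_intros(1))
        then have "supn e = 1" using Suc.prems(3) supn_step by auto
        moreover have "drop (Suc v) q = ys" using Cons by (metis drop_Suc list.sel(3) tl_drop)
        ultimately show ?thesis
          using Suc that Cons drop
          by (intro disjI2 exI[of _ i'] conjI exI[of _ e]) (auto simp: c_def)
      qed
    qed
    then have "restarts L (Suc N) p q 0 v" using v(2,3) unfolding restarts_def by blast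
    then have "\<exists>v\<le>length q. restarts L (Suc N) p q 0 v" using v(1) by blast
    then show ?thesis by (intro disjI2) (rule exI[of _ 0], simp)
  next
    case False
    have cp: "last_return L p = c"
    proof (rule last_return_eqI)
      show "sum_list (take c p) = 0" "c \<le> length p" "c \<le> L" using c False by auto
      fix j assume "j \<le> length p" "j \<le> L" "sum_list (take j p) = 0"
      then show "j \<le> c" unfolding c_def by (intro last_return_ge) auto
    qed
    show ?thesis
    proof (cases "drop c p")
      case Nil
      then have "take c p = p" by simp
      then have "sum_list p = 0" using c(3) False by simp
      then show ?thesis using Suc.prems(2) by simp
    next
      case (Cons e ys)
      have p: "p = take c p @ e # ys" using Cons by (metis append_take_drop_id)
      have sum0: "sum_list (take c p) = 0" using c(3) False by simp
      have sum_p: "sum_list p = e + sum_list ys" by (subst p) (use sum0 in simp)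
      have len: "length p = c + Suc (length ys)"
        using arg_cong[OF p, of length] False by simp
      have e: "e \<in> steps" and ys: "set ys \<subseteq> steps"
        using Suc.prems(3) arg_cong[OF p, of set] by auto
      have "int N < supn (sum_list ys)"
        using Suc.prems(2) supn_triangle[of e "sum_list ys"] supn_step[OF e] sum_p by simp
      then have IH: "(\<forall>i\<le>N. erase L i (ys @ q) = erase L i ys) \<or>
        (\<exists>k\<le>N. \<exists>v\<le>length q. restarts L N ys q k v)"
        using Suc.prems len ys by (intro Suc.IH) auto
      have erase_p: "erase L (Suc i) p = e + erase L i ys" for i using Cons cp by simp
      have "drop c (p @ q) = e # (ys @ q)" using Cons False by simp
      then have erase_pq: "erase L (Suc i) (p @ q) = e + erase L i (ys @ q)" for i by (simp add: c_def)
      from IH show ?thesis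
      proof
        assume "\<forall>i\<le>N. erase L i (ys @ q) = erase L i ys"
        then have "erase L i (p @ q) = erase L i p" if "i \<le> Suc N" for i
          using that by (cases i) (auto simp only: erase_p erase_pq erase.simps(1) Suc_le_mono)
        then show ?thesis by (intro disjI1 allI impI)
      next
        assume "\<exists>k\<le>N. \<exists>v\<le>length q. restarts L N ys q k v"
        then obtain k v where k: "k \<le> N" and v: "v \<le> length q" and restarts: "restarts L N ys q k v"
          by blast
        have vis: "sum_list ys + sum_list (take v q) = erase L k ys"
          and vl: "v + length ys \<le> (k + 1) * (L + 1)"
          using restarts unfolding restarts_def by simp_all
        have all: "(\<exists>i'\<le>N. erase L i (ys @ q) = erase L i' ys) \<or>
            (\<exists>i'\<le>N. \<exists>e. supn e \<le> 1 \<and> erase L i (ys @ q) = erase L k ys + e + erase L i' (drop (Suc v) q))"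
          if "i \<le> N" for i
          using restarts that unfolding restarts_def by simp
        have "(\<exists>i'\<le>Suc N. erase L i (p @ q) = erase L i' p) \<or>
          (\<exists>i'\<le>Suc N. \<exists>e. supn e \<le> 1 \<and> erase L i (p @ q) = erase L (Suc k) p + e + erase L i' (drop (Suc v) q))"
          if i: "i \<le> Suc N" for i
        proof (cases i)
          case 0
          then show ?thesis by (intro disjI1 exI[of _ 0]) simp
        next
          case (Suc i0)
          with i have "i0 \<le> N" by simp
          from all[OF this] show ?thesis
          proof (elim disjE exE conjE)
            fix i' assume "i' \<le> N" "erase L i0 (ys @ q) = erase L i' ys"
            then show ?thesis
              unfolding Suc erase_pq by (intro disjI1 exI[of _ "Suc i'"]) (simp only: erase_p Suc_le_mono simp_thms)
          next
            fix i' d assume "i' \<le> N" "supn d \<le> 1" "erase L i0 (ys @ q) = erase L k ys + d + erase L i' (drop (Suc v) q)"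
            then show ?thesis
              unfolding Suc erase_pq erase_p
              by (intro disjI2 exI[of _ i'] conjI exI[of _ d]) (auto simp: add.assoc)
          qed
        qed
        moreover have "sum_list p + sum_list (take v q) = erase L (Suc k) p"
          unfolding erase_p sum_p vis[symmetric] by (simp add: add.assoc)
        moreover have "v + length p \<le> (Suc k + 1) * (L + 1)" using vl len c(2) by simp
        ultimately have "restarts L (Suc N) p q (Suc k) v" unfolding restarts_def by simp
        then have "\<exists>v\<le>length q. restarts L (Suc N) p q (Suc k) v" using v by blast
        then show ?thesis using k by (intro disjI2) (rule exI[of _ "Suc k"], simp)
      qed
    qed
  qed
qed

definition exits :: "int \<Rightarrow> site list \<Rightarrow> bool" where
  "exits R p \<longleftrightarrow> R \<le> supn (sum_list p) \<and> (\<forall>j<length p. supn (sum_list (take j p)) < R)"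

definition stays :: "int \<Rightarrow> nat \<Rightarrow> site list \<Rightarrow> bool" where
  "stays R L xs \<longleftrightarrow> (\<forall>j\<le>L. supn (sum_list (take j xs)) < R)"

text \<open>
Expectation of \<open>F\<close> of the path stopped on leaving the cube, restricted to the event that this happens
within \<open>L\<close> steps.
\<close>

definition stopped_avg :: "int \<Rightarrow> nat \<Rightarrow> (site list \<Rightarrow> real) \<Rightarrow> real" where
  "stopped_avg R L F = (\<Sum>j\<le>L. avg j (\<lambda>p. of_bool (exits R p) * F p))"

lemma stopped_avg_mono:
  assumes "\<And>p. exits R p \<Longrightarrow> set p \<subseteq> steps \<Longrightarrow> length p \<le> L \<Longrightarrow> F p \<le> G p"
  shows "stopped_avg R L F \<le> stopped_avg R L G"
  unfolding stopped_avg_def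
  by (intro sum_mono avg_mono) (use assms in \<open>auto simp: words_def\<close>)

lemma stopped_avg_add: "stopped_avg R L (\<lambda>p. F p + G p) = stopped_avg R L F + stopped_avg R L G"
  by (simp add: stopped_avg_def distrib_left avg_add sum.distrib)

lemma stopped_avg_cmult: "stopped_avg R L (\<lambda>p. c * F p) = c * stopped_avg R L F"
proof -
  have "avg j (\<lambda>p. of_bool (exits R p) * (c * F p)) = c * avg j (\<lambda>p. of_bool (exits R p) * F p)" for j
    unfolding avg_cmult[symmetric] by (intro avg_cong) simp
  then show ?thesis by (simp add: stopped_avg_def sum_distrib_left)
qed

text \<open>
The strong Markov property at the exit time.
\<close>

lemma stopped_avg_avg:
  assumes "L \<le> n"
  shows "stopped_avg R L (\<lambda>p. avg (n - length p) (\<lambda>q. G (p @ q)))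
    = avg n (\<lambda>xs. (\<Sum>j\<le>L. of_bool (exits R (take j xs))) * G xs)"
proof -
  have "avg n (\<lambda>xs. (\<Sum>j\<le>L. of_bool (exits R (take j xs))) * G xs)
     = (\<Sum>j\<le>L. avg (j + (n - j)) (\<lambda>xs. of_bool (exits R (take j xs)) * G xs))"
    unfolding sum_distrib_right avg_sum using assms by (intro sum.cong) auto
  also have "\<dots> = stopped_avg R L (\<lambda>p. avg (n - length p) (\<lambda>q. G (p @ q)))"
    unfolding stopped_avg_def avg_append avg_cmult[symmetric]
    by (intro sum.cong avg_cong) (auto simp: words_length avg_cmult)
  finally show ?thesis ..
qed

lemma exits_count_le: "(\<Sum>j\<le>L. of_bool (exits R (take j xs))) \<le> (1::real)" if "L \<le> length xs"
proof -
  have uniq: "i = j" if "exits R (take i xs)" "exits R (take j xs)" "i \<le> L" "j \<le> L" for i j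
  proof -
    have False if "i < j" "exits R (take i xs)" "exits R (take j xs)" "j \<le> L" for i j
      using that \<open>L \<le> length xs\<close> unfolding exits_def by (auto simp: min_def dest!: spec[of _ i] split: if_splits)
    then show ?thesis using that by (metis linorder_neqE_nat)
  qed
  show ?thesis
  proof (cases "\<exists>i\<le>L. exits R (take i xs)")
    case True
    then obtain i where i: "i \<le> L" "exits R (take i xs)" by blast
    have "(\<Sum>j\<le>L. of_bool (exits R (take j xs))) = (\<Sum>j\<le>L. if j = i then 1 else (0::real))"
      using uniq i by (intro sum.cong) (auto simp: of_bool_def)
    then show ?thesis using i by simp
  qed (simp add: of_bool_def)
qed

lemma exits_count_ge: "1 - of_bool (stays R L xs) \<le> (\<Sum>j\<le>L. of_bool (exits R (take j xs)) :: real)"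
  if "L \<le> length xs"
proof (cases "stays R L xs")
  case False
  then obtain j where j: "j \<le> L" "R \<le> supn (sum_list (take j xs))" by (auto simp: stays_def not_less)
  define i where "i = (LEAST j. R \<le> supn (sum_list (take j xs)))"
  have i: "R \<le> supn (sum_list (take i xs))" "i \<le> j"
    unfolding i_def using j by (auto intro: LeastI Least_le)
  have "supn (sum_list (take j xs)) < R" if "j < i" for j
    using not_less_Least[of j "\<lambda>j. R \<le> supn (sum_list (take j xs))"] that by (simp add: i_def)
  then have "exits R (take i xs)" using i by (auto simp: exits_def min_def)
  then have "of_bool (exits R (take i xs)) \<le> (\<Sum>j\<le>L. of_bool (exits R (take j xs)) :: real)"
    using i j by (intro member_le_sum) auto
  then show ?thesis using \<open>exits R (take i xs)\<close> False by simp
qed (simp add: sum_nonneg)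

lemma stopped_avg_avg_le:
  assumes "L \<le> n" "\<And>xs. xs \<in> words n \<Longrightarrow> 0 \<le> G xs"
  shows "stopped_avg R L (\<lambda>p. avg (n - length p) (\<lambda>q. G (p @ q))) \<le> avg n G"
  unfolding stopped_avg_avg[OF assms(1)]
proof (rule avg_mono)
  fix xs assume "xs \<in> words n"
  then show "(\<Sum>j\<le>L. of_bool (exits R (take j xs))) * G xs \<le> G xs"
    using mult_right_mono[OF exits_count_le[of L xs R] assms(2)[of xs]] assms(1)
    by (simp add: words_length)
qed

lemma stopped_avg_const_le: "0 \<le> c \<Longrightarrow> stopped_avg R L (\<lambda>_. c) \<le> c"
  using stopped_avg_avg_le[of L L "\<lambda>_. c" R] by simp

lemma avg_stays: "L \<le> n \<Longrightarrow> avg n (\<lambda>xs. of_bool (stays R L xs)) = escape {x. R \<le> supn x} L 0"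
proof -
  assume "L \<le> n"
  then have "avg n (\<lambda>xs. of_bool (stays R L xs)) = avg (L + (n - L)) (\<lambda>xs. of_bool (stays R L xs))" by simp
  also have "\<dots> = escape {x. R \<le> supn x} L 0"
    unfolding avg_append escape_def
  proof (rule avg_cong)
    fix xs assume "xs \<in> words L"
    then have "stays R L (xs @ ys) \<longleftrightarrow> avoids {x. R \<le> supn x} 0 xs" for ys
      by (auto simp: stays_def avoids_iff words_length not_le)
    then show "avg (n - L) (\<lambda>ys. of_bool (stays R L (xs @ ys))) = of_bool (avoids {x. R \<le> supn x} 0 xs)" by simp
  qed
  finally show ?thesis .
qed

lemma avg_le_stopped_avg:
  assumes "L \<le> n" "\<And>xs. xs \<in> words n \<Longrightarrow> 0 \<le> G xs" "\<And>xs. xs \<in> words n \<Longrightarrow> G xs \<le> g"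
  shows "avg n G \<le> stopped_avg R L (\<lambda>p. avg (n - length p) (\<lambda>q. G (p @ q))) + g * escape {x. R \<le> supn x} L 0"
proof -
  have "avg n G \<le> avg n (\<lambda>xs. (\<Sum>j\<le>L. of_bool (exits R (take j xs))) * G xs + g * of_bool (stays R L xs))"
  proof (rule avg_mono)
    fix xs assume xs: "xs \<in> words n"
    then have "(1 - of_bool (stays R L xs)) * G xs \<le> (\<Sum>j\<le>L. of_bool (exits R (take j xs))) * G xs"
      using assms by (intro mult_right_mono exits_count_ge) (auto simp: words_length)
    then show "G xs \<le> (\<Sum>j\<le>L. of_bool (exits R (take j xs))) * G xs + g * of_bool (stays R L xs)"
      using assms(2,3)[OF xs] by (cases "stays R L xs") (auto intro!: add_increasing)
  qed
  then show ?thesis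
    unfolding avg_add stopped_avg_avg[OF assms(1), symmetric] avg_cmult avg_stays[OF assms(1)] .
qed

lemma max_norm_append: "N * (L + 1) \<le> length xs \<Longrightarrow> max_norm L N (xs @ ys) = max_norm L N xs"
proof -
  assume len: "N * (L + 1) \<le> length xs"
  have "erase L i (xs @ ys) = erase L i xs" if "i \<le> N" for i
    using that len by (intro erase_append) (meson le_trans mult_le_mono1)
  then show ?thesis by (rule max_norm_cong)
qed

definition max_moment :: "nat \<Rightarrow> nat \<Rightarrow> real" where
  "max_moment L N = avg (N * (L + 1)) (\<lambda>xs. (max_norm L N xs)\<^sup>2)"

text \<open>
With a finite cutoff the first \<open>N\<close> erased points depend on a bounded number of steps only. Hence the
moment does not depend on the number of available steps, and the walk after an exceptional visit has
the same moment as the original one.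
\<close>

lemma avg_max_norm:
  assumes "N * (L + 1) \<le> n"
  shows "avg n (\<lambda>xs. (max_norm L N xs)\<^sup>2) = max_moment L N"
proof -
  have "avg n (\<lambda>xs. (max_norm L N xs)\<^sup>2) = avg (N * (L + 1) + (n - N * (L + 1))) (\<lambda>xs. (max_norm L N xs)\<^sup>2)"
    using assms by simp
  also have "\<dots> = max_moment L N"
    unfolding avg_append max_moment_def
    by (intro avg_cong) (simp add: max_norm_append words_length)
  finally show ?thesis .
qed

lemma max_moment_nonneg: "0 \<le> max_moment L N"
  unfolding max_moment_def by (intro avg_nonneg) simp

text \<open>
Bound for the expected number of visits to \<open>N + 1\<close> points of sup norm at most \<open>N\<close>, for a walk that starts
at sup norm at least \<open>R\<close>.
\<close>

definition return_bound :: "nat \<Rightarrow> int \<Rightarrow> real" where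
  "return_bound N R = real (N + 1) * green_const / real_of_int (R - int N)"

lemma return_bound_nonneg: "int N < R \<Longrightarrow> 0 \<le> return_bound N R"
  unfolding return_bound_def using green_const_pos by auto

definition differs :: "nat \<Rightarrow> nat \<Rightarrow> site list \<Rightarrow> site list \<Rightarrow> bool" where
  "differs L N p q \<longleftrightarrow> (\<exists>i\<le>N. erase L i (p @ q) \<noteq> erase L i p)"

definition revisits :: "nat \<Rightarrow> nat \<Rightarrow> site list \<Rightarrow> site list \<Rightarrow> nat \<Rightarrow> nat \<Rightarrow> bool" where
  "revisits L N p q v k \<longleftrightarrow> sum_list p + sum_list (take v q) = erase L k p"

definition revisit_sum :: "nat \<Rightarrow> nat \<Rightarrow> real \<Rightarrow> real \<Rightarrow> site list \<Rightarrow> site list \<Rightarrow> real" where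
  "revisit_sum L N c0 c1 p q = (\<Sum>v<Suc ((N + 1) * (L + 1)). \<Sum>k\<le>N.
     of_bool (revisits L N p q v k) * (c0 + c1 * (max_norm L N (drop (Suc v) q))\<^sup>2))"

lemma avg_tl:
  "avg (Suc m) (\<lambda>z. G (drop 1 z)) = avg m G"
  by simp

text \<open>
The steps after time \<open>v\<close> are independent of the event that an erased point is visited at time \<open>v\<close>, for each
fixed \<open>v\<close>; hence the number of visits and the moment of the restarted walk factorise.
\<close>

lemma revisit_sum_le:
  assumes p: "set p \<subseteq> steps" "R \<le> supn (sum_list p)" "int N < R"
    and m: "2 * ((N + 1) * (L + 1)) \<le> m"
    and c: "0 \<le> c0" "0 \<le> c1"
  shows "avg m (revisit_sum L N c0 c1 p) \<le> return_bound N R * (c0 + c1 * max_moment L N)"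
proof -
  define H where "H = (N + 1) * (L + 1)"
  define C where "C = c0 + c1 * max_moment L N"
  have C: "0 \<le> C" using c max_moment_nonneg by (simp add: C_def)
  have summand: "avg m (\<lambda>q. of_bool (revisits L N p q v k) * (c0 + c1 * (max_norm L N (drop (Suc v) q))\<^sup>2))
      = avg v (\<lambda>ys. of_bool (sum_list p + sum_list ys = erase L k p)) * C" if v: "v < Suc H" for v k
  proof -
    obtain m' where m': "m - v = Suc m'" "N * (L + 1) \<le> m'"
    proof
      show "m - v = Suc (m - v - 1)" using m v by (simp add: H_def)
      show "N * (L + 1) \<le> m - v - 1" using m v by (simp add: H_def)
    qed
    have "avg m (\<lambda>q. of_bool (revisits L N p q v k) * (c0 + c1 * (max_norm L N (drop (Suc v) q))\<^sup>2))
      = avg (v + (m - v)) (\<lambda>q. of_bool (revisits L N p q v k) * (c0 + c1 * (max_norm L N (drop (Suc v) q))\<^sup>2))"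
      using m v by (simp add: H_def)
    also have "\<dots> = avg v (\<lambda>ys. of_bool (sum_list p + sum_list ys = erase L k p) * C)"
      unfolding avg_append
    proof (rule avg_cong)
      fix ys assume ys: "ys \<in> words v"
      have "avg (m - v) (\<lambda>z. of_bool (revisits L N p (ys @ z) v k) * (c0 + c1 * (max_norm L N (drop (Suc v) (ys @ z)))\<^sup>2))
         = of_bool (sum_list p + sum_list ys = erase L k p) * avg (Suc m') (\<lambda>z. c0 + c1 * (max_norm L N (drop 1 z))\<^sup>2)"
        unfolding m' avg_cmult[symmetric] using ys
        by (intro avg_cong) (simp add: revisits_def words_length Suc_diff_le)
      also have "avg (Suc m') (\<lambda>z. c0 + c1 * (max_norm L N (drop 1 z))\<^sup>2) = C"
        unfolding avg_tl[where G = "\<lambda>z. c0 + c1 * (max_norm L N z)\<^sup>2"] C_def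
        using m'(2) by (simp add: avg_add avg_cmult avg_max_norm)
      finally show "avg (m - v) (\<lambda>z. of_bool (revisits L N p (ys @ z) v k) * (c0 + c1 * (max_norm L N (drop (Suc v) (ys @ z)))\<^sup>2))
         = of_bool (sum_list p + sum_list ys = erase L k p) * C" .
    qed
    finally show ?thesis by (simp add: avg_multc)
  qed
  have vis: "(\<Sum>v<Suc H. avg v (\<lambda>ys. of_bool (sum_list p + sum_list ys = erase L k p))) \<le> green_const / real_of_int (R - int N)"
    if k: "k \<le> N" for k
  proof -
    have "supn (sum_list p) \<le> supn (sum_list p - erase L k p) + supn (erase L k p)"
      using supn_triangle[of "sum_list p - erase L k p" "erase L k p"] by simp
    moreover have "supn (erase L k p) \<le> int N"
      using supn_erase_le[OF p(1), of L k] k by linarith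
    ultimately have "R - int N \<le> supn (sum_list p - erase L k p)" using p(2) by linarith
    then have "newton (sum_list p - erase L k p) \<le> 1 / real_of_int (R - int N)"
      using p(3) by (intro newton_le_supn) auto
    then have "green_const * newton (sum_list p - erase L k p) \<le> green_const * (1 / real_of_int (R - int N))"
      using green_const_pos by (intro mult_left_mono) auto
    then show ?thesis using expected_visits_le[of "sum_list p" "erase L k p" "Suc H"] by simp
  qed
  have "avg m (revisit_sum L N c0 c1 p)
    = (\<Sum>v<Suc H. \<Sum>k\<le>N. avg v (\<lambda>ys. of_bool (sum_list p + sum_list ys = erase L k p)) * C)"
    unfolding revisit_sum_def[abs_def] H_def[symmetric] avg_sum by (intro sum.cong) (use summand in auto)
  also have "\<dots> = (\<Sum>k\<le>N. (\<Sum>v<Suc H. avg v (\<lambda>ys. of_bool (sum_list p + sum_list ys = erase L k p))) * C)"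
    by (subst sum.swap) (simp only: sum_distrib_right)
  also have "\<dots> \<le> (\<Sum>k\<le>N. green_const / real_of_int (R - int N) * C)"
    using C by (intro sum_mono mult_right_mono vis) auto
  also have "\<dots> = return_bound N R * C" by (simp add: return_bound_def)
  finally show ?thesis unfolding C_def .
qed

text \<open>
Both bounds replace the event of a change by the number of visits to the erased points. The constants
in the second one come from \<open>(x + 1 + y)^2 \<le> 2 x^2 + 4 + 4 y^2\<close>.
\<close>

lemma differs_bounds:
  assumes p: "set p \<subseteq> steps" "R \<le> supn (sum_list p)" "int N < R" "length p \<le> L"
    and m: "2 * ((N + 1) * (L + 1)) \<le> m"
  shows "avg m (\<lambda>q. of_bool (differs L N p q)) \<le> return_bound N R"
    and "avg m (\<lambda>q. of_bool (differs L N p q) * (max_norm L N (p @ q))\<^sup>2)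
      \<le> return_bound N R * (2 * (max_norm L N p)\<^sup>2 + 4 + 4 * max_moment L N)"
proof -
  define H where "H = (N + 1) * (L + 1)"
  have wit: "\<exists>v<Suc H. \<exists>k\<le>N. revisits L N p q v k \<and>
      max_norm L N (p @ q) \<le> max_norm L N p + 1 + max_norm L N (drop (Suc v) q)"
    if q: "q \<in> words m" and d: "differs L N p q" for q
  proof -
    have "\<exists>k\<le>N. \<exists>v\<le>length q. restarts L N p q k v"
      using erase_append_dichotomy[OF p(4), of N q] d p q
      unfolding differs_def by (auto simp: words_def)
    then obtain k v where k: "k \<le> N" and restarts: "restarts L N p q k v"
      by blast
    have vis: "revisits L N p q v k" and vl: "v + length p \<le> (k + 1) * (L + 1)"
      using restarts unfolding restarts_def revisits_def by simp_all
    have all: "(\<exists>i'\<le>N. erase L i (p @ q) = erase L i' p) \<or>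
        (\<exists>i'\<le>N. \<exists>e. supn e \<le> 1 \<and> erase L i (p @ q) = erase L k p + e + erase L i' (drop (Suc v) q))"
      if "i \<le> N" for i
      using restarts that unfolding restarts_def by simp
    have "(k + 1) * (L + 1) \<le> H" unfolding H_def using k by (intro mult_le_mono) auto
    then have "v < Suc H" using vl by simp
    moreover have "max_norm L N (p @ q) \<le> max_norm L N p + 1 + max_norm L N (drop (Suc v) q)"
    proof (rule max_norm_leI)
      fix i assume "i \<le> N"
      from all[OF this] show "real_of_int (supn (erase L i (p @ q))) \<le> max_norm L N p + 1 + max_norm L N (drop (Suc v) q)"
      proof (elim disjE exE conjE)
        fix i' assume "i' \<le> N" "erase L i (p @ q) = erase L i' p"
        then show ?thesis using max_norm_ge[of i' N L p] max_norm_nonneg[of L N "drop (Suc v) q"] by simp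
      next
        fix i' e assume *: "i' \<le> N" "supn e \<le> 1" "erase L i (p @ q) = erase L k p + e + erase L i' (drop (Suc v) q)"
        have "supn (erase L i (p @ q)) \<le> supn (erase L k p) + 1 + supn (erase L i' (drop (Suc v) q))"
          using supn_triangle[of "erase L k p + e" "erase L i' (drop (Suc v) q)"] supn_triangle[of "erase L k p" e] * by simp
        then have "real_of_int (supn (erase L i (p @ q))) \<le> real_of_int (supn (erase L k p)) + 1 + real_of_int (supn (erase L i' (drop (Suc v) q)))"
          by linarith
        then show ?thesis using max_norm_ge[OF k, of L p] max_norm_ge[OF *(1), of L "drop (Suc v) q"] by simp
      qed
    qed
    ultimately show ?thesis using k vis by blast
  qed
  have dominate: "x \<le> revisit_sum L N c0 c1 p q"
    if "v < Suc H" "k \<le> N" "revisits L N p q v k" "x \<le> c0 + c1 * (max_norm L N (drop (Suc v) q))\<^sup>2" "0 \<le> c0" "0 \<le> c1"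
    for x c0 c1 q v k
  proof -
    let ?f = "\<lambda>v k. of_bool (revisits L N p q v k) * (c0 + c1 * (max_norm L N (drop (Suc v) q))\<^sup>2)"
    have nn: "0 \<le> ?f v k" for v k using that by simp
    have "x \<le> ?f v k" using that by simp
    also have "\<dots> \<le> (\<Sum>k\<le>N. ?f v k)" using that nn by (intro member_le_sum) auto
    also have "\<dots> \<le> (\<Sum>v<Suc H. \<Sum>k\<le>N. ?f v k)"
      using that nn by (intro member_le_sum[where f = "\<lambda>v. \<Sum>k\<le>N. ?f v k"] sum_nonneg) auto
    finally show ?thesis unfolding revisit_sum_def H_def .
  qed
  have nonneg: "0 \<le> revisit_sum L N c0 c1 p q" if "0 \<le> c0" "0 \<le> c1" for c0 c1 q
    unfolding revisit_sum_def using that by (intro sum_nonneg) auto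
  have "avg m (\<lambda>q. of_bool (differs L N p q)) \<le> avg m (revisit_sum L N 1 0 p)"
  proof (rule avg_mono)
    fix q assume q: "q \<in> words m"
    show "of_bool (differs L N p q) \<le> revisit_sum L N 1 0 p q"
    proof (cases "differs L N p q")
      case True
      then obtain v k where "v < Suc H" "k \<le> N" "revisits L N p q v k" using wit[OF q] by blast
      then show ?thesis using True by (intro dominate) auto
    next
      case False
      then show ?thesis using nonneg[of 1 0 q] by simp
    qed
  qed
  also have "\<dots> \<le> return_bound N R * (1 + 0 * max_moment L N)"
    using p m by (intro revisit_sum_le) auto
  finally show "avg m (\<lambda>q. of_bool (differs L N p q)) \<le> return_bound N R" by simp
  have "avg m (\<lambda>q. of_bool (differs L N p q) * (max_norm L N (p @ q))\<^sup>2) 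
      \<le> avg m (revisit_sum L N (2 * (max_norm L N p)\<^sup>2 + 4) 4 p)"
  proof (rule avg_mono)
    fix q assume q: "q \<in> words m"
    show "of_bool (differs L N p q) * (max_norm L N (p @ q))\<^sup>2 
      \<le> revisit_sum L N (2 * (max_norm L N p)\<^sup>2 + 4) 4 p q"
    proof (cases "differs L N p q")
      case True
      then obtain v k where vk: "v < Suc H" "k \<le> N" "revisits L N p q v k"
        and le: "max_norm L N (p @ q) \<le> max_norm L N p + 1 + max_norm L N (drop (Suc v) q)" using wit[OF q] by blast
      define a where "a = max_norm L N p"
      define b where "b = max_norm L N (drop (Suc v) q)"
      have "(max_norm L N (p @ q))\<^sup>2 \<le> (a + 1 + b)\<^sup>2"
        using le max_norm_nonneg unfolding a_def b_def by (intro power_mono) auto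
      also have "\<dots> \<le> 2 * a\<^sup>2 + 4 + 4 * b\<^sup>2"
        using zero_le_power2[of "a - (1 + b)"] zero_le_power2[of "1 - b"]
        by (simp add: power2_eq_square algebra_simps)
      finally have "(max_norm L N (p @ q))\<^sup>2 \<le> (2 * (max_norm L N p)\<^sup>2 + 4) + 4 * (max_norm L N (drop (Suc v) q))\<^sup>2"
        by (simp add: a_def b_def)
      then show ?thesis using True vk by (intro dominate) auto
    next
      case False
      then show ?thesis using nonneg[of "2 * (max_norm L N p)\<^sup>2 + 4" 4 q] by simp
    qed
  qed
  also have "\<dots> \<le> return_bound N R * ((2 * (max_norm L N p)\<^sup>2 + 4) + 4 * max_moment L N)"
    using p m by (intro revisit_sum_le) auto
  finally show "avg m (\<lambda>q. of_bool (differs L N p q) * (max_norm L N (p @ q))\<^sup>2)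
      \<le> return_bound N R * (2 * (max_norm L N p)\<^sup>2 + 4 + 4 * max_moment L N)" .
qed

lemma sq_norm_diff_le:
  fixes a b :: real
  assumes "\<bar>real_of_int (supn x)\<bar> \<le> a" "\<bar>real_of_int (supn y)\<bar> \<le> b"
  shows "\<bar>real_of_int (sq_norm x) - real_of_int (sq_norm y)\<bar> \<le> 3 * (a\<^sup>2 + b\<^sup>2)"
proof -
  have "real_of_int (sq_norm z) \<le> 3 * c\<^sup>2" if "\<bar>real_of_int (supn z)\<bar> \<le> c" for z c
  proof -
    have "real_of_int (sq_norm z) \<le> real_of_int (3 * (supn z)\<^sup>2)"
      using sq_norm_le_supn[of z] by (simp only: of_int_le_iff)
    also have "\<dots> \<le> 3 * c\<^sup>2"
      using power_mono[OF that, of 2] by simp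
    finally show ?thesis .
  qed
  then have "real_of_int (sq_norm x) \<le> 3 * a\<^sup>2" "real_of_int (sq_norm y) \<le> 3 * b\<^sup>2" using assms by auto
  moreover have "0 \<le> real_of_int (sq_norm x)" "0 \<le> real_of_int (sq_norm y)" by auto
  ultimately show ?thesis unfolding abs_le_iff distrib_left by linarith
qed

text \<open>
Both cutoffs are compared with the loop erasure of the path stopped on leaving the cube, whose maximum has
second moment \<open>a\<close>. Given the stopped path, with probability at least 7/8 the maximum for either cutoff is that
of the stopped path, so \<open>a\<close> is at most twice either maximal moment. Conversely the maximal moment for \<open>L\<close> is bounded
in terms of \<open>a\<close>, its own contribution on the exceptional event being absorbed on the left-hand side. Thus everything is
controlled by the moment for \<open>L'\<close>, the cutoff that later tends to infinity.
\<close>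

lemma cutoff_comparison:
  fixes N L L' n :: nat and R :: int
  defines "q0 \<equiv> return_bound N R" and "\<eta> \<equiv> escape {x. R \<le> supn x} L 0"
  assumes R: "int N < R" and L: "L \<le> L'" and q0: "q0 \<le> 1 / 8"
    and n: "L + 2 * ((N + 1) * (L' + 1)) \<le> n"
  shows "\<bar>avg n (\<lambda>xs. real_of_int (sq_norm (erase L N xs))) - avg n (\<lambda>xs. real_of_int (sq_norm (erase L' N xs)))\<bar>
      \<le> 108 * q0 * (max_moment L' N + 1) + 12 * (real N)\<^sup>2 * \<eta>"
    and "avg n (\<lambda>xs. of_bool (erase L N xs \<noteq> erase L' N xs)) \<le> 2 * q0 + \<eta>"
proof -
  have q0_nn: "0 \<le> q0"
    unfolding q0_def using R by (rule return_bound_nonneg)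
  have \<eta>_nn: "0 \<le> \<eta>" unfolding \<eta>_def by (rule escape_nonneg)
  have Ln: "L \<le> n" using n by simp
  have Nn: "N * (L' + 1) \<le> n" "N * (L + 1) \<le> n"
  proof -
    show *: "N * (L' + 1) \<le> n" using n by simp
    show "N * (L + 1) \<le> n" using L by (intro order_trans[OF _ *] mult_le_mono) auto
  qed
  define top where "top p = (max_norm L N p)\<^sup>2" for p
  have top': "max_norm L' N p = max_norm L N p" if "length p \<le> L" for p
    using erase_cutoff_irrelevant[of p L' L] that L by (intro max_norm_cong) simp
  define a where "a = stopped_avg R L top"
  have a_nn: "0 \<le> a"
    using stopped_avg_mono[of R L "\<lambda>_. 0" top] stopped_avg_cmult[of R L 0 top] by (simp add: a_def top_def)
  have room: "2 * ((N + 1) * (K + 1)) \<le> n - length p" if "K \<in> {L, L'}" "length p \<le> L" for K p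
  proof -
    have "(N + 1) * (K + 1) \<le> (N + 1) * (L' + 1)" using that L by (intro mult_le_mono) auto
    then show ?thesis using n that by linarith
  qed
  have same: "max_norm K N p = max_norm L N p" "erase K i p = erase L i p" if "K \<in> {L, L'}" "length p \<le> L" for K p i
    using that top' erase_cutoff_irrelevant[of p L' L] L by auto
  have dprob: "avg (n - length p) (\<lambda>q. of_bool (differs K N p q)) \<le> q0"
    if "K \<in> {L, L'}" "exits R p" "set p \<subseteq> steps" "length p \<le> L" for K p
    unfolding q0_def using that R L room[OF that(1,4)]
    by (intro differs_bounds) (auto simp: exits_def)
  have dmom: "avg (n - length p) (\<lambda>q. of_bool (differs K N p q) * (max_norm K N (p @ q))\<^sup>2)
     \<le> q0 * (2 * top p + (4 + 4 * max_moment K N))"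
    if "K \<in> {L, L'}" "exits R p" "set p \<subseteq> steps" "length p \<le> L" for K p
    using differs_bounds(2)[of p R N K "n - length p"] that R L room[OF that(1,4)] same(1)[OF that(1,4)]
    by (simp add: exits_def q0_def top_def add.assoc) auto
  have bK: "avg n (\<lambda>xs. (max_norm K N xs)\<^sup>2) = max_moment K N" if "K \<in> {L, L'}" for K
    using that Nn by (auto intro: avg_max_norm)
  have lower: "a \<le> 2 * max_moment K N" if K: "K \<in> {L, L'}" for K
  proof -
    have "stopped_avg R L (\<lambda>p. 7 / 8 * top p) \<le> stopped_avg R L (\<lambda>p. avg (n - length p) (\<lambda>q. (max_norm K N (p @ q))\<^sup>2))"
    proof (rule stopped_avg_mono)
      fix p assume p: "exits R p" "set p \<subseteq> steps" "length p \<le> L"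
      have "7 / 8 * top p \<le> (1 - avg (n - length p) (\<lambda>q. of_bool (differs K N p q))) * top p"
        using dprob[OF K p] q0 by (intro mult_right_mono) (auto simp: top_def)
      also have "\<dots> = avg (n - length p) (\<lambda>q. (1 - of_bool (differs K N p q)) * top p)"
        by (simp only: avg_multc avg_diff avg_const)
      also have "\<dots> \<le> avg (n - length p) (\<lambda>q. (max_norm K N (p @ q))\<^sup>2)"
      proof (rule avg_mono)
        fix q
        show "(1 - of_bool (differs K N p q)) * top p \<le> (max_norm K N (p @ q))\<^sup>2"
        proof (cases "differs K N p q")
          case False
          then have "max_norm K N (p @ q) = max_norm K N p"
            unfolding differs_def by (intro max_norm_cong) blast
          then show ?thesis using False same(1)[OF K p(3)] by (simp add: top_def)
        qed simp
      qed
      finally show "7 / 8 * top p \<le> avg (n - length p) (\<lambda>q. (max_norm K N (p @ q))\<^sup>2)" .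
    qed
    also have "\<dots> \<le> avg n (\<lambda>xs. (max_norm K N xs)\<^sup>2)"
      using Ln by (intro stopped_avg_avg_le) auto
    finally have "7 / 8 * a \<le> max_moment K N" unfolding stopped_avg_cmult bK[OF K] a_def .
    then show ?thesis using a_nn by simp
  qed
  have dtotal: "stopped_avg R L (\<lambda>p. avg (n - length p) (\<lambda>q. of_bool (differs K N p q) * (max_norm K N (p @ q))\<^sup>2))
      \<le> q0 * (2 * a + 4 + 4 * max_moment K N)" if K: "K \<in> {L, L'}" for K
  proof -
    have "stopped_avg R L (\<lambda>p. avg (n - length p) (\<lambda>q. of_bool (differs K N p q) * (max_norm K N (p @ q))\<^sup>2))
       \<le> stopped_avg R L (\<lambda>p. q0 * (2 * top p + (4 + 4 * max_moment K N)))"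
      by (rule stopped_avg_mono) (rule dmom[OF K])
    also have "\<dots> = q0 * (2 * a + stopped_avg R L (\<lambda>_. 4 + 4 * max_moment K N))"
      by (simp only: stopped_avg_cmult stopped_avg_add a_def)
    also have "\<dots> \<le> q0 * (2 * a + (4 + 4 * max_moment K N))"
      using q0_nn max_moment_nonneg by (intro mult_left_mono add_left_mono stopped_avg_const_le) auto
    finally show ?thesis by (simp add: add.assoc)
  qed
  have upper: "max_moment L N \<le> 5 / 2 * a + 1 + 2 * (real N)\<^sup>2 * \<eta>"
  proof -
    have "avg n (\<lambda>xs. (max_norm L N xs)\<^sup>2)
      \<le> stopped_avg R L (\<lambda>p. avg (n - length p) (\<lambda>q. (max_norm L N (p @ q))\<^sup>2)) + (real N)\<^sup>2 * \<eta>"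
      unfolding \<eta>_def using Ln max_norm_le max_norm_nonneg
      by (intro avg_le_stopped_avg) (auto simp: words_set intro!: power_mono)
    also have "stopped_avg R L (\<lambda>p. avg (n - length p) (\<lambda>q. (max_norm L N (p @ q))\<^sup>2))
      \<le> stopped_avg R L (\<lambda>p. top p + avg (n - length p) (\<lambda>q. of_bool (differs L N p q) * (max_norm L N (p @ q))\<^sup>2))"
    proof (rule stopped_avg_mono)
      fix p
      have "avg (n - length p) (\<lambda>q. (max_norm L N (p @ q))\<^sup>2)
        \<le> avg (n - length p) (\<lambda>q. top p + of_bool (differs L N p q) * (max_norm L N (p @ q))\<^sup>2)"
      proof (rule avg_mono)
        fix q
        show "(max_norm L N (p @ q))\<^sup>2 \<le> top p + of_bool (differs L N p q) * (max_norm L N (p @ q))\<^sup>2"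
          proof (cases "differs L N p q")
            case False
            then have "max_norm L N (p @ q) = max_norm L N p"
              unfolding differs_def by (intro max_norm_cong) blast
            then show ?thesis by (simp add: top_def)
          qed (simp add: top_def)
      qed
      then show "avg (n - length p) (\<lambda>q. (max_norm L N (p @ q))\<^sup>2)
        \<le> top p + avg (n - length p) (\<lambda>q. of_bool (differs L N p q) * (max_norm L N (p @ q))\<^sup>2)"
        by (simp add: avg_add)
    qed
    also have "\<dots> \<le> a + q0 * (2 * a + 4 + 4 * max_moment L N)"
      unfolding stopped_avg_add using dtotal[of L] by (simp add: a_def)
    also have "q0 * (2 * a + 4 + 4 * max_moment L N) \<le> 1 / 8 * (2 * a + 4 + 4 * max_moment L N)"
      using q0 a_nn max_moment_nonneg[of L N] by (intro mult_right_mono) auto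
    finally have "avg n (\<lambda>xs. (max_norm L N xs)\<^sup>2) \<le> a + 1 / 8 * (2 * a + 4 + 4 * max_moment L N) + (real N)\<^sup>2 * \<eta>"
      by simp
    then have "max_moment L N \<le> a + 1 / 8 * (2 * a + 4 + 4 * max_moment L N) + (real N)\<^sup>2 * \<eta>"
      using bK[of L] by simp
    moreover have "2 * (real N)\<^sup>2 * \<eta> = 2 * ((real N)\<^sup>2 * \<eta>)" by simp
    ultimately show ?thesis by argo
  qed
  define \<Delta> where "\<Delta> xs = \<bar>real_of_int (sq_norm (erase L N xs)) - real_of_int (sq_norm (erase L' N xs))\<bar>" for xs
  \<comment> \<open>Where one erased walk agrees with the stopped path, its square is bounded by \<open>top p\<close>.\<close>
  have \<Delta>_le: "\<Delta> (p @ q) \<le> 3 * (of_bool (differs L N p q) * (max_norm L N (p @ q))\<^sup>2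
      + of_bool (differs L' N p q) * (max_norm L' N (p @ q))\<^sup>2
      + (of_bool (differs L N p q) + of_bool (differs L' N p q)) * top p)"
    if p: "length p \<le> L" for p q
  proof -
    have S: "\<bar>real_of_int (supn (erase K N (p @ q)))\<bar> \<le> (if differs K N p q then max_norm K N (p @ q) else max_norm L N p)"
      if "K \<in> {L, L'}" for K
      using max_norm_ge[of N N K "p @ q"] max_norm_ge[of N N L p] same(2)[OF that p, of N]
      by (auto simp: differs_def)
    show ?thesis
    proof (cases "differs L N p q \<or> differs L' N p q")
      case True
      then show ?thesis
        using sq_norm_diff_le[OF S[of L] S[of L']] zero_le_power2[of "max_norm L N p"]
        unfolding \<Delta>_def top_def by (auto intro: order_trans)
    next
      case False
      then have "erase L N (p @ q) = erase L' N (p @ q)"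
        using same(2)[of L' p N] p by (auto simp: differs_def)
      then show ?thesis using False by (simp add: \<Delta>_def)
    qed
  qed
  have "avg n \<Delta> \<le> stopped_avg R L (\<lambda>p. avg (n - length p) (\<lambda>q. \<Delta> (p @ q))) + (6 * (real N)\<^sup>2) * \<eta>"
    unfolding \<eta>_def
  proof (rule avg_le_stopped_avg[OF Ln])
    fix xs assume xs: "xs \<in> words n"
    show "0 \<le> \<Delta> xs" by (simp add: \<Delta>_def)
    have "\<bar>real_of_int (supn (erase K N xs))\<bar> \<le> real N" for K
      using max_norm_ge[of N N K xs] max_norm_le[of xs K N] xs by (simp add: words_set)
    from sq_norm_diff_le[OF this this] show "\<Delta> xs \<le> 6 * (real N)\<^sup>2" by (simp add: \<Delta>_def)
  qed
  also have "stopped_avg R L (\<lambda>p. avg (n - length p) (\<lambda>q. \<Delta> (p @ q)))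
     \<le> stopped_avg R L (\<lambda>p. 3 * (avg (n - length p) (\<lambda>q. of_bool (differs L N p q) * (max_norm L N (p @ q))\<^sup>2)
        + avg (n - length p) (\<lambda>q. of_bool (differs L' N p q) * (max_norm L' N (p @ q))\<^sup>2)
        + (2 * q0) * top p))"
  proof (rule stopped_avg_mono)
    fix p assume p: "exits R p" "set p \<subseteq> steps" "length p \<le> L"
    have "avg (n - length p) (\<lambda>q. \<Delta> (p @ q)) \<le> avg (n - length p) (\<lambda>q.
      3 * (of_bool (differs L N p q) * (max_norm L N (p @ q))\<^sup>2
      + of_bool (differs L' N p q) * (max_norm L' N (p @ q))\<^sup>2
      + (of_bool (differs L N p q) + of_bool (differs L' N p q)) * top p))"
      by (rule avg_mono) (rule \<Delta>_le[OF p(3)])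
    also have "\<dots> = 3 * (avg (n - length p) (\<lambda>q. of_bool (differs L N p q) * (max_norm L N (p @ q))\<^sup>2)
        + avg (n - length p) (\<lambda>q. of_bool (differs L' N p q) * (max_norm L' N (p @ q))\<^sup>2)
        + (avg (n - length p) (\<lambda>q. of_bool (differs L N p q)) + avg (n - length p) (\<lambda>q. of_bool (differs L' N p q))) * top p)"
      by (simp only: avg_cmult avg_add avg_multc)
    also have "\<dots> \<le> 3 * (avg (n - length p) (\<lambda>q. of_bool (differs L N p q) * (max_norm L N (p @ q))\<^sup>2)
        + avg (n - length p) (\<lambda>q. of_bool (differs L' N p q) * (max_norm L' N (p @ q))\<^sup>2)
        + (2 * q0) * top p)"
      using dprob[of L p] dprob[of L' p] p
      by (intro mult_left_mono add_left_mono mult_right_mono) (auto simp: top_def)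
    finally show "avg (n - length p) (\<lambda>q. \<Delta> (p @ q)) \<le> 3 * (avg (n - length p) (\<lambda>q. of_bool (differs L N p q) * (max_norm L N (p @ q))\<^sup>2)
        + avg (n - length p) (\<lambda>q. of_bool (differs L' N p q) * (max_norm L' N (p @ q))\<^sup>2)
        + (2 * q0) * top p)" .
  qed
  also have "\<dots> \<le> 3 * (q0 * (2 * a + 4 + 4 * max_moment L N) + q0 * (2 * a + 4 + 4 * max_moment L' N) + 2 * q0 * a)"
    unfolding stopped_avg_cmult stopped_avg_add a_def[symmetric]
    using dtotal[of L] dtotal[of L'] q0_nn by (intro mult_left_mono add_mono) auto
  also have "\<dots> = q0 * (18 * a + 24 + 12 * max_moment L N + 12 * max_moment L' N)"
    by (simp add: algebra_simps)
  also have "\<dots> \<le> q0 * (108 * max_moment L' N + 36 + 24 * ((real N)\<^sup>2 * \<eta>))"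
    using lower[of L'] upper q0_nn by (intro mult_left_mono) auto
  also have "\<dots> = q0 * (108 * max_moment L' N + 36) + q0 * (24 * ((real N)\<^sup>2 * \<eta>))"
    by (simp add: algebra_simps)
  also have "q0 * (24 * ((real N)\<^sup>2 * \<eta>)) \<le> 1 / 8 * (24 * ((real N)\<^sup>2 * \<eta>))"
    using q0 \<eta>_nn by (intro mult_right_mono) auto
  also have "q0 * (108 * max_moment L' N + 36) \<le> q0 * (108 * (max_moment L' N + 1))"
    using q0_nn by (intro mult_left_mono) auto
  finally have "avg n \<Delta> \<le> 108 * q0 * (max_moment L' N + 1) + 9 * ((real N)\<^sup>2 * \<eta>)"
    by (simp add: algebra_simps)
  moreover have "\<bar>avg n (\<lambda>xs. real_of_int (sq_norm (erase L N xs))) - avg n (\<lambda>xs. real_of_int (sq_norm (erase L' N xs)))\<bar> \<le> avg n \<Delta>"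
  proof (rule abs_leI)
    show "avg n (\<lambda>xs. real_of_int (sq_norm (erase L N xs))) - avg n (\<lambda>xs. real_of_int (sq_norm (erase L' N xs))) \<le> avg n \<Delta>"
      unfolding avg_diff[symmetric] \<Delta>_def by (rule avg_mono) simp
    have "avg n (\<lambda>xs. real_of_int (sq_norm (erase L' N xs))) - avg n (\<lambda>xs. real_of_int (sq_norm (erase L N xs))) \<le> avg n \<Delta>"
      unfolding avg_diff[symmetric] \<Delta>_def by (rule avg_mono) simp
    then show "- (avg n (\<lambda>xs. real_of_int (sq_norm (erase L N xs))) - avg n (\<lambda>xs. real_of_int (sq_norm (erase L' N xs)))) \<le> avg n \<Delta>" by simp
  qed
  moreover have "0 \<le> (real N)\<^sup>2 * \<eta>" using \<eta>_nn by simp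
  ultimately show "\<bar>avg n (\<lambda>xs. real_of_int (sq_norm (erase L N xs))) - avg n (\<lambda>xs. real_of_int (sq_norm (erase L' N xs)))\<bar>
      \<le> 108 * q0 * (max_moment L' N + 1) + 12 * (real N)\<^sup>2 * \<eta>" by simp
  have "avg n (\<lambda>xs. of_bool (erase L N xs \<noteq> erase L' N xs))
      \<le> stopped_avg R L (\<lambda>p. avg (n - length p) (\<lambda>q. of_bool (erase L N (p @ q) \<noteq> erase L' N (p @ q)))) + 1 * \<eta>"
    unfolding \<eta>_def by (rule avg_le_stopped_avg[OF Ln]) auto
  also have "stopped_avg R L (\<lambda>p. avg (n - length p) (\<lambda>q. of_bool (erase L N (p @ q) \<noteq> erase L' N (p @ q))))
      \<le> stopped_avg R L (\<lambda>_. 2 * q0)"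
  proof (rule stopped_avg_mono)
    fix p assume p: "exits R p" "set p \<subseteq> steps" "length p \<le> L"
    have "avg (n - length p) (\<lambda>q. of_bool (erase L N (p @ q) \<noteq> erase L' N (p @ q)))
      \<le> avg (n - length p) (\<lambda>q. of_bool (differs L N p q) + of_bool (differs L' N p q))"
    proof (rule avg_mono)
      fix q
      show "of_bool (erase L N (p @ q) \<noteq> erase L' N (p @ q)) \<le> (of_bool (differs L N p q) + of_bool (differs L' N p q) :: real)"
        using same(2)[of L' p N] p by (auto simp: differs_def)
    qed
    also have "\<dots> \<le> 2 * q0"
      unfolding avg_add using dprob[of L p] dprob[of L' p] p by auto
    finally show "avg (n - length p) (\<lambda>q. of_bool (erase L N (p @ q) \<noteq> erase L' N (p @ q))) \<le> 2 * q0" .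
  qed
  also have "\<dots> \<le> 2 * q0" using q0_nn by (intro stopped_avg_const_le) auto
  finally show "avg n (\<lambda>xs. of_bool (erase L N xs \<noteq> erase L' N xs)) \<le> 2 * q0 + \<eta>" by simp
qed

section \<open>Transfer to the probability space\<close>

definition increments :: "(nat \<Rightarrow> site) \<Rightarrow> nat \<Rightarrow> site list" where
  "increments w n = map (\<lambda>i. w (Suc i) - w i) [0..<n]"

lemma length_increments [simp]: "length (increments w n) = n"
  by (simp add: increments_def)

lemma sum_list_increments: "sum_list (increments w n) = w n - w 0"
  by (induction n) (auto simp: increments_def)

lemma take_increments: "j \<le> n \<Longrightarrow> take j (increments w n) = increments w j"
  by (simp add: increments_def take_map)

definition shift :: "(nat \<Rightarrow> site) \<Rightarrow> nat \<Rightarrow> nat \<Rightarrow> site" where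
  "shift w u j = w (u + 1 + j) - w (u + 1)"

lemma drop_increments:
  assumes "u < n"
  shows "drop u (increments w n) = (w (Suc u) - w u) # increments (shift w u) (n - u - 1)"
proof (rule nth_equalityI)
  fix i assume "i < length (drop u (increments w n))"
  then show "drop u (increments w n) ! i = ((w (Suc u) - w u) # increments (shift w u) (n - u - 1)) ! i"
    by (cases i) (auto simp: increments_def shift_def)
qed (use assms in simp)

locale walk = prob_space M for M :: "'a measure" +
  fixes S :: "nat \<Rightarrow> 'a \<Rightarrow> site"
  assumes srw: "simple_random_walk M S"
begin

lemma S_0: "\<omega> \<in> space M \<Longrightarrow> S 0 \<omega> = 0"
  using srw by (simp add: simple_random_walk_def)

lemma indep_increments: "indep_vars (\<lambda>_. count_space UNIV) (\<lambda>n \<omega>. S (Suc n) \<omega> - S n \<omega>) UNIV"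
  using srw by (simp add: simple_random_walk_def)

lemma increments_measurable [measurable]: "(\<lambda>\<omega>. S (Suc n) \<omega> - S n \<omega>) \<in> M \<rightarrow>\<^sub>M count_space UNIV"
  using indep_increments by (simp add: indep_vars_def2)

lemma S_measurable [measurable]: "S n \<in> M \<rightarrow>\<^sub>M count_space UNIV"
proof (induction n)
  case 0
  have "S 0 \<in> M \<rightarrow>\<^sub>M count_space UNIV \<longleftrightarrow> (\<lambda>_. 0) \<in> M \<rightarrow>\<^sub>M (count_space UNIV :: site measure)"
    by (rule measurable_cong) (simp add: S_0)
  then show ?case by simp
next
  case (Suc n)
  have "(\<lambda>\<omega>. S n \<omega> + (S (Suc n) \<omega> - S n \<omega>)) \<in> M \<rightarrow>\<^sub>M count_space UNIV"
    by (rule measurable_compose_countable[where f = "\<lambda>x \<omega>. x + (S (Suc n) \<omega> - S n \<omega>)", OF _ Suc])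
       (rule measurable_compose[OF increments_measurable], simp)
  then show ?case by simp
qed

lemma prob_increments: "e \<in> steps \<Longrightarrow> prob ((\<lambda>\<omega>. S (Suc n) \<omega> - S n \<omega>) -` {e} \<inter> space M) = 1 / 6"
proof -
  assume e: "e \<in> steps"
  have "prob ((\<lambda>\<omega>. S (Suc n) \<omega> - S n \<omega>) -` {e} \<inter> space M)
    = measure (distr M (count_space UNIV) (\<lambda>\<omega>. S (Suc n) \<omega> - S n \<omega>)) {e}"
    by (rule measure_distr[symmetric]) auto
  also have "\<dots> = pmf (pmf_of_set steps) e"
    using srw unfolding simple_random_walk_def by (simp add: pmf.rep_eq)
  also have "\<dots> = 1 / 6"
    using e by (subst pmf_of_set) (auto simp: indicator_def)
  finally show ?thesis .
qed

definition first_steps :: "nat \<Rightarrow> 'a \<Rightarrow> site list" where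
  "first_steps n \<omega> = increments (\<lambda>j. S j \<omega>) n"

lemma first_steps_measurable [measurable]: "first_steps n \<in> M \<rightarrow>\<^sub>M count_space UNIV"
proof (induction n)
  case 0
  then show ?case by (simp add: first_steps_def increments_def)
next
  case (Suc n)
  have "(\<lambda>\<omega>. first_steps n \<omega> @ [S (Suc n) \<omega> - S n \<omega>]) \<in> M \<rightarrow>\<^sub>M count_space UNIV"
    by (rule measurable_compose_countable[where f = "\<lambda>xs \<omega>. xs @ [S (Suc n) \<omega> - S n \<omega>]", OF _ Suc])
       (rule measurable_compose[OF increments_measurable], simp)
  then show ?case by (simp add: first_steps_def increments_def)
qed

lemma prob_first_steps:
  assumes xs: "xs \<in> words n"
  shows "prob (first_steps n -` {xs} \<inter> space M) = 1 / 6 ^ n"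
proof (cases "n = 0")
  case True
  then have "first_steps n -` {xs} \<inter> space M = space M" using xs by (auto simp: first_steps_def increments_def)
  then show ?thesis using True prob_space by simp
next
  case False
  have len: "length xs = n" using xs by (rule words_length)
  have "first_steps n \<omega> = xs \<longleftrightarrow> (\<forall>i<n. S (Suc i) \<omega> - S i \<omega> = xs ! i)" for \<omega>
    unfolding first_steps_def increments_def list_eq_iff_nth_eq by (simp only: len length_map length_upt) simp
  then have "first_steps n -` {xs} \<inter> space M
     = (\<Inter>i\<in>{..<n}. (\<lambda>\<omega>. S (Suc i) \<omega> - S i \<omega>) -` {xs ! i} \<inter> space M)"
    using False by blast
  also have "prob \<dots> = (\<Prod>i<n. prob ((\<lambda>\<omega>. S (Suc i) \<omega> - S i \<omega>) -` {xs ! i} \<inter> space M))"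
    using False by (intro indep_varsD[OF indep_increments]) auto
  also have "\<dots> = (\<Prod>i<n. 1 / 6)"
  proof (intro prod.cong refl prob_increments)
    fix i assume "i \<in> {..<n}"
    then show "xs ! i \<in> steps" using words_set[OF xs] len by (auto simp: subset_iff)
  qed
  finally show ?thesis by (simp add: power_divide)
qed

lemma AE_first_steps: "AE \<omega> in M. first_steps n \<omega> \<in> words n"
proof -
  have "prob (first_steps n -` words n \<inter> space M) = prob (\<Union>xs\<in>words n. first_steps n -` {xs} \<inter> space M)"
    by (rule arg_cong[where f = prob]) auto
  also have "\<dots> = (\<Sum>xs\<in>words n. prob (first_steps n -` {xs} \<inter> space M))"
    by (rule finite_measure_finite_Union)
       (auto simp: disjoint_family_on_def intro!: measurable_sets[OF first_steps_measurable])
  also have "\<dots> = (\<Sum>xs\<in>words n. 1 / 6 ^ n)"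
    by (intro sum.cong refl prob_first_steps)
  also have "\<dots> = avg n (\<lambda>_. 1)"
    by (simp only: avg_eq_sum sum_divide_distrib)
  finally have "prob (first_steps n -` words n \<inter> space M) = 1" by simp
  moreover have "first_steps n -` words n \<inter> space M \<in> events"
    by (rule measurable_sets[OF first_steps_measurable]) simp
  ultimately show ?thesis
    using prob_eq_1[of "first_steps n -` words n \<inter> space M"] by auto
qed

lemma integral_first_steps: "(\<integral>\<omega>. F (first_steps n \<omega>) \<partial>M) = avg n F"
  and integrable_first_steps: "integrable M (\<lambda>\<omega>. F (first_steps n \<omega>))" for F :: "site list \<Rightarrow> real"
proof -
  have meas: "(\<lambda>\<omega>. F (first_steps n \<omega>)) \<in> borel_measurable M"
    by (rule measurable_compose[OF first_steps_measurable]) simp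
  have ev: "first_steps n -` {xs} \<inter> space M \<in> events" for xs
    by (rule measurable_sets[OF first_steps_measurable]) simp
  have sum_eq: "AE \<omega> in M. (\<Sum>xs\<in>words n. F xs * indicator (first_steps n -` {xs} \<inter> space M) \<omega>) = F (first_steps n \<omega>)"
    using AE_first_steps[of n] AE_space
  proof eventually_elim
    case (elim \<omega>)
    then have "(\<Sum>xs\<in>words n. F xs * indicator (first_steps n -` {xs} \<inter> space M) \<omega>)
      = (\<Sum>xs\<in>words n. if xs = first_steps n \<omega> then F xs else 0)"
      by (intro sum.cong) (auto simp: indicator_def)
    then show ?case using elim by simp
  qed
  have int: "integrable M (\<lambda>\<omega>. \<Sum>xs\<in>words n. F xs * indicator (first_steps n -` {xs} \<inter> space M) \<omega>)"
    using ev by (intro Bochner_Integration.integrable_sum integrable_mult_right) (simp add: emeasure_eq_measure)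
  show "integrable M (\<lambda>\<omega>. F (first_steps n \<omega>))"
    using int meas sum_eq by (rule integrable_cong_AE_imp)
  have "(\<integral>\<omega>. F (first_steps n \<omega>) \<partial>M) = (\<integral>\<omega>. (\<Sum>xs\<in>words n. F xs * indicator (first_steps n -` {xs} \<inter> space M) \<omega>) \<partial>M)"
    using sum_eq meas int by (intro integral_cong_AE) (auto elim: AE_mp)
  also have "\<dots> = (\<Sum>xs\<in>words n. F xs * prob (first_steps n -` {xs} \<inter> space M))"
    using ev by (subst Bochner_Integration.integral_sum) (auto simp: emeasure_eq_measure)
  also have "\<dots> = avg n F"
    by (simp add: prob_first_steps avg_eq_sum sum_divide_distrib)
  finally show "(\<integral>\<omega>. F (first_steps n \<omega>) \<partial>M) = avg n F" .
qed

lemma prob_first_steps_Collect: "\<P>(\<omega> in M. Q (first_steps n \<omega>)) = avg n (\<lambda>xs. of_bool (Q xs))"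
proof -
  have "\<P>(\<omega> in M. Q (first_steps n \<omega>)) = (\<integral>\<omega>. indicator {\<omega>\<in>space M. Q (first_steps n \<omega>)} \<omega> \<partial>M)"
    by simp
  also have "\<dots> = (\<integral>\<omega>. of_bool (Q (first_steps n \<omega>)) \<partial>M)"
    by (intro Bochner_Integration.integral_cong) (auto simp: indicator_def)
  finally show ?thesis by (simp only: integral_first_steps[of "\<lambda>xs. of_bool (Q xs)"])
qed

lemma sum_list_take_first_steps:
  assumes "\<omega> \<in> space M" "j \<le> n"
  shows "sum_list (take j (first_steps n \<omega>)) = S j \<omega>"
  using assms by (simp add: first_steps_def take_increments sum_list_increments S_0)

text \<open>
Transience, by Borel-Cantelli: the expected number of visits to each site is finite.
\<close>

lemma AE_finite_visits: "AE \<omega> in M. \<forall>x. finite {j. S j \<omega> = x}"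
proof -
  have "AE \<omega> in M. finite {j. S j \<omega> = x}" for x
  proof -
    define A where "A n = {\<omega>\<in>space M. S n \<omega> = x}" for n
    have [measurable]: "A n \<in> events" for n
      unfolding A_def by measurable
    have A: "prob (A n) = avg n (\<lambda>ys. of_bool (0 + sum_list ys = x))" for n
    proof -
      have "A n = {\<omega>\<in>space M. 0 + sum_list (first_steps n \<omega>) = x}"
        unfolding A_def using sum_list_take_first_steps[of _ n n] by (auto simp: first_steps_def)
      then show ?thesis using prob_first_steps_Collect[of "\<lambda>ys. 0 + sum_list ys = x" n] by simp
    qed
    have "summable (\<lambda>n. prob (A n))"
    proof (rule summableI_nonneg_bounded)
      show "0 \<le> prob (A n)" for n by simp
      show "(\<Sum>i<n. prob (A i)) \<le> green_const * newton (0 - x)" for n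
        unfolding A by (rule expected_visits_le)
    qed
    then have "AE \<omega> in M. eventually (\<lambda>n. \<omega> \<in> space M - A n) sequentially"
      by (intro borel_cantelli_AE1) (auto simp: emeasure_eq_measure)
    then show ?thesis
    proof eventually_elim
      case (elim \<omega>)
      then obtain n0 where n0: "\<And>n. n0 \<le> n \<Longrightarrow> \<omega> \<in> space M - A n"
        by (auto simp: eventually_sequentially)
      have "{j. S j \<omega> = x} \<subseteq> {..<n0}"
      proof
        fix j assume j: "j \<in> {j. S j \<omega> = x}"
        show "j \<in> {..<n0}"
        proof (rule ccontr)
          assume "j \<notin> {..<n0}"
          then have "\<omega> \<in> space M - A j" by (intro n0) simp
          then show False using j by (simp add: A_def)
        qed
      qed
      then show ?case by (rule finite_subset) simp
    qed
  qed
  then show ?thesis by (simp add: AE_all_countable)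
qed

end

section \<open>Erasure times of an infinite path\<close>

text \<open>
Exactly the condition under which all suprema in the definition of the erasure times are maxima: it
holds for every path if the cutoff is finite, and for transient paths if it is infinite.
\<close>

definition locally_transient :: "ereal \<Rightarrow> (nat \<Rightarrow> site) \<Rightarrow> bool" where
  "locally_transient \<Lambda> w \<longleftrightarrow> (\<forall>v x. finite {j. w j = x \<and> ereal \<bar>real j - real v\<bar> \<le> \<Lambda>})"

lemma locally_transient_finite: "locally_transient (ereal l) w"
  unfolding locally_transient_def
proof (intro allI)
  fix v x
  have "{j. w j = x \<and> ereal \<bar>real j - real v\<bar> \<le> ereal l} \<subseteq> {..v + nat \<lceil>l\<rceil>}"
  proof clarsimp
    fix j assume "\<bar>real j - real v\<bar> \<le> l"
    then have "real j \<le> real v + real_of_int \<lceil>l\<rceil>" by linarith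
    then show "j \<le> v + nat \<lceil>l\<rceil>" by linarith
  qed
  then show "finite {j. w j = x \<and> ereal \<bar>real j - real v\<bar> \<le> ereal l}"
    by (rule finite_subset) simp
qed

lemma locally_transient_infinity: "(\<And>x. finite {j. w j = x}) \<Longrightarrow> locally_transient \<infinity> w"
  by (simp add: locally_transient_def)

lemma locally_transient_shift:
  assumes "locally_transient \<Lambda> w"
  shows "locally_transient \<Lambda> (shift w u)"
  unfolding locally_transient_def
proof (intro allI)
  fix v x
  have "finite ((\<lambda>j. u + 1 + j) -` {j. w j = x + w (u + 1) \<and> ereal \<bar>real j - real (u + 1 + v)\<bar> \<le> \<Lambda>})"
    proof (rule finite_vimageI)
    show "finite {j. w j = x + w (u + 1) \<and> ereal \<bar>real j - real (u + 1 + v)\<bar> \<le> \<Lambda>}"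
      using assms unfolding locally_transient_def by blast
  qed (simp add: inj_on_def)
  also have "(\<lambda>j. u + 1 + j) -` {j. w j = x + w (u + 1) \<and> ereal \<bar>real j - real (u + 1 + v)\<bar> \<le> \<Lambda>}
     = {j. shift w u j = x \<and> ereal \<bar>real j - real v\<bar> \<le> \<Lambda>}"
    by (auto simp: shift_def)
  finally show "finite {j. shift w u j = x \<and> ereal \<bar>real j - real v\<bar> \<le> \<Lambda>}" .
qed

lemma erasure_time_0:
  assumes "locally_transient \<Lambda> w" "w 0 = 0" "0 \<le> \<Lambda>"
  shows "w (erasure_time \<Lambda> w 0) = 0" "ereal (real (erasure_time \<Lambda> w 0)) \<le> \<Lambda>"
    and "\<And>j. w j = 0 \<Longrightarrow> ereal (real j) \<le> \<Lambda> \<Longrightarrow> j \<le> erasure_time \<Lambda> w 0"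
proof -
  define X where "X = {j. w j = 0 \<and> ereal (real j) \<le> \<Lambda>}"
  have "finite {j. w j = 0 \<and> ereal \<bar>real j - real 0\<bar> \<le> \<Lambda>}"
    using assms(1) unfolding locally_transient_def by blast
  then have fin: "finite X" by (simp add: X_def)
  have "0 \<in> X" using assms by (simp add: X_def zero_ereal_def)
  then have eq: "erasure_time \<Lambda> w 0 = Max X"
    using fin by (auto simp: X_def[symmetric] intro: cSup_eq_Max)
  have "Max X \<in> X" using fin \<open>0 \<in> X\<close> by (intro Max_in) auto
  then show "w (erasure_time \<Lambda> w 0) = 0" "ereal (real (erasure_time \<Lambda> w 0)) \<le> \<Lambda>"
    by (auto simp: eq X_def simp del: erasure_time.simps)
  fix j assume "w j = 0" "ereal (real j) \<le> \<Lambda>"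
  then show "j \<le> erasure_time \<Lambda> w 0"
    unfolding eq using fin by (intro Max_ge) (auto simp: X_def)
qed

text \<open>
The erasure times are defined by appending one step at the end; loop erasure of lists recurses on the first
step. This identity translates one recursion into the other.
\<close>

lemma erasure_time_Suc:
  assumes "locally_transient \<Lambda> w" "0 \<le> \<Lambda>"
  defines "u \<equiv> erasure_time \<Lambda> w 0"
  shows "erasure_time \<Lambda> w (Suc i) = u + 1 + erasure_time \<Lambda> (shift w u) i"
proof (induction i)
  case 0
  define X where "X = {j. shift w u j = 0 \<and> ereal (real j) \<le> \<Lambda>}"
  have "finite {j. shift w u j = 0 \<and> ereal \<bar>real j - real 0\<bar> \<le> \<Lambda>}"
    using locally_transient_shift[OF assms(1)] unfolding locally_transient_def by blast
  then have fin: "finite X" by (simp add: X_def)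
  have ne: "X \<noteq> {}" using assms(2) by (auto simp: X_def shift_def zero_ereal_def intro!: exI[of _ 0])
  have "{j. j > u \<and> w j = w (u + 1) \<and> ereal \<bar>real j - real u - 1\<bar> \<le> \<Lambda>} = (\<lambda>j. u + 1 + j) ` X"
  proof (intro set_eqI iffI)
    fix j assume j: "j \<in> {j. j > u \<and> w j = w (u + 1) \<and> ereal \<bar>real j - real u - 1\<bar> \<le> \<Lambda>}"
    then obtain j' where j': "j = u + 1 + j'" using le_Suc_ex[of "u + 1" j] by auto
    have "j' \<in> X" using j unfolding X_def shift_def j' by (auto simp: algebra_simps)
    then show "j \<in> (\<lambda>j. u + 1 + j) ` X" using j' by blast
  qed (auto simp: X_def shift_def)
  then have "erasure_time \<Lambda> w (Suc 0) = Sup ((\<lambda>j. u + 1 + j) ` X)"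
    by (simp add: u_def)
  also have "\<dots> = Max ((\<lambda>j. u + 1 + j) ` X)" using fin ne by (intro cSup_eq_Max) auto
  also have "\<dots> = u + 1 + Max X"
    using fin ne by (intro mono_Max_commute[symmetric]) (auto simp: mono_def)
  also have "Max X = erasure_time \<Lambda> (shift w u) 0"
    using fin ne by (simp add: X_def[symmetric] cSup_eq_Max)
  finally show ?case .
next
  case (Suc i)
  define v where "v = erasure_time \<Lambda> (shift w u) i"
  have prev: "erasure_time \<Lambda> w (Suc i) = u + 1 + v" using Suc by (simp add: v_def)
  define X where "X = {j. j > v \<and> shift w u j = shift w u (v + 1) \<and> ereal \<bar>real j - real v - 1\<bar> \<le> \<Lambda>}"
  have "finite {j. shift w u j = shift w u (v + 1) \<and> ereal \<bar>real j - real (v + 1)\<bar> \<le> \<Lambda>}"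
    using locally_transient_shift[OF assms(1)] unfolding locally_transient_def by blast
  then have fin: "finite X"
    by (rule rev_finite_subset) (auto simp: X_def algebra_simps)
  have ne: "X \<noteq> {}" using assms(2) by (auto simp: X_def zero_ereal_def intro!: exI[of _ "v + 1"])
  have "{j. j > u + 1 + v \<and> w j = w (u + 1 + v + 1) \<and> ereal \<bar>real j - real (u + 1 + v) - 1\<bar> \<le> \<Lambda>} = (\<lambda>j. u + 1 + j) ` X"
  proof (intro set_eqI iffI)
    fix j assume j: "j \<in> {j. j > u + 1 + v \<and> w j = w (u + 1 + v + 1) \<and> ereal \<bar>real j - real (u + 1 + v) - 1\<bar> \<le> \<Lambda>}"
    then obtain j' where j': "j = u + 1 + j'" using le_Suc_ex[of "u + 1" j] by auto
    have "j' \<in> X" using j unfolding X_def shift_def j' by (auto simp: algebra_simps)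
    then show "j \<in> (\<lambda>j. u + 1 + j) ` X" using j' by blast
  qed (auto simp: X_def shift_def algebra_simps)
  then have "erasure_time \<Lambda> w (Suc (Suc i)) = Sup ((\<lambda>j. u + 1 + j) ` X)"
    using erasure_time.simps(2)[of \<Lambda> w "Suc i"] unfolding prev by simp
  also have "\<dots> = Max ((\<lambda>j. u + 1 + j) ` X)" using fin ne by (intro cSup_eq_Max) auto
  also have "\<dots> = u + 1 + Max X"
    using fin ne by (intro mono_Max_commute[symmetric]) (auto simp: mono_def)
  also have "Max X = erasure_time \<Lambda> (shift w u) (Suc i)"
    using cSup_eq_Max[OF fin ne] unfolding X_def by (simp only: erasure_time.simps(2) v_def)
  finally show ?case .
qed

lemma shift_0 [simp]: "shift w u 0 = 0"
  by (simp add: shift_def)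

lemma last_return_increments:
  assumes tr: "locally_transient \<Lambda> w" "w 0 = 0" "0 \<le> \<Lambda>"
    and n: "erasure_time \<Lambda> w 0 \<le> n" "erasure_time \<Lambda> w 0 \<le> L"
    and L: "\<And>j. j \<le> L \<Longrightarrow> ereal (real j) \<le> \<Lambda>"
  shows "last_return L (increments w n) = erasure_time \<Lambda> w 0"
proof (rule last_return_eqI)
  note e0 = erasure_time_0[OF tr]
  show "sum_list (take (erasure_time \<Lambda> w 0) (increments w n)) = 0"
    using n e0(1) tr(2) by (simp add: take_increments sum_list_increments del: erasure_time.simps)
  fix i assume i: "i \<le> length (increments w n)" "i \<le> L" "sum_list (take i (increments w n)) = 0"
  then have "w i = 0" using tr(2) by (simp add: take_increments sum_list_increments)
  then show "i \<le> erasure_time \<Lambda> w 0" using e0(3) L[OF i(2)] by blast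
qed (use n in \<open>auto simp del: erasure_time.simps\<close>)

lemma erase_increments_Suc:
  assumes tr: "locally_transient \<Lambda> w" "w 0 = 0" "0 \<le> \<Lambda>"
    and c: "last_return L (increments w n) = erasure_time \<Lambda> w 0" "erasure_time \<Lambda> w 0 < n"
  defines "u \<equiv> erasure_time \<Lambda> w 0"
  assumes IH: "erase L i (increments (shift w u) (n - u - 1)) = shift w u (erasure_time \<Lambda> (shift w u) i)"
  shows "erase L (Suc i) (increments w n) = w (erasure_time \<Lambda> w (Suc i))"
proof -
  have "w u = 0" unfolding u_def by (rule erasure_time_0(1)[OF tr])
  then show ?thesis
    using c drop_increments[of u n w] IH
    unfolding erasure_time_Suc[OF tr(1,3)] u_def[symmetric]
    by (simp add: shift_def)
qed

lemma erase_increments_finite: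
  assumes l: "0 \<le> l"
  defines "L \<equiv> nat \<lfloor>l\<rfloor>"
  shows "w 0 = 0 \<Longrightarrow> (i + 1) * (L + 1) \<le> n \<Longrightarrow> erase L i (increments w n) = w (erasure_time (ereal l) w i)"
proof (induction i arbitrary: w n)
  case 0
  then show ?case using erasure_time_0(1)[OF locally_transient_finite, of w l] l by simp
next
  case (Suc i)
  note tr = locally_transient_finite[of l w] Suc.prems(1)
  have l': "0 \<le> ereal l" using l by simp
  define u where "u = erasure_time (ereal l) w 0"
  have "ereal (real u) \<le> ereal l" unfolding u_def by (rule erasure_time_0(2)[OF tr l'])
  then have uL: "u \<le> L" unfolding L_def by simp linarith
  have un: "u < n" using uL Suc.prems(2) by simp
  have "last_return L (increments w n) = u"
    unfolding u_def
  proof (rule last_return_increments[OF tr l'])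
    fix j assume "j \<le> L"
    then have "int j \<le> \<lfloor>l\<rfloor>" unfolding L_def using l by linarith
    then show "ereal (real j) \<le> ereal l" by simp linarith
  qed (use uL un in \<open>auto simp: u_def[symmetric] simp del: erasure_time.simps\<close>)
  moreover have "erase L i (increments (shift w u) (n - u - 1)) = shift w u (erasure_time (ereal l) (shift w u) i)"
    using Suc.prems(2) uL by (intro Suc.IH) auto
  ultimately show ?case
    using un unfolding u_def by (intro erase_increments_Suc[OF tr l'])
qed

text \<open>
For a transient path the last return to each of finitely many points occurs at a finite time, so that a
large cutoff and a long initial segment give the same erased points as the whole path.
\<close>

lemma erase_increments_infinite:
  "w 0 = 0 \<Longrightarrow> (\<And>x. finite {j. w j = x}) \<Longrightarrow>
    \<exists>n0. \<forall>L\<ge>n0. \<forall>n\<ge>n0. erase L i (increments w n) = w (erasure_time \<infinity> w i)"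
proof (induction i arbitrary: w)
  case 0
  have "w (erasure_time \<infinity> w 0) = 0"
    by (rule erasure_time_0(1)[OF locally_transient_infinity[OF 0(2)] 0(1)]) simp
  then show ?case by (simp del: erasure_time.simps)
next
  case (Suc i)
  note tr = locally_transient_infinity[OF Suc.prems(2)] Suc.prems(1)
  define u where "u = erasure_time \<infinity> w 0"
  have fin: "finite {j. shift w u j = x}" for x
    using locally_transient_shift[OF tr(1), of u] unfolding locally_transient_def by simp
  have "\<exists>n0. \<forall>L\<ge>n0. \<forall>n\<ge>n0. erase L i (increments (shift w u) n) = shift w u (erasure_time \<infinity> (shift w u) i)"
    by (rule Suc.IH[OF shift_0 fin])
  then obtain n0 where n0: "\<And>L n. n0 \<le> L \<Longrightarrow> n0 \<le> n \<Longrightarrow>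
      erase L i (increments (shift w u) n) = shift w u (erasure_time \<infinity> (shift w u) i)"
    by blast
  have "erase L (Suc i) (increments w n) = w (erasure_time \<infinity> w (Suc i))"
    if "n0 + u + 1 \<le> L" "n0 + u + 1 \<le> n" for L n
  proof (rule erase_increments_Suc[OF tr])
    have "u \<le> n" "u \<le> L" using that by auto
    then show "last_return L (increments w n) = erasure_time \<infinity> w 0"
      unfolding u_def by (intro last_return_increments[OF tr]) auto
    show "erasure_time \<infinity> w 0 < n" using that unfolding u_def by linarith
    have "n0 \<le> L" "n0 \<le> n - u - 1" using that by auto
    from n0[OF this] show "erase L i (increments (shift w (erasure_time \<infinity> w 0)) (n - erasure_time \<infinity> w 0 - 1))
        = shift w (erasure_time \<infinity> w 0) (erasure_time \<infinity> (shift w (erasure_time \<infinity> w 0)) i)"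
      unfolding u_def .
  qed simp
  then show ?case by blast
qed

section \<open>Comparison of the two erased walks\<close>

lemma (in prob_space) integral_diff_le:
  fixes F G :: "'a \<Rightarrow> real"
  assumes F: "integrable M F" and G: "integrable M G" and B: "B \<in> events"
    and off: "AE \<omega> in M. \<omega> \<notin> B \<longrightarrow> F \<omega> = G \<omega>"
    and on: "AE \<omega> in M. \<bar>F \<omega> - G \<omega>\<bar> \<le> D"
  shows "\<bar>(\<integral>\<omega>. F \<omega> \<partial>M) - (\<integral>\<omega>. G \<omega> \<partial>M)\<bar> \<le> D * prob B"
proof -
  have "\<bar>(\<integral>\<omega>. F \<omega> \<partial>M) - (\<integral>\<omega>. G \<omega> \<partial>M)\<bar> = \<bar>\<integral>\<omega>. F \<omega> - G \<omega> \<partial>M\<bar>"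
    using F G by simp
  also have "\<dots> \<le> (\<integral>\<omega>. \<bar>F \<omega> - G \<omega>\<bar> \<partial>M)"
    by (rule integral_abs_bound)
  also have "\<dots> \<le> (\<integral>\<omega>. D * indicator B \<omega> \<partial>M)"
  proof (rule integral_mono_AE)
    show "integrable M (\<lambda>\<omega>. \<bar>F \<omega> - G \<omega>\<bar>)" using F G by simp
    show "integrable M (\<lambda>\<omega>. D * indicator B \<omega>)"
      using B by (intro integrable_mult_right) (simp add: emeasure_eq_measure)
    show "AE \<omega> in M. \<bar>F \<omega> - G \<omega>\<bar> \<le> D * indicator B \<omega>"
      using off on by eventually_elim (auto simp: indicator_def)
  qed
  also have "\<dots> = D * prob B" using B by simp
  finally show ?thesis .
qed

context walk
begin

definition erased :: "ereal \<Rightarrow> nat \<Rightarrow> 'a \<Rightarrow> site" where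
  "erased \<Lambda> i \<omega> = S (erasure_time \<Lambda> (\<lambda>n. S n \<omega>) i) \<omega>"

lemma S_pred [measurable]:
  "T \<in> M \<rightarrow>\<^sub>M count_space UNIV \<Longrightarrow> (\<lambda>\<omega>. S (T \<omega>) \<omega>) \<in> M \<rightarrow>\<^sub>M count_space UNIV"
  by (rule measurable_compose_countable[where f = S and g = T]) auto

lemma erasure_time_measurable [measurable]:
  "(\<lambda>\<omega>. erasure_time \<Lambda> (\<lambda>n. S n \<omega>) i) \<in> M \<rightarrow>\<^sub>M count_space UNIV"
proof (induction i)
  case 0
  have "Measurable.pred M (\<lambda>\<omega>. S j \<omega> = 0)" for j by measurable
  then have "Measurable.pred M (\<lambda>\<omega>. j \<in> {j. S j \<omega> = 0 \<and> ereal (real j) \<le> \<Lambda>})" for j by simp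
  then show ?case unfolding erasure_time.simps by (rule measurable_Sup_nat)
next
  case (Suc i)
  define T where "T \<omega> = erasure_time \<Lambda> (\<lambda>n. S n \<omega>) i" for \<omega>
  have [measurable]: "T \<in> M \<rightarrow>\<^sub>M count_space UNIV" using Suc by (simp add: T_def[abs_def])
  have "Measurable.pred M (\<lambda>\<omega>. T \<omega> < j \<and> S j \<omega> = S (T \<omega> + 1) \<omega> \<and> ereal \<bar>real j - real (T \<omega>) - 1\<bar> \<le> \<Lambda>)" for j
  proof -
    have "Measurable.pred M (\<lambda>\<omega>. (\<lambda>t \<omega>. t < j \<and> S j \<omega> = S (t + 1) \<omega> \<and> ereal \<bar>real j - real t - 1\<bar> \<le> \<Lambda>) (T \<omega>) \<omega>)"
      by (rule measurable_compose_countable[where g = T]) measurable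
    then show ?thesis by simp
  qed
  then show ?case unfolding erasure_time.simps T_def[symmetric] by (intro measurable_Sup_nat) simp
qed

lemma erased_measurable [measurable]: "erased \<Lambda> i \<in> M \<rightarrow>\<^sub>M count_space UNIV"
  unfolding erased_def[abs_def] by measurable

lemma erase_first_steps_finite:
  assumes "\<omega> \<in> space M" "0 \<le> l" "(i + 1) * (nat \<lfloor>l\<rfloor> + 1) \<le> n"
  shows "erase (nat \<lfloor>l\<rfloor>) i (first_steps n \<omega>) = erased (ereal l) i \<omega>"
  unfolding first_steps_def erased_def using assms by (intro erase_increments_finite) (auto simp: S_0)

lemma AE_erase_first_steps_infinite:
  "AE \<omega> in M. \<exists>n0. \<forall>i\<le>N. \<forall>L\<ge>n0. \<forall>n\<ge>n0. erase L i (first_steps n \<omega>) = erased \<infinity> i \<omega>"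
  using AE_finite_visits AE_space
proof eventually_elim
  case (elim \<omega>)
  have "\<exists>n0. \<forall>L\<ge>n0. \<forall>n\<ge>n0. erase L i (first_steps n \<omega>) = erased \<infinity> i \<omega>" for i
    unfolding first_steps_def erased_def using elim by (intro erase_increments_infinite) (auto simp: S_0)
  then obtain n0 where n0: "\<And>i L n. n0 i \<le> L \<Longrightarrow> n0 i \<le> n \<Longrightarrow> erase L i (first_steps n \<omega>) = erased \<infinity> i \<omega>"
    by metis
  have "n0 i \<le> Max (n0 ` {..N})" if "i \<le> N" for i using that by (intro Max_ge) auto
  then show ?case using n0 by (intro exI[of _ "Max (n0 ` {..N})"]) (meson le_trans)
qed

lemma AE_supn_erased:
  assumes "\<Lambda> = \<infinity> \<or> (\<exists>l\<ge>0. \<Lambda> = ereal l)"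
  shows "AE \<omega> in M. supn (erased \<Lambda> N \<omega>) \<le> int N"
proof -
  have words: "AE \<omega> in M. \<forall>n. first_steps n \<omega> \<in> words n"
    using AE_first_steps by (simp add: AE_all_countable)
  from assms show ?thesis
  proof
    assume \<Lambda>: "\<Lambda> = \<infinity>"
    show ?thesis
      using AE_erase_first_steps_infinite[of N] words
    proof eventually_elim
      case (elim \<omega>)
      then obtain n0 where "erase n0 N (first_steps n0 \<omega>) = erased \<infinity> N \<omega>" by blast
      moreover have "supn (erase n0 N (first_steps n0 \<omega>)) \<le> int N"
        using elim by (intro supn_erase_le words_set) auto
      ultimately show ?case by (simp add: \<Lambda>)
    qed
  next
    assume "\<exists>l\<ge>0. \<Lambda> = ereal l"
    then obtain l where l: "0 \<le> l" "\<Lambda> = ereal l" by blast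
    show ?thesis
      using AE_space words
    proof eventually_elim
      case (elim \<omega>)
      define n where "n = (N + 1) * (nat \<lfloor>l\<rfloor> + 1)"
      have "erase (nat \<lfloor>l\<rfloor>) N (first_steps n \<omega>) = erased \<Lambda> N \<omega>"
        unfolding l(2) using elim l(1) by (intro erase_first_steps_finite) (auto simp: n_def)
      moreover have "supn (erase (nat \<lfloor>l\<rfloor>) N (first_steps n \<omega>)) \<le> int N"
        using elim by (intro supn_erase_le words_set) auto
      ultimately show ?case by simp
    qed
  qed
qed

lemma AE_erased_infinity_neq_0: "AE \<omega> in M. erased \<infinity> (Suc i) \<omega> \<noteq> 0"
  using AE_finite_visits AE_space
proof eventually_elim
  case (elim \<omega>)
  define w where "w = (\<lambda>n. S n \<omega>)"
  have tr: "locally_transient \<infinity> w"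
    using elim by (intro locally_transient_infinity) (simp add: w_def)
  have w0: "w 0 = 0" using elim by (simp add: w_def S_0)
  have inf: "(0::ereal) \<le> \<infinity>" by simp
  have "w (erasure_time \<infinity> w (Suc i)) \<noteq> 0"
  proof
    assume "w (erasure_time \<infinity> w (Suc i)) = 0"
    then have "erasure_time \<infinity> w (Suc i) \<le> erasure_time \<infinity> w 0"
      using erasure_time_0(3)[OF tr w0 inf] by simp
    then show False unfolding erasure_time_Suc[OF tr inf] by simp
  qed
  then show ?case by (simp only: erased_def w_def not_False_eq_True)
qed

text \<open>
A single event of vanishing probability for all large cutoffs and list lengths, because the same list is
later erased with two different cutoffs.
\<close>

definition late :: "nat \<Rightarrow> nat \<Rightarrow> 'a set" where
  "late N m = {\<omega>\<in>space M. \<exists>L\<ge>m. \<exists>n\<ge>m. \<exists>i\<le>N. erase L i (first_steps n \<omega>) \<noteq> erased \<infinity> i \<omega>}"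

lemma late_measurable [measurable]: "late N m \<in> events"
proof -
  have "Measurable.pred M (\<lambda>\<omega>. erase L i (first_steps n \<omega>) \<noteq> erased \<infinity> i \<omega>)" for L i n
  proof -
    have [measurable]: "(\<lambda>\<omega>. erase L i (first_steps n \<omega>)) \<in> M \<rightarrow>\<^sub>M count_space UNIV"
      by (rule measurable_compose[OF first_steps_measurable]) simp
    show ?thesis by measurable
  qed
  then show ?thesis unfolding late_def by measurable
qed

lemma prob_late_tendsto_0: "(\<lambda>m. prob (late N m)) \<longlonglongrightarrow> 0"
proof -
  have "(\<lambda>m. prob (late N m)) \<longlonglongrightarrow> prob (\<Inter>m. late N m)"
  proof (rule finite_Lim_measure_decseq)
    show "decseq (late N)"
      unfolding decseq_def late_def by (auto; meson le_trans)
  qed auto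
  moreover have "prob (\<Inter>m. late N m) = 0"
  proof -
    have "AE \<omega> in M. \<omega> \<notin> (\<Inter>m. late N m)"
      using AE_erase_first_steps_infinite[of N] by eventually_elim (auto simp: late_def)
    then have "(\<Inter>m. late N m) \<in> null_sets M"
      by (subst (asm) AE_iff_null_sets[symmetric]) auto
    then show ?thesis by (simp add: measure_def null_setsD1)
  qed
  ultimately show ?thesis by simp
qed

lemma integrable_bounded_site:
  fixes F :: "site \<Rightarrow> real"
  assumes "T \<in> M \<rightarrow>\<^sub>M count_space UNIV" "AE \<omega> in M. supn (T \<omega>) \<le> int N"
  shows "integrable M (\<lambda>\<omega>. real_of_int (sq_norm (T \<omega>)))"
proof (rule integrable_const_bound)
  show "(\<lambda>\<omega>. real_of_int (sq_norm (T \<omega>))) \<in> borel_measurable M"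
    by (rule measurable_compose[OF assms(1)]) simp
  show "AE \<omega> in M. norm (real_of_int (sq_norm (T \<omega>))) \<le> 3 * (real N)\<^sup>2"
    using assms(2)
  proof eventually_elim
    case (elim \<omega>)
    then have "\<bar>real_of_int (supn (T \<omega>))\<bar> \<le> real N" by simp
    from sq_norm_diff_le[OF this, of 0 0] show ?case by (simp add: sq_norm_def)
  qed
qed

definition moment :: "ereal \<Rightarrow> nat \<Rightarrow> real" where
  "moment \<Lambda> N = (\<integral>\<omega>. real_of_int (sq_norm (erased \<Lambda> N \<omega>)) \<partial>M)"

lemma integrable_erased:
  "\<Lambda> = \<infinity> \<or> (\<exists>l\<ge>0. \<Lambda> = ereal l) \<Longrightarrow> integrable M (\<lambda>\<omega>. real_of_int (sq_norm (erased \<Lambda> N \<omega>)))"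
  by (rule integrable_bounded_site[OF erased_measurable AE_supn_erased])

lemma moment_infinity_ge_1: "1 \<le> moment \<infinity> (Suc i)"
proof -
  have "(\<integral>\<omega>. 1 \<partial>M) \<le> (\<integral>\<omega>. real_of_int (sq_norm (erased \<infinity> (Suc i) \<omega>)) \<partial>M)"
  proof (rule integral_mono_AE)
    show "AE \<omega> in M. 1 \<le> real_of_int (sq_norm (erased \<infinity> (Suc i) \<omega>))"
      using AE_erased_infinity_neq_0[of i]
    proof eventually_elim
      case (elim \<omega>)
      then have "supn (erased \<infinity> (Suc i) \<omega>) \<noteq> 0" by simp
      then have "1 \<le> supn (erased \<infinity> (Suc i) \<omega>)" using supn_nonneg[of "erased \<infinity> (Suc i) \<omega>"] by linarith
      then have "1 \<le> (supn (erased \<infinity> (Suc i) \<omega>))\<^sup>2" by simp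
      then have "1 \<le> sq_norm (erased \<infinity> (Suc i) \<omega>)" using supn_le_sq_norm by (rule order_trans)
      then show ?case by simp
    qed
  qed (auto intro: integrable_erased)
  then show ?thesis by (simp add: moment_def prob_space)
qed

lemma avg_moment_le:
  assumes "m \<le> L" "m \<le> n"
  shows "\<bar>avg n (\<lambda>xs. real_of_int (sq_norm (erase L N xs))) - moment \<infinity> N\<bar> \<le> 6 * (real N)\<^sup>2 * prob (late N m)"
  unfolding moment_def integral_first_steps[of "\<lambda>xs. real_of_int (sq_norm (erase L N xs))", symmetric]
proof (rule integral_diff_le)
  show "AE \<omega> in M. \<omega> \<notin> late N m \<longrightarrow> real_of_int (sq_norm (erase L N (first_steps n \<omega>))) = real_of_int (sq_norm (erased \<infinity> N \<omega>))"
    using AE_space by eventually_elim (use assms in \<open>auto simp: late_def\<close>)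
  show "AE \<omega> in M. \<bar>real_of_int (sq_norm (erase L N (first_steps n \<omega>))) - real_of_int (sq_norm (erased \<infinity> N \<omega>))\<bar> \<le> 6 * (real N)\<^sup>2"
    using AE_first_steps[of n] AE_supn_erased[of \<infinity> N, simplified]
  proof eventually_elim
    case (elim \<omega>)
    then have "\<bar>real_of_int (supn (erase L N (first_steps n \<omega>)))\<bar> \<le> real N" "\<bar>real_of_int (supn (erased \<infinity> N \<omega>))\<bar> \<le> real N"
      using supn_erase_le[OF words_set[OF elim(1)], of L N] by auto
    from sq_norm_diff_le[OF this] show ?case by simp
  qed
qed (auto intro: integrable_first_steps[of "\<lambda>xs. real_of_int (sq_norm (erase L N xs))"] integrable_erased)

text \<open>
The bound for the farthest point concerns lists whose length does not exceed the cutoff, whereas the maximal moment needs a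
list much longer than the cutoff. Outside \<open>late N m\<close> both situations give the same points.
\<close>

lemma max_moment_le:
  assumes "m \<le> L" "m \<le> n" "N * (L + 1) \<le> n"
  shows "max_moment L N \<le> real_of_int (ratio\<^sup>2) + 4 * real_of_int (ratio\<^sup>2) * moment \<infinity> N
    + (24 * real_of_int (ratio\<^sup>2) + 1) * (real N)\<^sup>2 * prob (late N m)"
proof -
  have "\<bar>(\<integral>\<omega>. (max_norm L N (first_steps n \<omega>))\<^sup>2 \<partial>M) - (\<integral>\<omega>. (max_norm n N (first_steps n \<omega>))\<^sup>2 \<partial>M)\<bar>
      \<le> (real N)\<^sup>2 * prob (late N m)"
  proof (rule integral_diff_le)
    show "AE \<omega> in M. \<omega> \<notin> late N m \<longrightarrow> (max_norm L N (first_steps n \<omega>))\<^sup>2 = (max_norm n N (first_steps n \<omega>))\<^sup>2"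
      using AE_space
    proof eventually_elim
      case (elim \<omega>)
      show ?case
      proof
        assume "\<omega> \<notin> late N m"
        then have "erase L i (first_steps n \<omega>) = erase n i (first_steps n \<omega>)" if "i \<le> N" for i
          using assms elim that unfolding late_def by simp
        then have "max_norm L N (first_steps n \<omega>) = max_norm n N (first_steps n \<omega>)" by (rule max_norm_cong)
        then show "(max_norm L N (first_steps n \<omega>))\<^sup>2 = (max_norm n N (first_steps n \<omega>))\<^sup>2" by simp
      qed
    qed
    show "AE \<omega> in M. \<bar>(max_norm L N (first_steps n \<omega>))\<^sup>2 - (max_norm n N (first_steps n \<omega>))\<^sup>2\<bar> \<le> (real N)\<^sup>2"
      using AE_first_steps[of n]
    proof eventually_elim
      case (elim \<omega>)
      have "0 \<le> (max_norm K N (first_steps n \<omega>))\<^sup>2 \<and> (max_norm K N (first_steps n \<omega>))\<^sup>2 \<le> (real N)\<^sup>2" for K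
        using max_norm_nonneg max_norm_le[OF words_set[OF elim]] by (auto intro: power_mono)
      from this[of L] this[of n] show ?case by linarith
    qed
  qed (rule integrable_first_steps[of "\<lambda>xs. (max_norm _ N xs)\<^sup>2"] late_measurable)+
  then have "max_moment L N \<le> avg n (\<lambda>xs. (max_norm n N xs)\<^sup>2) + (real N)\<^sup>2 * prob (late N m)"
    using avg_max_norm[OF assms(3)] unfolding integral_first_steps[of "\<lambda>xs. (max_norm _ N xs)\<^sup>2"] by simp
  also have "avg n (\<lambda>xs. (max_norm n N xs)\<^sup>2) \<le> real_of_int (ratio\<^sup>2)
      + 4 * real_of_int (ratio\<^sup>2) * avg n (\<lambda>xs. real_of_int ((supn (erase n N xs))\<^sup>2))"
    by (rule second_moment_max_le) simp
  also have "avg n (\<lambda>xs. real_of_int ((supn (erase n N xs))\<^sup>2)) \<le> avg n (\<lambda>xs. real_of_int (sq_norm (erase n N xs)))"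
    by (rule avg_mono) (simp only: of_int_le_iff supn_le_sq_norm)
  also have "\<dots> \<le> moment \<infinity> N + 6 * (real N)\<^sup>2 * prob (late N m)"
    using avg_moment_le[OF assms(2,2), of N] by linarith
  finally show ?thesis by (simp add: algebra_simps ratio_def)
qed

text \<open>
The comparison of two finite cutoffs, with the larger one sent to infinity together with the number of steps.
\<close>

lemma erased_comparison:
  fixes N :: nat and R :: int and l :: real
  assumes N: "1 \<le> N" and l: "0 \<le> l" and R: "int N < R"
  defines "q0 \<equiv> return_bound N R" and "\<eta> \<equiv> escape {x. R \<le> supn x} (nat \<lfloor>l\<rfloor>) 0"
  assumes q0: "q0 \<le> 1 / 8"
  shows "\<bar>moment (ereal l) N - moment \<infinity> N\<bar>
      \<le> (108 * (5 * real_of_int (ratio\<^sup>2) + 1) * q0 + 12 * ((real N)\<^sup>2 * \<eta>)) * moment \<infinity> N"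
    and "prob {\<omega>\<in>space M. erased (ereal l) N \<omega> \<noteq> erased \<infinity> N \<omega>} \<le> 2 * q0 + \<eta>"
proof -
  define L where "L = nat \<lfloor>l\<rfloor>"
  define A2 where "A2 = real_of_int (ratio\<^sup>2)"
  define d2 where "d2 = moment \<infinity> N"
  have A2: "0 \<le> A2" by (simp add: A2_def)
  have q0_nn: "0 \<le> q0"
    unfolding q0_def using R by (rule return_bound_nonneg)
  have d2: "1 \<le> d2"
    using moment_infinity_ge_1[of "N - 1"] N by (simp add: d2_def)
  have \<eta>_nn: "0 \<le> \<eta>" unfolding \<eta>_def by (rule escape_nonneg)
  \<comment> \<open>A cutoff \<open>L'\<close> and a number \<open>n\<close> of steps, both at least \<open>m\<close>, replace the infinite cutoff at the cost of
        \<open>prob (late N m)\<close>.\<close>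
  have bounds: "\<bar>moment (ereal l) N - d2\<bar> \<le> 108 * q0 * (A2 + 4 * A2 * d2 + 1) + 12 * ((real N)\<^sup>2 * \<eta>)
        + (108 * q0 * (24 * A2 + 1) + 6) * (real N)\<^sup>2 * prob (late N m)"
    "prob {\<omega>\<in>space M. erased (ereal l) N \<omega> \<noteq> erased \<infinity> N \<omega>} \<le> 2 * q0 + \<eta> + prob (late N m)" for m
  proof -
    define L' where "L' = max m L"
    define n where "n = max m (L + 2 * ((N + 1) * (L' + 1)))"
    have n: "L + 2 * ((N + 1) * (L' + 1)) \<le> n" "m \<le> n" "m \<le> L'" "L \<le> L'"
      by (auto simp: n_def L'_def)
    have Nn: "N * (L' + 1) \<le> n" using n(1) by simp
    have "(N + 1) * (L + 1) \<le> (N + 1) * (L' + 1)" using n by (intro mult_le_mono) auto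
    then have NL: "(N + 1) * (L + 1) \<le> n" using n(1) by linarith
    note cmp = cutoff_comparison[OF R n(4) q0[unfolded q0_def] n(1), folded q0_def]
    have \<eta>: "escape {x. R \<le> supn x} L 0 = \<eta>" by (simp add: \<eta>_def L_def)
    have erase: "erase L N (first_steps n \<omega>) = erased (ereal l) N \<omega>" if "\<omega> \<in> space M" for \<omega>
      unfolding L_def using that l NL by (intro erase_first_steps_finite) (auto simp: L_def)
    have "moment (ereal l) N = (\<integral>\<omega>. real_of_int (sq_norm (erase L N (first_steps n \<omega>))) \<partial>M)"
      unfolding moment_def by (intro Bochner_Integration.integral_cong) (auto simp: erase)
    then have c2: "moment (ereal l) N = avg n (\<lambda>xs. real_of_int (sq_norm (erase L N xs)))"
      using integral_first_steps[of "\<lambda>xs. real_of_int (sq_norm (erase L N xs))" n] by simp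
    have "\<bar>moment (ereal l) N - d2\<bar> \<le> 108 * q0 * (max_moment L' N + 1) + 12 * (real N)\<^sup>2 * \<eta> + 6 * (real N)\<^sup>2 * prob (late N m)"
      using cmp(1) avg_moment_le[OF n(3,2), of N] unfolding c2 d2_def \<eta> by linarith
    also have "108 * q0 * (max_moment L' N + 1) \<le> 108 * q0 * (A2 + 4 * A2 * d2 + (24 * A2 + 1) * (real N)\<^sup>2 * prob (late N m) + 1)"
      using max_moment_le[OF n(3,2) Nn] q0_nn unfolding A2_def d2_def
      by (intro mult_left_mono) auto
    finally show "\<bar>moment (ereal l) N - d2\<bar> \<le> 108 * q0 * (A2 + 4 * A2 * d2 + 1) + 12 * ((real N)\<^sup>2 * \<eta>)
        + (108 * q0 * (24 * A2 + 1) + 6) * (real N)\<^sup>2 * prob (late N m)"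
      by (simp add: algebra_simps)
    have ev: "{\<omega>\<in>space M. erase L N (first_steps n \<omega>) \<noteq> erase L' N (first_steps n \<omega>)} \<in> events"
    proof -
      have "(\<lambda>\<omega>. erase L N (first_steps n \<omega>) \<noteq> erase L' N (first_steps n \<omega>)) \<in> M \<rightarrow>\<^sub>M count_space UNIV"
        by (rule measurable_compose[OF first_steps_measurable]) simp
      then show ?thesis by (simp add: pred_def)
    qed
    have "prob {\<omega>\<in>space M. erased (ereal l) N \<omega> \<noteq> erased \<infinity> N \<omega>}
       \<le> prob ({\<omega>\<in>space M. erase L N (first_steps n \<omega>) \<noteq> erase L' N (first_steps n \<omega>)} \<union> late N m)"
    proof (rule finite_measure_mono)
      show "{\<omega>\<in>space M. erased (ereal l) N \<omega> \<noteq> erased \<infinity> N \<omega>}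
         \<subseteq> {\<omega>\<in>space M. erase L N (first_steps n \<omega>) \<noteq> erase L' N (first_steps n \<omega>)} \<union> late N m"
        using n erase unfolding late_def by auto
    qed (use ev in auto)
    also have "\<dots> \<le> prob {\<omega>\<in>space M. erase L N (first_steps n \<omega>) \<noteq> erase L' N (first_steps n \<omega>)} + prob (late N m)"
      using ev by (intro measure_Un_le) auto
    finally show "prob {\<omega>\<in>space M. erased (ereal l) N \<omega> \<noteq> erased \<infinity> N \<omega>} \<le> 2 * q0 + \<eta> + prob (late N m)"
      using cmp(2) prob_first_steps_Collect[of "\<lambda>xs. erase L N xs \<noteq> erase L' N xs" n] unfolding \<eta> by linarith
  qed
  have "\<bar>moment (ereal l) N - d2\<bar> \<le> 108 * q0 * (A2 + 4 * A2 * d2 + 1) + 12 * ((real N)\<^sup>2 * \<eta>)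
        + (108 * q0 * (24 * A2 + 1) + 6) * (real N)\<^sup>2 * 0"
  proof (rule LIMSEQ_le_const)
    show "(\<lambda>m. 108 * q0 * (A2 + 4 * A2 * d2 + 1) + 12 * ((real N)\<^sup>2 * \<eta>)
        + (108 * q0 * (24 * A2 + 1) + 6) * (real N)\<^sup>2 * prob (late N m))
      \<longlonglongrightarrow> 108 * q0 * (A2 + 4 * A2 * d2 + 1) + 12 * ((real N)\<^sup>2 * \<eta>)
        + (108 * q0 * (24 * A2 + 1) + 6) * (real N)\<^sup>2 * 0"
      by (rule tendsto_add[OF tendsto_const tendsto_mult[OF tendsto_const prob_late_tendsto_0]])
  qed (use bounds(1) in blast)
  also have "\<dots> \<le> (108 * (5 * A2 + 1) * q0 + 12 * ((real N)\<^sup>2 * \<eta>)) * d2"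
  proof -
    \<comment> \<open>The additive constants are absorbed because \<open>d2 \<ge> 1\<close>: the erased walk never revisits 0.\<close>
    have "A2 + 4 * A2 * d2 + 1 \<le> (5 * A2 + 1) * d2"
      using mult_left_mono[OF d2, of "A2 + 1"] A2 by (simp add: algebra_simps)
    then have "108 * q0 * (A2 + 4 * A2 * d2 + 1) \<le> 108 * q0 * ((5 * A2 + 1) * d2)"
      using q0_nn by (intro mult_left_mono) auto
    moreover have "12 * ((real N)\<^sup>2 * \<eta>) * 1 \<le> 12 * ((real N)\<^sup>2 * \<eta>) * d2"
      using d2 \<eta>_nn by (intro mult_left_mono) auto
    ultimately show ?thesis by (simp add: algebra_simps)
  qed
  finally show "\<bar>moment (ereal l) N - moment \<infinity> N\<bar>
      \<le> (108 * (5 * real_of_int (ratio\<^sup>2) + 1) * q0 + 12 * ((real N)\<^sup>2 * \<eta>)) * moment \<infinity> N"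
    unfolding A2_def d2_def .
  have "prob {\<omega>\<in>space M. erased (ereal l) N \<omega> \<noteq> erased \<infinity> N \<omega>} \<le> 2 * q0 + \<eta> + 0"
  proof (rule LIMSEQ_le_const)
    show "(\<lambda>m. 2 * q0 + \<eta> + prob (late N m)) \<longlonglongrightarrow> 2 * q0 + \<eta> + 0"
      by (rule tendsto_add[OF tendsto_const prob_late_tendsto_0])
  qed (use bounds(2) in blast)
  then show "prob {\<omega>\<in>space M. erased (ereal l) N \<omega> \<noteq> erased \<infinity> N \<omega>} \<le> 2 * q0 + \<eta>" by simp
qed

end

lemma escape_antimono: "m \<le> n \<Longrightarrow> escape K n x \<le> escape K m x"
  using escape_add_le[of K "n - m" 1 m x] escape_le_1[of K] by simp

section \<open>Choice of the radius and convergence together\<close>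

text \<open>
With \<open>a = 2 + 4\<delta>\<close> and \<open>R\<close> of order \<open>N powr (1 + \<delta>)\<close>, the ratio \<open>N / R\<close> tends to 0. The time
\<open>N powr a\<close> contains \<open>k\<close> blocks of length \<open>N powr a / k\<close>, in each of which the walk stays inside the cube with
probability of order \<open>N powr (2 + 2\<delta> - a) = N powr (-2\<delta>)\<close>. With \<open>k \<ge> 2 / \<delta>\<close> blocks the product is of order at most
\<open>N powr -4\<close>.
\<close>

lemma radius_exists:
  fixes a :: real
  assumes a: "2 < a"
  obtains R :: "nat \<Rightarrow> int" where
    "eventually (\<lambda>N. int N < R N) sequentially"
    "(\<lambda>N. return_bound N (R N)) \<longlonglongrightarrow> 0"
    "(\<lambda>N. (real N)\<^sup>2 * escape {x. R N \<le> supn x} (nat \<lfloor>real N powr a\<rfloor>) 0) \<longlonglongrightarrow> 0"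
proof
  define \<delta> where "\<delta> = (a - 2) / 4"
  have \<delta>: "0 < \<delta>" "a = 2 + 4 * \<delta>" using a by (auto simp: \<delta>_def field_simps)
  define R where "R N = \<lceil>2 * real N powr (1 + \<delta>)\<rceil>" for N :: nat
  define k where "k = nat \<lceil>2 / \<delta>\<rceil>"
  have "0 < 2 / \<delta>" using \<delta> by simp
  then have k: "0 < k" "2 / \<delta> \<le> real k" unfolding k_def by linarith+
  then have \<delta>k: "2 \<le> \<delta> * real k" using \<delta> by (simp add: field_simps)
  have pos: "real N \<le> real N powr (1 + \<delta>)" "1 \<le> real N powr (1 + \<delta>)" if "1 \<le> N" for N
    using powr_mono[of 1 "1 + \<delta>" "real N"] powr_mono[of 0 "1 + \<delta>" "real N"] that \<delta> by auto
  have R_lower: "real N powr (1 + \<delta>) \<le> real_of_int (R N - int N)" if "1 \<le> N" for N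
    using pos[OF that] le_of_int_ceiling[of "2 * real N powr (1 + \<delta>)"]
    unfolding R_def of_int_diff of_int_of_nat_eq by linarith
  have R_upper: "real_of_int (R N) \<le> 3 * real N powr (1 + \<delta>)" if "1 \<le> N" for N
    using pos[OF that] of_int_ceiling_le_add_one[of "2 * real N powr (1 + \<delta>)"] unfolding R_def by linarith
  have N_less_R: "int N < R N" if "1 \<le> N" for N
  proof -
    have "0 < real_of_int (R N - int N)" using R_lower[OF that] pos[OF that] by linarith
    then show ?thesis by simp
  qed
  then show "eventually (\<lambda>N. int N < R N) sequentially"
    by (intro eventually_sequentiallyI[of 1]) auto
  show "(\<lambda>N. return_bound N (R N)) \<longlonglongrightarrow> 0"
  proof (rule tendsto_sandwich)
    show "eventually (\<lambda>N. 0 \<le> return_bound N (R N)) sequentially"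
      using N_less_R by (intro eventually_sequentiallyI[of 1] return_bound_nonneg)
    show "eventually (\<lambda>N. return_bound N (R N) \<le> 2 * green_const * real N powr (- \<delta>)) sequentially"
    proof (intro eventually_sequentiallyI[of 1])
      fix N :: nat assume N: "1 \<le> N"
      have "return_bound N (R N) \<le> (2 * real N) * green_const / real N powr (1 + \<delta>)"
        unfolding return_bound_def using N R_lower[OF N] pos[OF N] green_const_pos
        by (intro frac_le mult_right_mono) auto
      also have "\<dots> = 2 * green_const * real N powr (- \<delta>)"
        using N by (simp add: powr_add powr_minus field_simps)
      finally show "return_bound N (R N) \<le> 2 * green_const * real N powr (- \<delta>)" .
    qed
    have "(\<lambda>N. real N powr (- \<delta>)) \<longlonglongrightarrow> 0"
      by (rule tendsto_neg_powr[OF _ filterlim_real_sequentially]) (use \<delta> in simp)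
    then show "(\<lambda>N. 2 * green_const * real N powr (- \<delta>)) \<longlonglongrightarrow> 0"
      by (rule tendsto_mult_right_zero)
  qed simp
  show "(\<lambda>N. (real N)\<^sup>2 * escape {x. R N \<le> supn x} (nat \<lfloor>real N powr a\<rfloor>) 0) \<longlonglongrightarrow> 0"
  proof (rule tendsto_sandwich)
    show "eventually (\<lambda>N. 0 \<le> (real N)\<^sup>2 * escape {x. R N \<le> supn x} (nat \<lfloor>real N powr a\<rfloor>) 0) sequentially"
      by (simp add: escape_nonneg)
    have "eventually (\<lambda>N. 2 * real k \<le> real N powr a) sequentially"
    proof (intro eventually_sequentiallyI[of "max 1 (2 * k)"])
      fix N assume "max 1 (2 * k) \<le> N"
      then have "1 \<le> real N" "2 * real k \<le> real N" by auto
      then show "2 * real k \<le> real N powr a"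
        using powr_mono[of 1 a "real N"] a by simp
    qed
    then show "eventually (\<lambda>N. (real N)\<^sup>2 * escape {x. R N \<le> supn x} (nat \<lfloor>real N powr a\<rfloor>) 0
        \<le> (54 * real k) ^ k * real N powr (- 2)) sequentially"
      using eventually_ge_at_top[of 1]
    proof eventually_elim
      case (elim N)
      define L where "L = nat \<lfloor>real N powr a\<rfloor>"
      define b where "b = L div k"
      have "real L = of_int \<lfloor>real N powr a\<rfloor>" unfolding L_def by simp
      then have "real N powr a - 1 \<le> real L" by linarith
      moreover have "real L = real k * real b + real (L mod k)"
        unfolding b_def by (metis mult_div_mod_eq of_nat_add of_nat_mult)
      moreover have "real (L mod k) \<le> real k - 1"
        using mod_less_divisor[OF k(1), of L] by linarith
      ultimately have "real N powr a - real k \<le> real k * real b" by linarith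
      then have b_lower: "real N powr a \<le> 2 * real k * real b" using elim(1) by linarith
      have Npos: "0 < real N powr a" using elim by simp
      have b: "0 < b"
        using b_lower Npos by (cases "b = 0") auto
      have R0: "0 \<le> R N" using N_less_R[OF elim(2)] by linarith
      have "escape {x. R N \<le> supn x} L 0 \<le> escape {x. R N \<le> supn x} (k * b) 0"
        by (rule escape_antimono) (simp add: b_def)
      also have "\<dots> \<le> (3 * (real_of_int (R N))\<^sup>2 / real b) ^ k"
        by (rule stay_power_le[OF b R0])
      also have "\<dots> \<le> (54 * real k * real N powr (- 2 * \<delta>)) ^ k"
      proof (rule power_mono)
        have "3 * (real_of_int (R N))\<^sup>2 \<le> 3 * (3 * real N powr (1 + \<delta>))\<^sup>2"
          using R_upper[OF elim(2)] R0 by (intro mult_left_mono power_mono) auto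
        also have "\<dots> = 27 * real N powr (2 + 2 * \<delta>)"
          using elim by (simp add: power_mult_distrib powr_power algebra_simps)
        finally have "3 * (real_of_int (R N))\<^sup>2 / real b \<le> 27 * real N powr (2 + 2 * \<delta>) / (real N powr a / (2 * real k))"
          using b_lower Npos k b by (intro frac_le) (auto simp: field_simps)
        also have "\<dots> = 54 * real k * (real N powr (2 + 2 * \<delta>) / real N powr a)" by simp
        also have "real N powr (2 + 2 * \<delta>) / real N powr a = real N powr (- 2 * \<delta>)"
          unfolding powr_diff[symmetric] \<delta>(2) by simp
        finally show "3 * (real_of_int (R N))\<^sup>2 / real b \<le> 54 * real k * real N powr (- 2 * \<delta>)" .
      qed simp
      also have "\<dots> = (54 * real k) ^ k * real N powr (- 2 * \<delta> * real k)"
        using elim by (simp add: power_mult_distrib powr_power mult_ac)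
      also have "\<dots> \<le> (54 * real k) ^ k * real N powr (- 4)"
        using elim \<delta>k by (intro mult_left_mono powr_mono) auto
      finally have "(real N)\<^sup>2 * escape {x. R N \<le> supn x} L 0 \<le> (real N)\<^sup>2 * ((54 * real k) ^ k * real N powr (- 4))"
        by (intro mult_left_mono) auto
      also have "\<dots> = (54 * real k) ^ k * (real N powr 2 * real N powr (- 4))"
        using elim by (simp add: powr_numeral)
      also have "real N powr 2 * real N powr (- 4) = real N powr (- 2)"
        unfolding powr_add[symmetric] by simp
      finally show ?case by (simp add: L_def)
    qed
    have "(\<lambda>N. real N powr (- 2)) \<longlonglongrightarrow> 0"
      by (rule tendsto_neg_powr[OF _ filterlim_real_sequentially]) simp
    then show "(\<lambda>N. (54 * real k) ^ k * real N powr (- 2)) \<longlonglongrightarrow> 0"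
      by (rule tendsto_mult_right_zero)
  qed simp
qed

text \<open>
A form of Slutsky's lemma that presupposes no convergence: the second moments of \<open>Y\<close> are bounded, so
\<open>Y\<close> is tight, and on compact sets \<open>f\<close> is uniformly continuous.
\<close>

lemma (in prob_space) converging_together:
  fixes X Y :: "nat \<Rightarrow> 'a \<Rightarrow> 'b :: euclidean_space" and r :: "nat \<Rightarrow> real" and f :: "'b \<Rightarrow> real"
  assumes X [measurable]: "\<And>n. X n \<in> borel_measurable M" and Y [measurable]: "\<And>n. Y n \<in> borel_measurable M"
    and r: "r \<longlonglongrightarrow> 1"
    and eq: "(\<lambda>n. prob {\<omega>\<in>space M. X n \<omega> \<noteq> r n *\<^sub>R Y n \<omega>}) \<longlonglongrightarrow> 0"
    and int: "\<And>n. integrable M (\<lambda>\<omega>. (norm (Y n \<omega>))\<^sup>2)" and mom: "\<And>n. (\<integral>\<omega>. (norm (Y n \<omega>))\<^sup>2 \<partial>M) \<le> 1"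
    and f: "continuous_on UNIV f" "bounded (range f)"
  shows "(\<lambda>n. (\<integral>\<omega>. f (X n \<omega>) \<partial>M) - (\<integral>\<omega>. f (Y n \<omega>) \<partial>M)) \<longlonglongrightarrow> 0"
proof -
  obtain B where B: "0 < B" "\<And>x. \<bar>f x\<bar> \<le> B"
    using f(2) unfolding bounded_pos by auto
  have [measurable]: "f \<in> borel_measurable borel" using f(1) by (rule borel_measurable_continuous_onI)
  have fint: "integrable M (\<lambda>\<omega>. f (U \<omega>))" if [measurable]: "U \<in> borel_measurable M" for U
    by (rule integrable_const_bound[of _ B]) (use B in auto)
  have bound: "\<bar>f x - f y\<bar> \<le> 2 * B" for x y using B(2)[of x] B(2)[of y] by linarith
  show ?thesis
  proof (rule LIMSEQ_I)
    fix e :: real assume e: "0 < e"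
    \<comment> \<open>Beyond norm \<open>K\<close>, Chebyshev bounds the loss by \<open>2 B / K^2 \<le> e / 4\<close>.\<close>
    define K where "K = sqrt (8 * B / e) + 1"
    have K: "1 \<le> K" "8 * B / e \<le> K\<^sup>2"
    proof -
      have "0 \<le> sqrt (8 * B / e)" using B e by simp
      then show "1 \<le> K" by (simp add: K_def)
      have "(sqrt (8 * B / e))\<^sup>2 \<le> K\<^sup>2" unfolding K_def using B e by (intro power_mono) auto
      then show "8 * B / e \<le> K\<^sup>2" using B e by simp
    qed
    have "uniformly_continuous_on (cball 0 (2 * K)) f"
      using f(1) by (intro compact_uniformly_continuous) (auto intro: continuous_on_subset)
    then obtain d where d: "0 < d" "\<And>x y. x \<in> cball 0 (2 * K) \<Longrightarrow> y \<in> cball 0 (2 * K) \<Longrightarrow> dist x y < d \<Longrightarrow> dist (f x) (f y) < e / 4"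
      unfolding uniformly_continuous_on_def using e by (metis divide_pos_pos zero_less_numeral)
    have "eventually (\<lambda>n. dist (r n) 1 < min 1 (d / K)) sequentially"
      using r d K by (intro tendstoD) auto
    moreover have "eventually (\<lambda>n. dist (prob {\<omega>\<in>space M. X n \<omega> \<noteq> r n *\<^sub>R Y n \<omega>}) 0 < e / (8 * B)) sequentially"
      using eq e B by (intro tendstoD) auto
    ultimately have "eventually (\<lambda>n. norm ((\<integral>\<omega>. f (X n \<omega>) \<partial>M) - (\<integral>\<omega>. f (Y n \<omega>) \<partial>M) - 0) < e) sequentially"
    proof eventually_elim
      case (elim n)
      define E1 where "E1 = {\<omega>\<in>space M. X n \<omega> \<noteq> r n *\<^sub>R Y n \<omega>}"
      define E2 where "E2 = {\<omega>\<in>space M. K < norm (Y n \<omega>)}"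
      have [measurable]: "E1 \<in> events" "E2 \<in> events" unfolding E1_def E2_def by measurable
      have r1: "\<bar>r n - 1\<bar> < 1" "\<bar>r n - 1\<bar> * K < d"
        using elim(1) K by (auto simp: dist_real_def field_simps)
      have E2: "prob E2 \<le> 1 / K\<^sup>2"
      proof -
        have "K\<^sup>2 * prob E2 = (\<integral>\<omega>. K\<^sup>2 * indicator E2 \<omega> \<partial>M)" by simp
        also have "\<dots> \<le> (\<integral>\<omega>. (norm (Y n \<omega>))\<^sup>2 \<partial>M)"
        proof (rule integral_mono)
          show "integrable M (\<lambda>\<omega>. K\<^sup>2 * indicator E2 \<omega>)"
            by (intro integrable_mult_right) (simp add: emeasure_eq_measure)
          fix \<omega> show "K\<^sup>2 * indicator E2 \<omega> \<le> (norm (Y n \<omega>))\<^sup>2"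
            using K by (auto simp: E2_def indicator_def intro!: power_mono)
        qed (rule int)
        also have "\<dots> \<le> 1" by (rule mom)
        finally show ?thesis using K by (simp add: field_simps)
      qed
      have pt: "\<bar>f (X n \<omega>) - f (Y n \<omega>)\<bar> \<le> e / 4 + 2 * B * indicator E1 \<omega> + 2 * B * indicator E2 \<omega>"
        if \<omega>: "\<omega> \<in> space M" for \<omega>
      proof (cases "\<omega> \<in> E1 \<or> \<omega> \<in> E2")
        case True
        then show ?thesis using bound[of "X n \<omega>" "Y n \<omega>"] e B by (auto simp: indicator_def)
      next
        case False
        then have X_eq: "X n \<omega> = r n *\<^sub>R Y n \<omega>" and Y_le: "norm (Y n \<omega>) \<le> K"
          using \<omega> by (auto simp: E1_def E2_def)
        have "norm (X n \<omega>) \<le> 2 * K"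
          unfolding X_eq norm_scaleR using r1(1) Y_le K by (intro mult_mono) auto
        moreover have "dist (X n \<omega>) (Y n \<omega>) < d"
        proof -
          have "X n \<omega> - Y n \<omega> = (r n - 1) *\<^sub>R Y n \<omega>" by (simp add: X_eq scaleR_left_diff_distrib)
          then have "dist (X n \<omega>) (Y n \<omega>) = \<bar>r n - 1\<bar> * norm (Y n \<omega>)" by (simp add: dist_norm)
          also have "\<dots> \<le> \<bar>r n - 1\<bar> * K" using Y_le by (intro mult_left_mono) auto
          finally show ?thesis using r1 by simp
        qed
        ultimately have "dist (f (X n \<omega>)) (f (Y n \<omega>)) < e / 4"
          using Y_le K by (intro d(2)) auto
        then show ?thesis using False by (simp add: dist_real_def indicator_def)
      qed
      have "\<bar>(\<integral>\<omega>. f (X n \<omega>) \<partial>M) - (\<integral>\<omega>. f (Y n \<omega>) \<partial>M)\<bar> = \<bar>\<integral>\<omega>. f (X n \<omega>) - f (Y n \<omega>) \<partial>M\<bar>"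
        using fint by simp
      also have "\<dots> \<le> (\<integral>\<omega>. \<bar>f (X n \<omega>) - f (Y n \<omega>)\<bar> \<partial>M)" by (rule integral_abs_bound)
      also have "\<dots> \<le> (\<integral>\<omega>. e / 4 + 2 * B * indicator E1 \<omega> + 2 * B * indicator E2 \<omega> \<partial>M)"
        using fint by (intro integral_mono pt) (auto simp: emeasure_eq_measure)
      also have "\<dots> = e / 4 + 2 * B * prob E1 + 2 * B * prob E2"
        by (simp add: emeasure_eq_measure prob_space)
      also have "2 * B * prob E1 < 2 * B * (e / (8 * B))"
        using elim(2) B by (intro mult_strict_left_mono) (auto simp: E1_def)
      also have "2 * B * prob E2 \<le> 2 * B * (e / (8 * B))"
      proof (intro mult_left_mono)
        have "1 / K\<^sup>2 \<le> 1 / (8 * B / e)" using K B e by (intro divide_left_mono) auto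
        then show "prob E2 \<le> e / (8 * B)" using E2 by simp
      qed (use B in simp)
      finally show ?case using B e by simp
    qed
    then show "\<exists>n0. \<forall>n\<ge>n0. norm ((\<integral>\<omega>. f (X n \<omega>) \<partial>M) - (\<integral>\<omega>. f (Y n \<omega>) \<partial>M) - 0) < e"
      by (simp add: eventually_sequentially)
  qed
qed

theorem theorem2p3:
  fixes M :: "'a measure"
    and S :: "nat \<Rightarrow> 'a \<Rightarrow> int ^ 3"
    and \<alpha> :: ereal
    and c d :: "nat \<Rightarrow> real"
    and X Y :: "nat \<Rightarrow> 'a \<Rightarrow> real ^ 3"
  assumes srw: "simple_random_walk M S"
    and c: "\<And>N. c N = sqrt (\<integral>\<omega>. (norm (erased_walk_end \<alpha> S N \<omega>))\<^sup>2 \<partial>M)"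
    and d: "\<And>N. d N = sqrt (\<integral>\<omega>. (norm (erased_walk_end \<infinity> S N \<omega>))\<^sup>2 \<partial>M)"
    and X: "\<And>N \<omega>. X N \<omega> = erased_walk_end \<alpha> S N \<omega> /\<^sub>R c N"
    and Y: "\<And>N \<omega>. Y N \<omega> = erased_walk_end \<infinity> S N \<omega> /\<^sub>R d N"
    and conv: "(\<exists>\<nu>. converges_in_distribution M X \<nu>) \<or> (\<exists>\<nu>. converges_in_distribution M Y \<nu>)"
    and alpha: "2 < \<alpha>"
  shows "\<exists>\<nu>. converges_in_distribution M X \<nu> \<and> converges_in_distribution M Y \<nu>"
proof (cases "\<alpha> = \<infinity>")
  case True
  then have "X = Y" by (intro ext) (simp add: X Y c d)
  then show ?thesis using conv by auto
next
  case False
  then obtain a where a: "\<alpha> = ereal a" "2 < a" using alpha by (cases \<alpha>) auto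
  interpret prob_space M using srw by (simp add: simple_random_walk_def)
  interpret walk M S by unfold_locales (rule srw)
  define Z where "Z N = erased (ereal (real N powr a)) N" for N
  define W where "W N = erased \<infinity> N" for N
  have end_Z: "erased_walk_end \<alpha> S N \<omega> = real_vec (Z N \<omega>)" for N \<omega>
    by (simp add: erased_walk_end_def Z_def erased_def loop_cutoff_def a)
  have end_W: "erased_walk_end \<infinity> S N \<omega> = real_vec (W N \<omega>)" for N \<omega>
    by (simp add: erased_walk_end_def W_def erased_def loop_cutoff_def)
  have c2: "c N = sqrt (moment (ereal (real N powr a)) N)" for N
    by (simp add: c end_Z norm_real_vec moment_def Z_def)
  have d2: "d N = sqrt (moment \<infinity> N)" for N
    by (simp add: d end_W norm_real_vec moment_def W_def)
  have XZ: "X N \<omega> = real_vec (Z N \<omega>) /\<^sub>R c N" and YW: "Y N \<omega> = real_vec (W N \<omega>) /\<^sub>R d N" for N \<omega>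
    by (simp_all add: X Y end_Z end_W)
  have X_meas: "X N \<in> borel_measurable M" for N
    unfolding XZ[abs_def] Z_def
    by (rule measurable_compose[OF erased_measurable, where g = "\<lambda>x. real_vec x /\<^sub>R c N"]) simp
  have Y_meas: "Y N \<in> borel_measurable M" for N
    unfolding YW[abs_def] W_def
    by (rule measurable_compose[OF erased_measurable, where g = "\<lambda>x. real_vec x /\<^sub>R d N"]) simp
  obtain R :: "nat \<Rightarrow> int" where R: "eventually (\<lambda>N. int N < R N) sequentially"
    and q_lim: "(\<lambda>N. return_bound N (R N)) \<longlonglongrightarrow> 0"
    and \<eta>_lim: "(\<lambda>N. (real N)\<^sup>2 * escape {x. R N \<le> supn x} (nat \<lfloor>real N powr a\<rfloor>) 0) \<longlonglongrightarrow> 0"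
    using radius_exists[OF a(2)] by blast
  define q where "q N = return_bound N (R N)" for N
  define \<eta> where "\<eta> N = escape {x. R N \<le> supn x} (nat \<lfloor>real N powr a\<rfloor>) 0" for N
  define \<epsilon> where "\<epsilon> N = 108 * (5 * real_of_int (ratio\<^sup>2) + 1) * q N + 12 * ((real N)\<^sup>2 * \<eta> N)" for N
  have "\<epsilon> \<longlonglongrightarrow> 108 * (5 * real_of_int (ratio\<^sup>2) + 1) * 0 + 12 * 0"
    unfolding \<epsilon>_def[abs_def] q_def \<eta>_def
    by (intro tendsto_add tendsto_mult tendsto_const q_lim \<eta>_lim)
  then have \<epsilon>_lim: "\<epsilon> \<longlonglongrightarrow> 0" by simp
  have cmp: "eventually (\<lambda>N. \<bar>moment (ereal (real N powr a)) N - moment \<infinity> N\<bar> \<le> \<epsilon> N * moment \<infinity> N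
      \<and> prob {\<omega>\<in>space M. Z N \<omega> \<noteq> W N \<omega>} \<le> 2 * q N + \<eta> N \<and> 1 \<le> moment \<infinity> N \<and> \<epsilon> N < 1) sequentially"
    using R eventually_ge_at_top[of 1] order_tendstoD(2)[OF q_lim, of "1 / 8", simplified] order_tendstoD(2)[OF \<epsilon>_lim, of 1, simplified]
  proof eventually_elim
    case (elim N)
    have l: "0 \<le> real N powr a" and q8: "return_bound N (R N) \<le> 1 / 8" using elim by auto
    note * = erased_comparison[OF elim(2) l elim(1) q8]
    show ?case
      using * moment_infinity_ge_1[of "N - 1"] elim unfolding \<epsilon>_def q_def \<eta>_def Z_def W_def by simp
  qed
  \<comment> \<open>On \<open>{Z = W}\<close> the two normalised endpoints differ by this deterministic factor.\<close>
  define r where "r N = d N / c N" for N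
  have "(\<lambda>N. moment (ereal (real N powr a)) N / moment \<infinity> N - 1) \<longlonglongrightarrow> 0"
  proof (rule Lim_null_comparison[OF _ \<epsilon>_lim])
    show "eventually (\<lambda>N. norm (moment (ereal (real N powr a)) N / moment \<infinity> N - 1) \<le> \<epsilon> N) sequentially"
      using cmp
    proof eventually_elim
      case (elim N)
      then have "\<bar>(moment (ereal (real N powr a)) N - moment \<infinity> N) / moment \<infinity> N\<bar> \<le> \<epsilon> N"
        by (simp add: abs_divide divide_le_eq)
      moreover have "(moment (ereal (real N powr a)) N - moment \<infinity> N) / moment \<infinity> N
          = moment (ereal (real N powr a)) N / moment \<infinity> N - 1"
        using elim by (simp add: diff_divide_distrib)
      ultimately show ?case by simp
    qed
  qed
  then have "(\<lambda>N. moment (ereal (real N powr a)) N / moment \<infinity> N) \<longlonglongrightarrow> 1"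
    using LIM_zero_iff[of "\<lambda>N. moment (ereal (real N powr a)) N / moment \<infinity> N" 1] by simp
  then have "(\<lambda>N. inverse (sqrt (moment (ereal (real N powr a)) N / moment \<infinity> N))) \<longlonglongrightarrow> inverse (sqrt 1)"
    by (intro tendsto_inverse tendsto_real_sqrt) auto
  then have r_lim: "r \<longlonglongrightarrow> 1"
    unfolding r_def[abs_def] c2 d2 by (simp add: real_sqrt_divide)
  have neq_lim: "(\<lambda>N. prob {\<omega>\<in>space M. X N \<omega> \<noteq> r N *\<^sub>R Y N \<omega>}) \<longlonglongrightarrow> 0"
  proof (rule Lim_null_comparison)
    show "eventually (\<lambda>N. norm (prob {\<omega>\<in>space M. X N \<omega> \<noteq> r N *\<^sub>R Y N \<omega>}) \<le> 2 * q N + (real N)\<^sup>2 * \<eta> N) sequentially"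
      using cmp eventually_ge_at_top[of 1]
    proof eventually_elim
      case (elim N)
      have "0 < d N" using elim by (simp add: d2)
      then have "{\<omega>\<in>space M. X N \<omega> \<noteq> r N *\<^sub>R Y N \<omega>} \<subseteq> {\<omega>\<in>space M. Z N \<omega> \<noteq> W N \<omega>}"
        by (auto simp: XZ YW r_def divide_inverse mult.commute)
      moreover have "{\<omega>\<in>space M. Z N \<omega> \<noteq> W N \<omega>} \<in> events"
        unfolding Z_def W_def by measurable
      ultimately have "prob {\<omega>\<in>space M. X N \<omega> \<noteq> r N *\<^sub>R Y N \<omega>} \<le> prob {\<omega>\<in>space M. Z N \<omega> \<noteq> W N \<omega>}"
        by (rule finite_measure_mono)
      also have "\<dots> \<le> 2 * q N + 1 * \<eta> N" using elim by simp
      also have "\<dots> \<le> 2 * q N + (real N)\<^sup>2 * \<eta> N"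
        using elim(2) by (intro add_left_mono mult_right_mono) (auto simp: \<eta>_def escape_nonneg)
      finally show ?case by simp
    qed
    have "(\<lambda>N. 2 * q N + (real N)\<^sup>2 * \<eta> N) \<longlonglongrightarrow> 2 * 0 + 0"
      unfolding q_def \<eta>_def by (intro tendsto_add tendsto_mult tendsto_const q_lim \<eta>_lim)
    then show "(\<lambda>N. 2 * q N + (real N)\<^sup>2 * \<eta> N) \<longlonglongrightarrow> 0" by simp
  qed
  have norm_Y: "(norm (Y N \<omega>))\<^sup>2 = real_of_int (sq_norm (W N \<omega>)) / (d N)\<^sup>2" for N \<omega>
    by (simp add: YW norm_real_vec power_divide power_mult_distrib divide_inverse power_inverse mult.commute)
  have d_nn: "0 \<le> moment \<infinity> N" for N
    unfolding moment_def by (intro Bochner_Integration.integral_nonneg) simp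
  have int_Y: "integrable M (\<lambda>\<omega>. (norm (Y N \<omega>))\<^sup>2)" for N
    unfolding norm_Y W_def by (intro integrable_divide integrable_erased) simp
  have mom_Y: "(\<integral>\<omega>. (norm (Y N \<omega>))\<^sup>2 \<partial>M) \<le> 1" for N
  proof -
    have "(\<integral>\<omega>. (norm (Y N \<omega>))\<^sup>2 \<partial>M) = moment \<infinity> N / moment \<infinity> N"
      unfolding norm_Y W_def d2 using d_nn by (simp add: moment_def)
    then show ?thesis by simp
  qed
  have diff: "(\<lambda>N. (\<integral>\<omega>. f (X N \<omega>) \<partial>M) - (\<integral>\<omega>. f (Y N \<omega>) \<partial>M)) \<longlonglongrightarrow> 0"
    if "continuous_on UNIV f" "bounded (range f)" for f :: "real ^ 3 \<Rightarrow> real"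
    using X_meas Y_meas r_lim neq_lim int_Y mom_Y that by (rule converging_together)
  have XY: "converges_in_distribution M X \<nu> \<longleftrightarrow> converges_in_distribution M Y \<nu>" for \<nu>
  proof -
    have "(\<lambda>N. \<integral>\<omega>. f (X N \<omega>) \<partial>M) \<longlonglongrightarrow> L \<longleftrightarrow> (\<lambda>N. \<integral>\<omega>. f (Y N \<omega>) \<partial>M) \<longlonglongrightarrow> L"
      if "continuous_on UNIV f" "bounded (range f)" for f :: "real ^ 3 \<Rightarrow> real" and L
      using tendsto_add[OF _ diff[OF that], of "\<lambda>N. \<integral>\<omega>. f (Y N \<omega>) \<partial>M" L]
        tendsto_diff[OF _ diff[OF that], of "\<lambda>N. \<integral>\<omega>. f (X N \<omega>) \<partial>M" L] by auto
    then show ?thesis unfolding converges_in_distribution_def using X_meas Y_meas by blast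
  qed
  then show ?thesis using conv by blast
qed

end
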